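(* Let $a,b\in\mathbb{R}\setminus\{0\}$ and let $\nu_1,\nu_2:\mathbb{R}^2\to\mathbb{R}$ be smooth functions with $\nu_1(0,0)=0=\nu_2(0,0)$ and $$\frac{\partial \nu_1}{\partial j}(0,0)=0,\qquad \frac{\partial^2 \nu_1}{\partial j^2}(0,0)\neq 0,\qquad \frac{\partial \nu_1}{\partial t}(0,0)\neq 0 .$$ Let $f_{j,t}(q,p)$ be a smooth function on $\mathbb{R}^2$ depending on two real parameters $j,t$, and assume that there are coordinate changes by smooth functions such that the $6$-jet of $f_{j,t}$ at the origin can be put in the form $$H_{j,t}(q,p)=\frac{a}{2}p^2+\frac{b}{6}q^6+\frac{\nu_1(j,t)}{2}q^2+\frac{\nu_2(j,t)}{4}q^4 .$$ Then the system given by $f_{j,t}$ goes through a double flip bifurcation as $t$ passes through $0$. Moreover, for $t=\tau$ sufficiently close to $0$, let $j_0^{\pm}=j_0^{\pm}(\tau)$ be such that $\nu_1(j_0^{\pm},\tau)=0$ and $\nu_2(j_0^{\pm},\tau)\neq 0$. Then Hamiltonian flip bifurcations (with respect to the parameter $j$, at fixed $t=\tau$) occur at $(j,t)=(j_0^{\pm},\tau)$. If $a\,\nu_2(j_0^{\pm},\tau)<0$ the bifurcation is a dual Hamiltonian flip bifurcation, and if $a\,\nu_2(j_0^{\pm},\tau)>0$ it is a (non-dual) Hamiltonian flip bifurcation.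
   Context: We consider one-degree-of-freedom Hamiltonian systems on $\mathbb{R}^2$ with coordinates $(q,p)$ and symplectic form $dq\wedge dp$, invariant under the $\mathbb{Z}_2$-action $(q,p)\mapsto(-q,-p)$; the origin is a singular (equilibrium) point. A singular point $x$ is stable (in the sense of Lyapunov) if all points in a sufficiently small neighbourhood of $x$ remain close to $x$ under the flow for all time; otherwise it is unstable. It is a centre if all eigenvalues of the linearised system are non-zero and purely imaginary, and a saddle if the linearisation has no purely imaginary eigenvalues ($0$ counted as purely imaginary). Hamiltonian flip bifurcation (for a family depending on a parameter $j$, with the origin a singular point): if the origin is stable and becomes unstable as $j$ passes through $j_0$, while at the same time an additional singularity which is a centre is produced, the origin undergoes a Hamiltonian flip bifurcation at $j=j_0$. If the origin is unstable and becomes stable as $j$ passes through $j_0$, while at the same time an additional singularity which is a saddle is produced, it undergoes a dual Hamiltonian flip bifurcation at $j=j_0$. Double flip bifurcation: a two-parameter family (parameters $j,t$) goes through a double flip bifurcation as $t$ passes through $0$ if, for $t$ close to $0$ on one side of $0$, there is no value of $j$ near $0$ at which the origin undergoes a (dual or non-dual) Hamiltonian flip bifurcation with respect to $j$, whereas for $t$ close to $0$ on the other side there are exactly two such values $j_0^-(t)\neq j_0^+(t)$ near $0$, which both tend to $0$ as $t\to 0$. *)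

theory Defs
  imports "HOL-Analysis.Analysis"
begin

fun Ck :: "nat \<Rightarrow> ('a::euclidean_space \<Rightarrow> real) \<Rightarrow> bool" where
  "Ck 0 g = continuous_on UNIV g"
| "Ck (Suc k) g = (g differentiable_on UNIV \<and>
      (\<forall>b\<in>Basis. Ck k (\<lambda>x. frechet_derivative g (at x) b)))"

definition smooth :: "('a::euclidean_space \<Rightarrow> real) \<Rightarrow> bool" where
  "smooth g \<longleftrightarrow> (\<forall>k. Ck k g)"

definition dq :: "(real \<Rightarrow> real \<Rightarrow> real) \<Rightarrow> real \<Rightarrow> real \<Rightarrow> real" where
  "dq g = (\<lambda>q p. deriv (\<lambda>s. g s p) q)"

definition dp :: "(real \<Rightarrow> real \<Rightarrow> real) \<Rightarrow> real \<Rightarrow> real \<Rightarrow> real" where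
  "dp g = (\<lambda>q p. deriv (\<lambda>s. g q s) p)"

definition partials :: "nat \<Rightarrow> nat \<Rightarrow> (real \<Rightarrow> real \<Rightarrow> real) \<Rightarrow> real \<Rightarrow> real \<Rightarrow> real" where
  "partials m n g = (dq ^^ m) ((dp ^^ n) g)"

definition same_jet_at0 :: "nat \<Rightarrow> (real \<Rightarrow> real \<Rightarrow> real) \<Rightarrow> (real \<Rightarrow> real \<Rightarrow> real) \<Rightarrow> bool" where
  "same_jet_at0 k g h \<longleftrightarrow> (\<forall>m n. m + n \<le> k \<longrightarrow> partials m n g 0 0 = partials m n h 0 0)"

definition ham_solution :: "(real \<Rightarrow> real \<Rightarrow> real) \<Rightarrow> (real \<Rightarrow> real \<times> real) \<Rightarrow> real set \<Rightarrow> bool" where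
  "ham_solution g x I \<longleftrightarrow> (\<forall>s\<in>I.
     (x has_vector_derivative (dp g (fst (x s)) (snd (x s)), - dq g (fst (x s)) (snd (x s))))
       (at s within I))"

definition singular_point :: "(real \<Rightarrow> real \<Rightarrow> real) \<Rightarrow> real \<Rightarrow> real \<Rightarrow> bool" where
  "singular_point g q p \<longleftrightarrow> dq g q p = 0 \<and> dp g q p = 0"

definition stable_origin :: "(real \<Rightarrow> real \<Rightarrow> real) \<Rightarrow> bool" where
  "stable_origin g \<longleftrightarrow> (\<forall>\<epsilon>>0. \<exists>\<delta>>0. \<forall>I x.
     is_interval I \<and> 0 \<in> I \<and> ham_solution g x I \<and> norm (x 0) < \<delta> \<longrightarrow>
     (\<forall>s\<in>I. norm (x s) < \<epsilon>))"

text \<open>Eigenvalues of the linearisation of the Hamiltonian vector field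
  (dg/dp, -dg/dq) at (q,p): the 2x2 matrix A = [[g_pq, g_pp], [-g_qq, -g_qp]];
  eigenvalues are the complex roots of det(lambda I - A).\<close>
definition lin_eigenvalues :: "(real \<Rightarrow> real \<Rightarrow> real) \<Rightarrow> real \<Rightarrow> real \<Rightarrow> complex set" where
  "lin_eigenvalues g q p =
    (let a11 = dq (dp g) q p; a12 = dp (dp g) q p;
         a21 = - dq (dq g) q p; a22 = - dp (dq g) q p
     in {z::complex. (z - of_real a11) * (z - of_real a22) - of_real a12 * of_real a21 = 0})"

definition is_centre :: "(real \<Rightarrow> real \<Rightarrow> real) \<Rightarrow> real \<Rightarrow> real \<Rightarrow> bool" where
  "is_centre g q p \<longleftrightarrow> singular_point g q p \<and>
     (\<forall>z\<in>lin_eigenvalues g q p. z \<noteq> 0 \<and> Re z = 0)"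

definition is_saddle :: "(real \<Rightarrow> real \<Rightarrow> real) \<Rightarrow> real \<Rightarrow> real \<Rightarrow> bool" where
  "is_saddle g q p \<longleftrightarrow> singular_point g q p \<and>
     (\<forall>z\<in>lin_eigenvalues g q p. Re z \<noteq> 0)"

text \<open>Generic shape: for j on one side of j0 the origin has property B ("before"),
  on the other side it does not; on that other side additional singular points of
  type T (distinct from the origin) are produced, i.e. they exist arbitrarily close
  to the origin for j close to j0; on the "before" side there are no singular
  points near the origin other than the origin. The side is arbitrary
  (sigma = 1 or -1).\<close>
definition flip_shape ::
  "(real \<Rightarrow> real \<Rightarrow> real \<Rightarrow> real) \<Rightarrow> real \<Rightarrow> ((real \<Rightarrow> real \<Rightarrow> real) \<Rightarrow> bool)
     \<Rightarrow> ((real \<Rightarrow> real \<Rightarrow> real) \<Rightarrow> real \<Rightarrow> real \<Rightarrow> bool) \<Rightarrow> bool" where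
  "flip_shape G j0 B T \<longleftrightarrow> (\<exists>\<sigma>::real\<in>{-1,1}. \<exists>\<epsilon>>0.
     (\<forall>j. 0 < \<sigma> * (j0 - j) \<and> \<sigma> * (j0 - j) < \<epsilon> \<longrightarrow> B (G j)) \<and>
     (\<forall>j. 0 < \<sigma> * (j - j0) \<and> \<sigma> * (j - j0) < \<epsilon> \<longrightarrow> \<not> B (G j)) \<and>
     (\<forall>r>0. \<exists>\<delta>>0. \<forall>j. 0 < \<sigma> * (j - j0) \<and> \<sigma> * (j - j0) < \<delta> \<longrightarrow>
         (\<exists>q p. (q, p) \<noteq> (0, 0) \<and> norm (q, p) < r \<and> T (G j) q p)) \<and>
     (\<exists>r>0. \<forall>j. 0 < \<sigma> * (j0 - j) \<and> \<sigma> * (j0 - j) < \<epsilon> \<longrightarrow>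
         (\<forall>q p. singular_point (G j) q p \<and> norm (q, p) < r \<longrightarrow> (q, p) = (0, 0))))"

definition ham_flip :: "(real \<Rightarrow> real \<Rightarrow> real \<Rightarrow> real) \<Rightarrow> real \<Rightarrow> bool" where
  "ham_flip G j0 \<longleftrightarrow> flip_shape G j0 stable_origin is_centre"

definition dual_ham_flip :: "(real \<Rightarrow> real \<Rightarrow> real \<Rightarrow> real) \<Rightarrow> real \<Rightarrow> bool" where
  "dual_ham_flip G j0 \<longleftrightarrow> flip_shape G j0 (\<lambda>g. \<not> stable_origin g) is_saddle"

definition double_flip :: "(real \<Rightarrow> real \<Rightarrow> real \<Rightarrow> real \<Rightarrow> real) \<Rightarrow> bool" where
  "double_flip G \<longleftrightarrow> (\<exists>\<sigma>::real\<in>{-1,1}. \<exists>\<epsilon>>0. \<exists>\<delta>>0.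
     (\<forall>t. 0 < \<sigma> * t \<and> \<sigma> * t < \<delta> \<longrightarrow>
        \<not> (\<exists>j. \<bar>j\<bar> < \<epsilon> \<and> (ham_flip (\<lambda>j. G j t) j \<or> dual_ham_flip (\<lambda>j. G j t) j))) \<and>
     (\<exists>jm jp :: real \<Rightarrow> real.
        (\<forall>t. 0 < - \<sigma> * t \<and> - \<sigma> * t < \<delta> \<longrightarrow> jm t \<noteq> jp t \<and>
           {j. \<bar>j\<bar> < \<epsilon> \<and> (ham_flip (\<lambda>j. G j t) j \<or> dual_ham_flip (\<lambda>j. G j t) j)} = {jm t, jp t}) \<and>
        (jm \<longlongrightarrow> 0) (at 0 within {t. 0 < - \<sigma> * t}) \<and>
        (jp \<longlongrightarrow> 0) (at 0 within {t. 0 < - \<sigma> * t})))"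

definition Hnf :: "real \<Rightarrow> real \<Rightarrow> (real \<Rightarrow> real \<Rightarrow> real) \<Rightarrow> (real \<Rightarrow> real \<Rightarrow> real)
                    \<Rightarrow> real \<Rightarrow> real \<Rightarrow> real \<Rightarrow> real \<Rightarrow> real" where
  "Hnf a b \<nu>1 \<nu>2 j t q p = a / 2 * p ^ 2 + b / 6 * q ^ 6 + \<nu>1 j t / 2 * q ^ 2 + \<nu>2 j t / 4 * q ^ 4"

end

theory Submission
  imports Defs
begin

text \<open>The change of coordinates matches critical points near the origin, and at these the Hessian
  determinant of \<open>f\<close> pulled back along \<open>\<phi>\<close> is that of \<open>f\<close> times the squared Jacobian, and in one
  degree of freedom the sign of the Hessian determinant decides between centre and saddle. It also
  decides stability of a non-degenerate origin: if it is positive, energy conservation confines the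
  orbits, and if it is negative, a Chetaev function expels them. At the origin the
  sign is that of \<open>a \<nu>1\<close>, so a flip can only occur where \<open>\<nu>1\<close> vanishes.

  At a simple zero of \<open>\<nu>1\<close> in \<open>j\<close>, the equation \<open>\<partial>H/\<partial>p = 0\<close> is solved by
  \<open>p = O(q^6)\<close>, and \<open>\<partial>H/\<partial>q = 0\<close> becomes \<open>q (\<nu>1 + \<nu>2 q^2 + b q^4 + O(q^5)) = 0\<close>, a pitchfork with
  leading term \<open>\<nu>2 q^2\<close>, or \<open>b q^4\<close> if \<open>\<nu>2\<close> vanishes at the zero. Hence every simple zero of \<open>\<nu>1\<close> is a flip.
  Finally \<open>\<nu>1\<close> has a fold at the origin: it is strictly convex or concave in \<open>j\<close> and monotone in \<open>t\<close>, so
  it has no zeros in \<open>j\<close> on one side of \<open>t = 0\<close> and exactly two, both simple, on the other.\<close>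

section \<open>Smooth functions\<close>

text \<open>Stability quantifies over solutions on arbitrary intervals, so proving it needs no
  solution to exist, whereas instability must exhibit one. There the assumed stability serves as the
  a priori bound: it keeps orbits in a ball, outside of which the field may be cut off to become
  globally Lipschitz.

  A flip compares neighbouring values of \<open>j\<close> at frozen \<open>t\<close>, so remainder
  bounds and inverse functions have to be uniform in \<open>j\<close>. The coordinate change need
  not be symplectic; this is harmless because orbits are never transported, only critical points and
  signs of Hessian determinants.

  The count of exactly two flips carries no assumption on \<open>\<nu>2\<close>, so a simple zero of
  \<open>\<nu>1\<close> at which \<open>\<nu>2\<close> vanishes has to be a flip too. Measuring
  errors relative to \<open>|\<nu>1| + q^m\<close>, with \<open>m\<close> equal to 2 or 4, treats
  both cases alike: at a critical point off the origin \<open>\<nu>1\<close> nearly cancels the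
  leading term, so such errors stay small even in the Hessian determinant.\<close>

lemma Ck_SucI:
  assumes "\<And>x. (g has_derivative g' x) (at x)"
    and "\<And>b. b \<in> Basis \<Longrightarrow> Ck k (\<lambda>x. g' x b)"
  shows "Ck (Suc k) g"
proof -
  have "frechet_derivative g (at x) = g' x" for x
    using frechet_derivative_at[OF assms(1)] by simp
  then show ?thesis
    using assms by (auto simp: differentiable_on_def differentiable_def)
qed

lemma Ck_Suc_has_derivative:
  assumes "Ck (Suc k) g"
  shows "(g has_derivative frechet_derivative g (at x)) (at x)"
  using assms by (auto simp: differentiable_on_def frechet_derivative_works)

lemma Ck_SucD: "Ck (Suc k) g \<Longrightarrow> Ck k g"
  by (induction k arbitrary: g) (auto simp: differentiable_imp_continuous_on)

lemma Ck_const: "Ck k (\<lambda>x. c)"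
proof (induction k arbitrary: c)
  case (Suc k)
  show ?case
    by (rule Ck_SucI[where g' = "\<lambda>x h. 0"]) (use Suc in auto)
qed simp

lemma Ck_add: "Ck k f \<Longrightarrow> Ck k g \<Longrightarrow> Ck k (\<lambda>x. f x + g x)"
proof (induction k arbitrary: f g)
  case (Suc k)
  show ?case
    using Suc
    by (intro Ck_SucI[OF has_derivative_add[OF Ck_Suc_has_derivative[OF Suc.prems(1)]
            Ck_Suc_has_derivative[OF Suc.prems(2)]]]) simp
qed (auto intro: continuous_intros)

lemma Ck_mult: "Ck k f \<Longrightarrow> Ck k g \<Longrightarrow> Ck k (\<lambda>x. f x * g x)"
proof (induction k arbitrary: f g)
  case (Suc k)
  show ?case
    using Suc.prems Ck_SucD[OF Suc.prems(1)] Ck_SucD[OF Suc.prems(2)]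
    by (intro Ck_SucI[OF has_derivative_mult[OF Ck_Suc_has_derivative[OF Suc.prems(1)]
            Ck_Suc_has_derivative[OF Suc.prems(2)]]] Ck_add Suc.IH) auto
qed (auto intro: continuous_intros)

lemma Ck_sum: "(\<And>i. i \<in> A \<Longrightarrow> Ck k (f i)) \<Longrightarrow> Ck k (\<lambda>x. \<Sum>i\<in>A. f i x)"
  by (induction A rule: infinite_finite_induct) (auto intro: Ck_const Ck_add)

lemma Ck_bounded_linear:
  assumes "bounded_linear L"
  shows "Ck k L"
proof (cases k)
  case 0
  then show ?thesis
    using assms by (simp add: linear_continuous_on)
next
  case (Suc l)
  show ?thesis
    unfolding Suc
    by (rule Ck_SucI[OF bounded_linear.has_derivative[OF assms has_derivative_ident]])
      (rule Ck_const)
qed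

text \<open>Smoothness is only expressed for real-valued maps, so the inner map enters through its
  components. The induction keeps \<open>\<Phi>\<close> fixed and varies \<open>f\<close>: a
  derivative of the composite is a sum of products of a derivative of a component with a partial
  derivative of \<open>f\<close> taken along \<open>\<Phi>\<close>, and the induction hypothesis
  covers the latter.\<close>

lemma Ck_compose:
  fixes f :: "'b::euclidean_space \<Rightarrow> real" and \<Phi> :: "'a::euclidean_space \<Rightarrow> 'b"
  assumes "Ck k f" "\<And>i. i \<in> Basis \<Longrightarrow> Ck k (\<lambda>x. \<Phi> x \<bullet> i)"
  shows "Ck k (\<lambda>x. f (\<Phi> x))"
  using assms
proof (induction k arbitrary: f)
  case 0
  have "continuous_on UNIV \<Phi>"
    using 0(2) continuous_on_componentwise[of UNIV \<Phi>] by simp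
  then show ?case
    using 0(1) by (auto intro: continuous_on_compose2[of UNIV f UNIV \<Phi>])
next
  case (Suc k)
  define D where "D x h = (\<Sum>i\<in>Basis. frechet_derivative (\<lambda>x. \<Phi> x \<bullet> i) (at x) h *\<^sub>R i)" for x h
  have D: "(\<Phi> has_derivative D x) (at x)" for x
    unfolding has_derivative_componentwise_within[of \<Phi>]
  proof
    fix i :: 'b assume i: "i \<in> Basis"
    have "(\<lambda>h. D x h \<bullet> i) = frechet_derivative (\<lambda>x. \<Phi> x \<bullet> i) (at x)"
      using i by (auto simp: D_def)
    then show "((\<lambda>x. \<Phi> x \<bullet> i) has_derivative (\<lambda>h. D x h \<bullet> i)) (at x)"
      using Ck_Suc_has_derivative[OF Suc.prems(2)[OF i]] by simp
  qed
  have "Ck k (\<lambda>x. frechet_derivative f (at (\<Phi> x)) (D x b))" if b: "b \<in> Basis" for b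
  proof -
    have lin: "linear (frechet_derivative f (at y))" for y
      using Ck_Suc_has_derivative[OF Suc.prems(1), of y] has_derivative_linear by blast
    have "frechet_derivative f (at (\<Phi> x)) (D x b) =
        (\<Sum>i\<in>Basis. frechet_derivative (\<lambda>x. \<Phi> x \<bullet> i) (at x) b
           * frechet_derivative f (at (\<Phi> x)) i)" for x
      by (simp add: D_def linear_sum[OF lin] linear_scale[OF lin])
    moreover have "Ck k (\<lambda>x. \<Sum>i\<in>Basis. frechet_derivative (\<lambda>x. \<Phi> x \<bullet> i) (at x) b
           * frechet_derivative f (at (\<Phi> x)) i)"
    proof (intro Ck_sum Ck_mult)
      fix i :: 'b assume i: "i \<in> Basis"
      show "Ck k (\<lambda>x. frechet_derivative (\<lambda>x. \<Phi> x \<bullet> i) (at x) b)"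
        using Suc.prems(2)[OF i] b by simp
      show "Ck k (\<lambda>x. frechet_derivative f (at (\<Phi> x)) i)"
      proof (rule Suc.IH)
        show "Ck k (\<lambda>y. frechet_derivative f (at y) i)"
          using Suc.prems(1) i by simp
      qed (rule Ck_SucD[OF Suc.prems(2)])
    qed
    ultimately show ?thesis by simp
  qed
  then show ?case
    by (intro Ck_SucI[OF has_derivative_compose[OF D Ck_Suc_has_derivative[OF Suc.prems(1)]]])
qed

lemma smooth_const: "smooth (\<lambda>x. c)"
  by (simp add: smooth_def Ck_const)

lemma smooth_add: "smooth f \<Longrightarrow> smooth g \<Longrightarrow> smooth (\<lambda>x. f x + g x)"
  by (simp add: smooth_def Ck_add)

lemma smooth_mult: "smooth f \<Longrightarrow> smooth g \<Longrightarrow> smooth (\<lambda>x. f x * g x)"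
  by (simp add: smooth_def Ck_mult)

lemma smooth_diff: "smooth f \<Longrightarrow> smooth g \<Longrightarrow> smooth (\<lambda>x. f x - g x)"
  using smooth_add[of f "\<lambda>x. (- 1) * g x"] smooth_mult[OF smooth_const, of g "- 1"] by simp

lemma smooth_power: "smooth f \<Longrightarrow> smooth (\<lambda>x. f x ^ n)"
  by (induction n) (auto intro: smooth_const smooth_mult)

lemma smooth_bounded_linear: "bounded_linear L \<Longrightarrow> smooth L"
  by (simp add: smooth_def Ck_bounded_linear)

lemma smooth_compose:
  fixes \<Phi> :: "'a::euclidean_space \<Rightarrow> 'b::euclidean_space"
  assumes "smooth f" "\<And>i. i \<in> Basis \<Longrightarrow> smooth (\<lambda>x. \<Phi> x \<bullet> i)"
  shows "smooth (\<lambda>x. f (\<Phi> x))"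
  using assms by (simp add: smooth_def Ck_compose)

lemma smooth_compose2:
  assumes "smooth f" "smooth (u::'a::euclidean_space \<Rightarrow> real)" "smooth v"
  shows "smooth (\<lambda>x. f (u x, v x))"
  by (rule smooth_compose[OF assms(1)])
    (use assms in \<open>auto simp: Basis_prod_def smooth_const\<close>)

lemma smooth_compose3:
  assumes "smooth f" "smooth (u::'a::euclidean_space \<Rightarrow> real)" "smooth v" "smooth w"
  shows "smooth (\<lambda>x. f (u x, v x, w x))"
  by (rule smooth_compose[OF assms(1)])
    (use assms in \<open>auto simp: Basis_prod_def smooth_const\<close>)

lemma smooth_compose4:
  assumes "smooth f" "smooth (u::'a::euclidean_space \<Rightarrow> real)" "smooth v" "smooth w" "smooth z"
  shows "smooth (\<lambda>x. f ((u x, v x), (w x, z x)))"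
  by (rule smooth_compose[OF assms(1)])
    (use assms in \<open>auto simp: Basis_prod_def smooth_const\<close>)

lemma smooth_has_derivative:
  assumes "smooth f"
  shows "(f has_derivative frechet_derivative f (at x)) (at x)"
  using assms Ck_Suc_has_derivative[of 0] unfolding smooth_def by blast

lemma smooth_frechet_derivative:
  "smooth f \<Longrightarrow> b \<in> Basis \<Longrightarrow> smooth (\<lambda>x. frechet_derivative f (at x) b)"
  unfolding smooth_def by (metis Ck.simps(2))

lemma smooth_continuous_on: "smooth f \<Longrightarrow> continuous_on S f"
  unfolding smooth_def by (metis Ck.simps(1) continuous_on_subset subset_UNIV)

lemma smooth_deriv:
  fixes f :: "real \<Rightarrow> real"
  assumes "smooth f"
  shows "(f has_real_derivative deriv f x) (at x)" "smooth (deriv f)"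
proof -
  have *: "(f has_real_derivative frechet_derivative f (at x) 1) (at x)" for x
    using smooth_has_derivative[OF assms, of x]
    by (metis DERIV_deriv_iff_real_differentiable differentiable_def
        frechet_derivative_at has_field_derivative_def mult_1_right real_differentiable_def)
  then have "deriv f = (\<lambda>x. frechet_derivative f (at x) 1)"
    by (auto intro: DERIV_imp_deriv)
  then show "(f has_real_derivative deriv f x) (at x)" "smooth (deriv f)"
    using * smooth_frechet_derivative[OF assms, of 1] by auto
qed

lemma dq_eqI: "((\<lambda>s. g s p) has_real_derivative D) (at q) \<Longrightarrow> dq g q p = D"
  by (simp add: dq_def DERIV_imp_deriv)

lemma dp_eqI: "((\<lambda>s. g q s) has_real_derivative D) (at p) \<Longrightarrow> dp g q p = D"
  by (simp add: dp_def DERIV_imp_deriv)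

section \<open>Families of functions on the plane\<close>

text \<open>Here \<open>t\<close> is frozen and \<open>j\<close> is kept as a variable: joint
  smoothness is what gives bounds uniform in \<open>j\<close> and lets \<open>j\<close> take part in
  the inverse function theorem. A single function of two variables is treated as a constant
  family.\<close>

definition smooth_family :: "(real \<Rightarrow> real \<Rightarrow> real \<Rightarrow> real) \<Rightarrow> bool" where
  "smooth_family G \<longleftrightarrow> smooth (\<lambda>(j, q, p). G j q p)"

text \<open>Restricting the total derivative to the three coordinate lines identifies its entries
  with the partial derivatives; closure of smoothness under derivatives in basis directions then
  passes to families.\<close>

lemma
  assumes "smooth_family G"
  shows smooth_family_has_derivative: "((\<lambda>(j, q, p). G j q p) has_derivative
        (\<lambda>(i, h, k). deriv (\<lambda>i. G i q p) j * i + dq (G j) q p * h + dp (G j) q p * k))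
        (at (j, q, p))"
    and smooth_family_dj: "smooth_family (\<lambda>j q p. deriv (\<lambda>i. G i q p) j)"
    and smooth_family_dq: "smooth_family (\<lambda>j. dq (G j))"
    and smooth_family_dp: "smooth_family (\<lambda>j. dp (G j))"
proof -
  let ?G = "\<lambda>(j, q, p). G j q p"
  define D where "D j q p = frechet_derivative ?G (at (j, q, p))" for j q p
  have sm: "smooth ?G"
    using assms by (simp add: smooth_family_def)
  have hd: "(?G has_derivative D j q p) (at (j, q, p))" for j q p
    using smooth_has_derivative[OF sm] by (simp add: D_def)
  have lin: "linear (D j q p)" for j q p
    using hd has_derivative_linear by blast
  define E1 E2 E3 where "E1 j q p = D j q p (1,0,0)" "E2 j q p = D j q p (0,1,0)"
    "E3 j q p = D j q p (0,0,1)" for j q p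
  have D_eq: "D j q p (i, h, k) = E1 j q p * i + E2 j q p * h + E3 j q p * k" for j q p i h k
  proof -
    have "(i, h, k) = i *\<^sub>R (1,0,0) + h *\<^sub>R (0,1,0) + k *\<^sub>R (0,0,1::real)"
      by simp
    then show ?thesis
      by (simp only: linear_add[OF lin] linear_scale[OF lin] E1_E2_E3_def[symmetric])
        (simp add: mult.commute)
  qed
  have dj: "deriv (\<lambda>i. G i q p) j = E1 j q p" for j q p
  proof -
    have "((\<lambda>s. ?G (s, q, p)) has_derivative (\<lambda>h. D j q p (h, 0, 0))) (at j)"
      by (rule has_derivative_compose[of "\<lambda>s. (s, q, p)" "\<lambda>h. (h, 0, 0)" j UNIV ?G, OF _ hd])
        (auto intro!: derivative_eq_intros simp: zero_prod_def)
    then have "((\<lambda>s. G s q p) has_real_derivative E1 j q p) (at j)"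
      by (simp add: has_field_derivative_def D_eq)
    then show ?thesis
      by (rule DERIV_imp_deriv)
  qed
  have dq: "dq (G j) q p = E2 j q p" for j q p
  proof -
    have "((\<lambda>s. ?G (j, s, p)) has_derivative (\<lambda>h. D j q p (0, h, 0))) (at q)"
      by (rule has_derivative_compose[of "\<lambda>s. (j, s, p)" "\<lambda>h. (0, h, 0)" q UNIV ?G, OF _ hd])
        (auto intro!: derivative_eq_intros)
    then have "((\<lambda>s. G j s p) has_real_derivative E2 j q p) (at q)"
      by (simp add: has_field_derivative_def D_eq)
    then show ?thesis
      by (simp add: dq_def DERIV_imp_deriv)
  qed
  have dp: "dp (G j) q p = E3 j q p" for j q p
  proof -
    have "((\<lambda>s. ?G (j, q, s)) has_derivative (\<lambda>h. D j q p (0, 0, h))) (at p)"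
      by (rule has_derivative_compose[of "\<lambda>s. (j, q, s)" "\<lambda>h. (0, 0, h)" p UNIV ?G, OF _ hd])
        (auto intro!: derivative_eq_intros)
    then have "((\<lambda>s. G j q s) has_real_derivative E3 j q p) (at p)"
      by (simp add: has_field_derivative_def D_eq)
    then show ?thesis
      by (simp add: dp_def DERIV_imp_deriv)
  qed
  have "D j q p = (\<lambda>(i, h, k). deriv (\<lambda>i. G i q p) j * i + dq (G j) q p * h + dp (G j) q p * k)"
    by (auto simp: D_eq dj dq dp)
  then show "(?G has_derivative
      (\<lambda>(i, h, k). deriv (\<lambda>i. G i q p) j * i + dq (G j) q p * h + dp (G j) q p * k)) (at (j, q, p))"
    using hd[of j q p] by simp
  have *: "smooth (\<lambda>(j, q, p). D j q p b)" if "b \<in> Basis" for b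
    using smooth_frechet_derivative[OF sm that] by (simp add: D_def case_prod_unfold)
  have basis: "(1::real,0::real,0::real) \<in> Basis" "(0::real,1::real,0::real) \<in> Basis"
    "(0::real,0::real,1::real) \<in> Basis"
    by (auto simp: Basis_prod_def zero_prod_def)
  show "smooth_family (\<lambda>j q p. deriv (\<lambda>i. G i q p) j)"
    using *[OF basis(1)] by (simp add: smooth_family_def dj E1_E2_E3_def)
  show "smooth_family (\<lambda>j. dq (G j))"
    using *[OF basis(2)] by (simp add: smooth_family_def dq E1_E2_E3_def)
  show "smooth_family (\<lambda>j. dp (G j))"
    using *[OF basis(3)] by (simp add: smooth_family_def dp E1_E2_E3_def)
qed

section \<open>Closure properties and chain rules for smooth families\<close>

lemma smooth_proj: "smooth (\<lambda>(j::real, q::real, p::real). j)" "smooth (\<lambda>(j::real, q::real, p::real). q)"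
  "smooth (\<lambda>(j::real, q::real, p::real). p)"
proof -
  have "bounded_linear (\<lambda>x::real \<times> real \<times> real. fst (snd x))"
       "bounded_linear (\<lambda>x::real \<times> real \<times> real. snd (snd x))"
    by (auto intro: bounded_linear_compose bounded_linear_fst bounded_linear_snd)
  then show "smooth (\<lambda>(j::real, q::real, p::real). j)" "smooth (\<lambda>(j::real, q::real, p::real). q)"
    "smooth (\<lambda>(j::real, q::real, p::real). p)"
    using bounded_linear_fst by (auto simp: case_prod_unfold intro!: smooth_bounded_linear)
qed

lemma smooth_family_compose:
  assumes "smooth_family F" "smooth_family U" "smooth_family V"
  shows "smooth_family (\<lambda>j q p. F j (U j q p) (V j q p))"
  using smooth_compose3[OF assms(1)[unfolded smooth_family_def] smooth_proj(1)
      assms(2)[unfolded smooth_family_def] assms(3)[unfolded smooth_family_def]]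
  by (simp add: smooth_family_def case_prod_unfold)

lemma smooth_family_parameter: "smooth c \<Longrightarrow> smooth_family (\<lambda>j q p. c j)"
  using smooth_compose[of c "\<lambda>(j::real, q::real, p::real). j"] smooth_proj(1)
  by (simp add: smooth_family_def case_prod_unfold)

lemma smooth_family_vars: "smooth_family (\<lambda>j q p. q)" "smooth_family (\<lambda>j q p. p)"
  using smooth_proj(2,3) by (simp_all add: smooth_family_def)

lemma smooth_family_arith:
  assumes "smooth_family F" "smooth_family G"
  shows "smooth_family (\<lambda>j q p. F j q p + G j q p)" "smooth_family (\<lambda>j q p. F j q p - G j q p)"
    "smooth_family (\<lambda>j q p. F j q p * G j q p)"
  using smooth_add[of "\<lambda>(j, q, p). F j q p" "\<lambda>(j, q, p). G j q p"]
    smooth_diff[of "\<lambda>(j, q, p). F j q p" "\<lambda>(j, q, p). G j q p"]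
    smooth_mult[of "\<lambda>(j, q, p). F j q p" "\<lambda>(j, q, p). G j q p"] assms
  by (simp_all add: smooth_family_def case_prod_unfold)

lemma smooth_family_power: "smooth_family F \<Longrightarrow> smooth_family (\<lambda>j q p. F j q p ^ n)"
  using smooth_power[of "\<lambda>(j, q, p). F j q p" n] by (simp add: smooth_family_def case_prod_unfold)

lemma smooth_family_const: "smooth_family (\<lambda>j q p. c)"
  using smooth_const[of c] by (simp add: smooth_family_def case_prod_unfold)

lemma smooth_family_has_derivative_plane:
  assumes "smooth_family G"
  shows "((\<lambda>x. G j (fst x) (snd x)) has_derivative
      (\<lambda>h. dq (G j) (fst x) (snd x) * fst h + dp (G j) (fst x) (snd x) * snd h)) (at x)"
proof -
  have "((\<lambda>x. (j, fst x, snd x)) has_derivative (\<lambda>h. (0, fst h, snd h))) (at x)"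
    by (intro has_derivative_Pair has_derivative_const has_derivative_fst has_derivative_snd
        has_derivative_ident)
  from has_derivative_compose[OF this, of "\<lambda>(j, q, p). G j q p", OF smooth_family_has_derivative[OF assms]] show ?thesis
    by (simp add: case_prod_unfold)
qed

lemma smooth_family_has_derivative_comp:
  assumes "smooth_family G"
    and "(x has_derivative x') (at s within S)" "(y has_derivative y') (at s within S)"
  shows "((\<lambda>s. G j (x s) (y s)) has_derivative
      (\<lambda>h. dq (G j) (x s) (y s) * x' h + dp (G j) (x s) (y s) * y' h)) (at s within S)"
  using has_derivative_compose[OF has_derivative_Pair[OF assms(2,3)],
      of "\<lambda>x. G j (fst x) (snd x)", OF smooth_family_has_derivative_plane[OF assms(1)]]
  by simp

lemma smooth_family_DERIV_comp:
  assumes "smooth_family G"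
    and "(x has_real_derivative x') (at s within S)" "(y has_real_derivative y') (at s within S)"
  shows "((\<lambda>s. G j (x s) (y s)) has_real_derivative
      dq (G j) (x s) (y s) * x' + dp (G j) (x s) (y s) * y') (at s within S)"
  using smooth_family_has_derivative_comp[OF assms(1) assms(2,3)[unfolded has_field_derivative_def]]
  unfolding has_field_derivative_def by (rule has_derivative_eq_rhs) (auto simp: algebra_simps)

lemma smooth_family_DERIV:
  assumes "smooth_family G"
  shows "((\<lambda>s. G j s p) has_real_derivative dq (G j) q p) (at q within S)"
    "((\<lambda>s. G j q s) has_real_derivative dp (G j) q p) (at p within S)"
  using smooth_family_DERIV_comp[OF assms DERIV_ident DERIV_const, of j p q]
    smooth_family_DERIV_comp[OF assms DERIV_const DERIV_ident, of j q p]
  by auto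

lemma smooth_family_continuous:
  assumes "smooth_family G"
  shows "continuous_on S (\<lambda>(j, q, p). G j q p)"
  using assms smooth_continuous_on by (auto simp: smooth_family_def)

lemma chain_rule_partials:
  assumes F: "smooth_family F" and U: "smooth_family U" and V: "smooth_family V"
  shows "dq (\<lambda>q p. F j (U j q p) (V j q p)) = (\<lambda>q p. dq (F j) (U j q p) (V j q p) * dq (U j) q p
            + dp (F j) (U j q p) (V j q p) * dq (V j) q p)"
    and "dp (\<lambda>q p. F j (U j q p) (V j q p)) = (\<lambda>q p. dq (F j) (U j q p) (V j q p) * dp (U j) q p
            + dp (F j) (U j q p) (V j q p) * dp (V j) q p)"
proof -
  show "dq (\<lambda>q p. F j (U j q p) (V j q p)) = (\<lambda>q p. dq (F j) (U j q p) (V j q p) * dq (U j) q p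
            + dp (F j) (U j q p) (V j q p) * dq (V j) q p)"
    by (intro ext dq_eqI, rule smooth_family_DERIV_comp[OF F smooth_family_DERIV(1)[OF U] smooth_family_DERIV(1)[OF V]])
  show "dp (\<lambda>q p. F j (U j q p) (V j q p)) = (\<lambda>q p. dq (F j) (U j q p) (V j q p) * dp (U j) q p
            + dp (F j) (U j q p) (V j q p) * dp (V j) q p)"
    by (intro ext dp_eqI, rule smooth_family_DERIV_comp[OF F smooth_family_DERIV(2)[OF U] smooth_family_DERIV(2)[OF V]])
qed

text \<open>Tailored to the symmetry of mixed derivatives, where two uses of the mean value theorem
  yield equal values at different intermediate points.\<close>

lemma eq_if_equal_nearby:
  fixes f g :: "real \<times> real \<Rightarrow> real"
  assumes f: "isCont f z" and g: "isCont g z"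
    and near: "\<And>d. d > 0 \<Longrightarrow> \<exists>x y. dist x z < d \<and> dist y z < d \<and> f x = g y"
  shows "f z = g z"
proof (rule ccontr)
  assume "f z \<noteq> g z"
  define e where "e = dist (f z) (g z) / 2"
  have "e > 0" using \<open>f z \<noteq> g z\<close> by (simp add: e_def)
  obtain d1 d2 where d: "d1 > 0" "\<And>x. dist x z < d1 \<Longrightarrow> dist (f x) (f z) < e"
    "d2 > 0" "\<And>x. dist x z < d2 \<Longrightarrow> dist (g x) (g z) < e"
    using f g \<open>e > 0\<close> unfolding continuous_at_eps_delta by metis
  obtain x y where "dist x z < min d1 d2" "dist y z < min d1 d2" "f x = g y"
    using near[of "min d1 d2"] d by auto
  then show False
    using d(2)[of x] d(4)[of y] dist_triangle2[of "f z" "g z" "f x"] e_def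
    by (simp add: dist_commute)
qed

text \<open>The second difference of \<open>G j\<close> over a square of side \<open>h\<close> is
  \<open>h * h\<close> times either mixed derivative at some point of the square, depending on the
  order in which the mean value theorem is applied. Letting the square shrink gives equality at its
  corner.\<close>

lemma clairaut:
  assumes G: "smooth_family G"
  shows "dp (dq (G j)) = dq (dp (G j))"
proof (intro ext)
  fix q p
  let ?g = "G j"
  note G1 = smooth_family_dq[OF G] smooth_family_dp[OF G]
  have cont: "isCont (\<lambda>x. F j (fst x) (snd x)) z" if "smooth_family F" for F and z :: "real \<times> real"
    using smooth_family_has_derivative_plane[OF that] has_derivative_continuous by blast
  have mixed: "\<exists>x y. q < x \<and> x < q + h \<and> p < y \<and> y < p + h \<and>
      ?g (q + h) (p + h) - ?g (q + h) p - ?g q (p + h) + ?g q p = h * h * dp (dq ?g) x y"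
    if "h > 0" for h
  proof -
    have "((\<lambda>x. ?g x (p + h) - ?g x p) has_real_derivative (dq ?g x (p + h) - dq ?g x p)) (at x)" for x
      by (intro derivative_intros smooth_family_DERIV(1) G)
    from MVT2[of q "q + h", OF _ this] that obtain x where x: "q < x" "x < q + h"
      "?g (q + h) (p + h) - ?g (q + h) p - (?g q (p + h) - ?g q p) = h * (dq ?g x (p + h) - dq ?g x p)"
      by auto
    have "((\<lambda>y. dq ?g x y) has_real_derivative (dp (dq ?g) x y)) (at y)" for y
      by (intro smooth_family_DERIV(2) G1)
    from MVT2[of p "p + h", OF _ this] that obtain y where "p < y" "y < p + h"
      "dq ?g x (p + h) - dq ?g x p = h * dp (dq ?g) x y"
      by auto
    with x show ?thesis
      by (intro exI[of _ x] exI[of _ y]) (auto simp: algebra_simps)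
  qed
  have mixed': "\<exists>x y. q < x \<and> x < q + h \<and> p < y \<and> y < p + h \<and>
      ?g (q + h) (p + h) - ?g (q + h) p - ?g q (p + h) + ?g q p = h * h * dq (dp ?g) x y"
    if "h > 0" for h
  proof -
    have "((\<lambda>y. ?g (q + h) y - ?g q y) has_real_derivative (dp ?g (q + h) y - dp ?g q y)) (at y)" for y
      by (intro derivative_intros smooth_family_DERIV(2) G)
    from MVT2[of p "p + h", OF _ this] that obtain y where y: "p < y" "y < p + h"
      "?g (q + h) (p + h) - ?g q (p + h) - (?g (q + h) p - ?g q p) = h * (dp ?g (q + h) y - dp ?g q y)"
      by auto
    have "((\<lambda>x. dp ?g x y) has_real_derivative (dq (dp ?g) x y)) (at x)" for x
      by (intro smooth_family_DERIV(1) G1)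
    from MVT2[of q "q + h", OF _ this] that obtain x where "q < x" "x < q + h"
      "dp ?g (q + h) y - dp ?g q y = h * dq (dp ?g) x y"
      by auto
    with y show ?thesis
      by (intro exI[of _ x] exI[of _ y]) (auto simp: algebra_simps)
  qed
  have close: "dist (x, y) (q, p) < d"
    if "q < x" "x < q + d / 2" "p < y" "y < p + d / 2" for x y d
  proof -
    have "dist (x, y) (q, p) \<le> \<bar>x - q\<bar> + \<bar>y - p\<bar>"
      unfolding dist_prod_def by (rule order_trans[OF sqrt_sum_squares_le_sum_abs]) (simp add: dist_real_def)
    with that show ?thesis by simp
  qed
  have "(\<lambda>x. dp (dq ?g) (fst x) (snd x)) (q, p) = (\<lambda>x. dq (dp ?g) (fst x) (snd x)) (q, p)"
  proof (rule eq_if_equal_nearby)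
    show "isCont (\<lambda>x. dp (dq ?g) (fst x) (snd x)) (q, p)"
      by (rule cont[OF smooth_family_dp[OF G1(1)]])
    show "isCont (\<lambda>x. dq (dp ?g) (fst x) (snd x)) (q, p)"
      by (rule cont[OF smooth_family_dq[OF G1(2)]])
    fix d :: real assume "d > 0"
    with mixed[of "d / 2"] mixed'[of "d / 2"] obtain x y x' y' where
      xy: "q < x" "x < q + d / 2" "p < y" "y < p + d / 2" "q < x'" "x' < q + d / 2"
      "p < y'" "y' < p + d / 2" "d / 2 * (d / 2) * dp (dq ?g) x y = d / 2 * (d / 2) * dq (dp ?g) x' y'"
      by auto
    with \<open>d > 0\<close> have "dp (dq ?g) x y = dq (dp ?g) x' y'"
      by simp
    with close[of x d y] close[of x' d y'] xy
    show "\<exists>x y. dist x (q, p) < d \<and> dist y (q, p) < d \<and>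
        dp (dq ?g) (fst x) (snd x) = dq (dp ?g) (fst y) (snd y)"
      by (intro exI[of _ "(x, y)"] exI[of _ "(x', y')"]) auto
  qed
  then show "dp (dq ?g) q p = dq (dp ?g) q p" by simp
qed

section \<open>Jets and Taylor remainders\<close>

lemma smooth_family_dp_funpow: "smooth_family G \<Longrightarrow> smooth_family (\<lambda>j. (dp ^^ n) (G j))"
  by (induction n) (auto intro: smooth_family_dp)

lemma smooth_family_partials: "smooth_family G \<Longrightarrow> smooth_family (\<lambda>j. partials m n (G j))"
  unfolding partials_def
  by (induction m) (auto intro: smooth_family_dp_funpow smooth_family_dq)

lemma partials_dp: "partials m n (dp g) = partials m (Suc n) g"
  by (simp add: partials_def funpow_swap1)

text \<open>\<open>partials\<close> differentiates in \<open>p\<close> first, so an inner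
  \<open>dq\<close> has to be commuted past all the \<open>dp\<close>.\<close>

lemma partials_dq:
  assumes "smooth_family G"
  shows "partials m n (dq (G j)) = partials (Suc m) n (G j)"
proof -
  have "(dp ^^ n) (dq (G j)) = dq ((dp ^^ n) (G j))"
    by (induction n) (auto simp: clairaut[OF smooth_family_dp_funpow[OF assms]])
  then show ?thesis
    by (simp add: partials_def funpow_swap1)
qed

lemma partials_diff:
  assumes "smooth_family F" "smooth_family G"
  shows "partials m n (\<lambda>q p. F j q p - G j q p) = (\<lambda>q p. partials m n (F j) q p - partials m n (G j) q p)"
proof -
  have dp: "dp (\<lambda>q p. F j q p - G j q p) = (\<lambda>q p. dp (F j) q p - dp (G j) q p)"
    and dq: "dq (\<lambda>q p. F j q p - G j q p) = (\<lambda>q p. dq (F j) q p - dq (G j) q p)"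
    if "smooth_family F" "smooth_family G" for F G
    by (intro ext dp_eqI dq_eqI derivative_intros smooth_family_DERIV that)+
  have *: "(dp ^^ n) (\<lambda>q p. F j q p - G j q p) = (\<lambda>q p. (dp ^^ n) (F j) q p - (dp ^^ n) (G j) q p)"
    by (induction n)
      (auto simp: dp[OF smooth_family_dp_funpow[OF assms(1)] smooth_family_dp_funpow[OF assms(2)]])
  show ?thesis
  proof (induction m)
    case 0
    then show ?case by (simp add: partials_def *)
  next
    case (Suc m)
    have "partials (Suc m) n g = dq (partials m n g)" for g
      by (simp add: partials_def)
    then show ?case
      using Suc dq[OF smooth_family_partials[OF assms(1), of m n] smooth_family_partials[OF assms(2), of m n]]
      by simp
  qed
qed

text \<open>The mean value theorem along the ray from the origin. Applied repeatedly to partial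
  derivatives, it takes the place of a Taylor formula.\<close>

lemma smooth_family_line:
  assumes G: "smooth_family G"
  obtains s where "0 < s" "s < 1"
    "G j q p = G j 0 0 + q * dq (G j) (s * q) (s * p) + p * dp (G j) (s * q) (s * p)"
proof -
  have "((\<lambda>s. G j (s * q) (s * p)) has_real_derivative
      dq (G j) (s * q) (s * p) * q + dp (G j) (s * q) (s * p) * p) (at s)" for s
    by (rule smooth_family_DERIV_comp[OF G]) (auto intro!: derivative_eq_intros)
  from MVT2[of 0 1, OF _ this] that show thesis
    by (auto simp: algebra_simps)
qed

text \<open>Induction on the order, over all families at once: both first partials have a vanishing
  jet of one order less, and the mean value theorem on the ray contributes one further factor
  \<open>|q| + |p|\<close>. Compactness enters in the base case and makes \<open>C\<close>
  independent of \<open>j\<close>.\<close>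

lemma taylor_bound:
  assumes "smooth_family G" "compact J"
    and "\<And>j m n. j \<in> J \<Longrightarrow> m + n < k \<Longrightarrow> partials m n (G j) 0 0 = 0"
  shows "\<exists>C>0. \<forall>j\<in>J. \<forall>q p. \<bar>q\<bar> + \<bar>p\<bar> \<le> 1 \<longrightarrow> \<bar>G j q p\<bar> \<le> C * (\<bar>q\<bar> + \<bar>p\<bar>) ^ k"
  using assms(1,3)
proof (induction k arbitrary: G)
  case 0
  let ?K = "J \<times> ({-1..1::real} \<times> {-1..1::real})"
  have "compact ?K"
    using assms(2) by (intro compact_Times) auto
  then have "bounded ((\<lambda>(j, q, p). G j q p) ` ?K)"
    using smooth_family_continuous[OF 0(1)] by (intro compact_imp_bounded compact_continuous_image)
  then obtain C where "C > 0" and C: "\<And>x. x \<in> (\<lambda>(j, q, p). G j q p) ` ?K \<Longrightarrow> norm x \<le> C"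
    unfolding bounded_pos by metis
  have "\<bar>G j q p\<bar> \<le> C" if "j \<in> J" "\<bar>q\<bar> + \<bar>p\<bar> \<le> 1" for j q p
  proof -
    have "(j, q, p) \<in> ?K" using that by auto
    then have "(case (j, q, p) of (j, q, p) \<Rightarrow> G j q p) \<in> (\<lambda>(j, q, p). G j q p) ` ?K" by (rule imageI)
    from C[OF this] show ?thesis by simp
  qed
  with \<open>C > 0\<close> show ?case by auto
next
  case (Suc k)
  obtain C1 where C1: "C1 > 0" "\<And>j q p. j \<in> J \<Longrightarrow> \<bar>q\<bar> + \<bar>p\<bar> \<le> 1 \<Longrightarrow> \<bar>dq (G j) q p\<bar> \<le> C1 * (\<bar>q\<bar> + \<bar>p\<bar>) ^ k"
    using Suc.IH[OF smooth_family_dq[OF Suc.prems(1)]] Suc.prems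
    by (auto simp: partials_dq[OF Suc.prems(1)])
  obtain C2 where C2: "C2 > 0" "\<And>j q p. j \<in> J \<Longrightarrow> \<bar>q\<bar> + \<bar>p\<bar> \<le> 1 \<Longrightarrow> \<bar>dp (G j) q p\<bar> \<le> C2 * (\<bar>q\<bar> + \<bar>p\<bar>) ^ k"
    using Suc.IH[OF smooth_family_dp[OF Suc.prems(1)]] Suc.prems
    by (auto simp: partials_dp)
  have "\<bar>G j q p\<bar> \<le> (C1 + C2) * (\<bar>q\<bar> + \<bar>p\<bar>) ^ Suc k" if j: "j \<in> J" and qp: "\<bar>q\<bar> + \<bar>p\<bar> \<le> 1" for j q p
  proof -
    let ?N = "\<bar>q\<bar> + \<bar>p\<bar>"
    obtain s where s: "0 < s" "s < 1"
      "G j q p = G j 0 0 + q * dq (G j) (s * q) (s * p) + p * dp (G j) (s * q) (s * p)"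
      by (rule smooth_family_line[OF Suc.prems(1)])
    have "G j 0 0 = 0"
      using Suc.prems(2)[OF j, of 0 0] by (simp add: partials_def)
    have sN: "\<bar>s * q\<bar> + \<bar>s * p\<bar> = s * ?N"
      using s by (simp add: abs_mult algebra_simps)
    have sN1: "s * ?N \<le> ?N"
      using s by (intro mult_left_le_one_le) auto
    then have le: "\<bar>s * q\<bar> + \<bar>s * p\<bar> \<le> 1" using sN qp by linarith
    have pw: "(s * ?N) ^ k \<le> ?N ^ k"
      using s sN1 by (intro power_mono) auto
    have 1: "\<bar>dq (G j) (s * q) (s * p)\<bar> \<le> C1 * ?N ^ k"
      using C1(2)[OF j le] mult_left_mono[OF pw, of C1] C1(1) unfolding sN by linarith
    have 2: "\<bar>dp (G j) (s * q) (s * p)\<bar> \<le> C2 * ?N ^ k"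
      using C2(2)[OF j le] mult_left_mono[OF pw, of C2] C2(1) unfolding sN by linarith
    have "\<bar>G j q p\<bar> \<le> \<bar>q\<bar> * \<bar>dq (G j) (s * q) (s * p)\<bar> + \<bar>p\<bar> * \<bar>dp (G j) (s * q) (s * p)\<bar>"
      unfolding s(3) \<open>G j 0 0 = 0\<close> abs_mult[symmetric] by linarith
    also have "\<dots> \<le> ?N * (C1 * ?N ^ k) + ?N * (C2 * ?N ^ k)"
      using 1 2 by (intro add_mono mult_mono) auto
    finally show ?thesis by (simp add: algebra_simps)
  qed
  with C1(1) C2(1) show ?case
    by (intro exI[of _ "C1 + C2"]) auto
qed

section \<open>Linear type and stability of equilibria\<close>

text \<open>Also the determinant of the linearised Hamiltonian field, whose trace vanishes; the
  eigenvalues are thus the square roots of its negative.\<close>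

definition hess_det :: "(real \<Rightarrow> real \<Rightarrow> real) \<Rightarrow> real \<Rightarrow> real \<Rightarrow> real" where
  "hess_det g q p = dq (dq g) q p * dp (dp g) q p - (dq (dp g) q p)\<^sup>2"

lemma lin_eigenvalues_eq:
  assumes "smooth_family G"
  shows "lin_eigenvalues (G j) q p = {z. z\<^sup>2 = - of_real (hess_det (G j) q p)}"
  unfolding lin_eigenvalues_def hess_det_def Let_def clairaut[OF assms]
  by (auto simp: algebra_simps power2_eq_square)

lemma is_centreI:
  assumes "smooth_family G" "singular_point (G j) q p" "hess_det (G j) q p > 0"
  shows "is_centre (G j) q p"
  unfolding is_centre_def lin_eigenvalues_eq[OF assms(1)]
proof (intro conjI ballI)
  fix z :: complex assume "z \<in> {z. z\<^sup>2 = - of_real (hess_det (G j) q p)}"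
  then have z: "Re z * Re z - Im z * Im z = - hess_det (G j) q p" "Re z * Im z = 0"
    by (auto simp: complex_eq_iff power2_eq_square)
  then show "Re z = 0"
    using assms(3) by (metis less_irrefl mult_eq_0_iff mult_zero_right diff_zero
        neg_less_0_iff_less not_square_less_zero)
  with z assms(3) show "z \<noteq> 0" by auto
qed (fact assms(2))

lemma is_saddleI:
  assumes "smooth_family G" "singular_point (G j) q p" "hess_det (G j) q p < 0"
  shows "is_saddle (G j) q p"
  unfolding is_saddle_def lin_eigenvalues_eq[OF assms(1)]
proof (intro conjI ballI)
  fix z :: complex assume "z \<in> {z. z\<^sup>2 = - of_real (hess_det (G j) q p)}"
  then have z: "Re z * Re z - Im z * Im z = - hess_det (G j) q p"
    by (auto simp: complex_eq_iff power2_eq_square)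
  show "Re z \<noteq> 0"
  proof
    assume "Re z = 0"
    with z assms(3) show False
      using zero_le_square[of "Im z"] by simp
  qed
qed (fact assms(2))

text \<open>The globally Lipschitz case suffices, as the Hamiltonian field will be modified outside
  a ball. It yields a solution on all of \<open>[0, T]\<close> at once, with no maximal interval of
  existence to discuss.\<close>

lemma picard_global:
  fixes F :: "'a::euclidean_space \<Rightarrow> 'a"
  assumes lip: "\<And>x y. norm (F x - F y) \<le> L * norm (x - y)" and L: "L > 0" and T: "T \<ge> 0"
  obtains x where "x 0 = x0"
    "\<And>s. s \<in> {0..T} \<Longrightarrow> (x has_vector_derivative F (x s)) (at s within {0..T})"
proof -
  have contF: "continuous_on UNIV F"
  proof (rule continuous_onI)
    fix x :: 'a and e :: real assume "e > 0"
    then show "\<exists>d>0. \<forall>x'\<in>UNIV. dist x' x < d \<longrightarrow> dist (F x') (F x) \<le> e"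
      using lip L by (intro exI[of _ "e / L"])
        (auto simp: dist_norm field_simps intro: order_trans[OF lip])
  qed
  define X :: "nat \<Rightarrow> real \<Rightarrow> 'a" where "X = rec_nat (\<lambda>s. x0) (\<lambda>_ y s. x0 + integral {0..s} (\<lambda>r. F (y r)))"
  have X0: "X 0 s = x0" and XS: "X (Suc n) s = x0 + integral {0..s} (\<lambda>r. F (X n r))" for n s
    by (simp_all add: X_def)
  have contX: "continuous_on {0..T} (X n)" for n
  proof (induction n)
    case 0
    then show ?case by (simp add: X_def)
  next
    case (Suc n)
    have "continuous_on {0..T} (\<lambda>r. F (X n r))"
      by (rule continuous_on_compose2[OF contF Suc]) auto
    then have "(\<lambda>r. F (X n r)) integrable_on {0..T}"
      by (rule integrable_continuous_real)
    then show ?case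
      unfolding XS by (intro continuous_intros indefinite_integral_continuous_1)
  qed
  have intX: "(\<lambda>r. F (X n r)) integrable_on {0..s}" if "s \<in> {0..T}" for n s
  proof (rule integrable_continuous_real)
    show "continuous_on {0..s} (\<lambda>r. F (X n r))"
      by (rule continuous_on_compose2[OF contF continuous_on_subset[OF contX]]) (use that in auto)
  qed
  \<comment> \<open>An exponential weight makes the Picard map contract by 1/2 on all of [0, T] at once.\<close>
  define M where "M = norm (F x0) * T"
  have step: "norm (X (Suc n) s - X n s) \<le> M * exp (2 * L * s) / 2 ^ n" if "s \<in> {0..T}" for n s
    using that
  proof (induction n arbitrary: s)
    case 0
    have "norm (X (Suc 0) s - X 0 s) = norm (F x0) * s"
      using 0 by (simp add: XS X0)
    also have "\<dots> \<le> M"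
      using 0 by (auto simp: M_def intro: mult_left_mono)
    also have "\<dots> \<le> M * exp (2 * L * s)"
      using 0 L T mult_left_mono[of 1 "exp (2 * L * s)" M] by (simp add: M_def)
    finally show ?case by simp
  next
    case (Suc n)
    let ?w = "\<lambda>s. M * exp (2 * L * s) / 2 ^ Suc n"
    \<comment> \<open>The factor 2 in the exponent pays for the halving: \<open>?w\<close> is an
      antiderivative of \<open>L\<close> times the previous bound.\<close>
    have w: "((\<lambda>r. L * (M * exp (2 * L * r) / 2 ^ n)) has_integral (?w s - ?w 0)) {0..s}"
      using Suc.prems L
      by (intro fundamental_theorem_of_calculus)
        (auto intro!: derivative_eq_intros simp: has_real_derivative_iff_has_vector_derivative[symmetric])
    have "X (Suc (Suc n)) s - X (Suc n) s = integral {0..s} (\<lambda>r. F (X (Suc n) r) - F (X n r))"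
      unfolding integral_diff[OF intX[OF Suc.prems] intX[OF Suc.prems]]
      using XS[of "Suc n" s] XS[of n s] by simp
    also have "norm \<dots> \<le> integral {0..s} (\<lambda>r. L * (M * exp (2 * L * r) / 2 ^ n))"
    proof (rule integral_norm_bound_integral)
      show "(\<lambda>r. F (X (Suc n) r) - F (X n r)) integrable_on {0..s}"
        using intX[OF Suc.prems] by (intro integrable_diff)
      show "(\<lambda>r. L * (M * exp (2 * L * r) / 2 ^ n)) integrable_on {0..s}"
        using w by blast
      fix r assume "r \<in> {0..s}"
      then have "norm (X (Suc n) r - X n r) \<le> M * exp (2 * L * r) / 2 ^ n"
        using Suc by auto
      then show "norm (F (X (Suc n) r) - F (X n r)) \<le> L * (M * exp (2 * L * r) / 2 ^ n)"
        using lip[of "X (Suc n) r" "X n r"] L by (meson mult_left_mono order_less_imp_le order_trans)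
    qed
    also have "\<dots> = ?w s - ?w 0"
      using w by (rule integral_unique)
    also have "\<dots> \<le> ?w s"
      using T by (simp add: M_def)
    finally show ?case .
  qed
  \<comment> \<open>The iterates are \<open>x0\<close> plus partial sums of their increments.
    Replacing the weight by its value at \<open>T\<close> dominates these by a geometric
    series.\<close>
  have "uniform_limit {0..T} (\<lambda>n s. \<Sum>i<n. X (Suc i) s - X i s)
          (\<lambda>s. suminf (\<lambda>i. X (Suc i) s - X i s)) sequentially"
  proof (rule Weierstrass_m_test)
    show "summable (\<lambda>n. M * exp (2 * L * T) * (1 / 2) ^ n)"
      by (intro summable_mult summable_geometric) simp
    fix n s assume s: "s \<in> {0..T}"
    have "exp (2 * L * s) \<le> exp (2 * L * T)"
      using s L by simp
    then have "M * exp (2 * L * s) / 2 ^ n \<le> M * exp (2 * L * T) / 2 ^ n"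
      using T by (intro divide_right_mono mult_left_mono) (auto simp: M_def)
    with step[OF s, of n] show "norm (X (Suc n) s - X n s) \<le> M * exp (2 * L * T) * (1 / 2) ^ n"
      by (simp add: power_divide)
  qed
  then have "uniform_limit {0..T} (\<lambda>n s. x0 + (\<Sum>i<n. X (Suc i) s - X i s))
          (\<lambda>s. x0 + suminf (\<lambda>i. X (Suc i) s - X i s)) sequentially"
    by (intro uniform_limit_add uniform_limit_const)
  moreover have "x0 + (\<Sum>i<n. X (Suc i) s - X i s) = X n s" for n s
    using sum_lessThan_telescope[of "\<lambda>i. X i s" n] by (simp add: X0)
  ultimately obtain x where lim: "uniform_limit {0..T} X x sequentially"
    by auto
  have contx: "continuous_on {0..T} x"
    by (rule uniform_limit_theorem[OF _ lim]) (auto simp: contX)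
  have limF: "uniform_limit {0..T} (\<lambda>n s. F (X n s)) (\<lambda>s. F (x s)) sequentially"
  proof (rule uniform_limitI)
    fix e :: real assume "e > 0"
    then have "\<forall>\<^sub>F n in sequentially. \<forall>s\<in>{0..T}. dist (X n s) (x s) < e / L"
      using uniform_limitD[OF lim, of "e / L"] L by simp
    then show "\<forall>\<^sub>F n in sequentially. \<forall>s\<in>{0..T}. dist (F (X n s)) (F (x s)) < e"
    proof eventually_elim
      case (elim n)
      show ?case
      proof
        fix s assume "s \<in> {0..T}"
        with elim have "norm (X n s - x s) < e / L" by (auto simp: dist_norm)
        then have "L * norm (X n s - x s) < e" using L by (simp add: field_simps)
        then show "dist (F (X n s)) (F (x s)) < e"
          using lip[of "X n s" "x s"] by (simp add: dist_norm)
      qed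
    qed
  qed
  have eq: "x s = x0 + integral {0..s} (\<lambda>r. F (x r))" if s: "s \<in> {0..T}" for s
  proof -
    have "(\<lambda>n. integral {0..s} (\<lambda>r. F (X n r))) \<longlonglongrightarrow> integral {0..s} (\<lambda>r. F (x r))"
    proof -
      have "uniform_limit {0..s} (\<lambda>n s. F (X n s)) (\<lambda>s. F (x s)) sequentially"
        using limF by (rule uniform_limit_on_subset) (use s in auto)
      moreover have "continuous_on {0..s} (\<lambda>r. F (X n r))" for n
        by (rule continuous_on_compose2[OF contF continuous_on_subset[OF contX]]) (use s in auto)
      ultimately obtain I K where I: "\<And>n. ((\<lambda>r. F (X n r)) has_integral I n) {0..s}"
        "((\<lambda>r. F (x r)) has_integral K) {0..s}" "I \<longlonglongrightarrow> K"
        by (rule uniform_limit_integral) auto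
      have "I = (\<lambda>n. integral {0..s} (\<lambda>r. F (X n r)))"
        using I(1) by (auto intro: integral_unique[symmetric])
      with I show ?thesis
        by (simp add: integral_unique)
    qed
    then have "(\<lambda>n. X (Suc n) s) \<longlonglongrightarrow> x0 + integral {0..s} (\<lambda>r. F (x r))"
      unfolding XS by (intro tendsto_intros)
    moreover have "(\<lambda>n. X (Suc n) s) \<longlonglongrightarrow> x s"
      using tendsto_uniform_limitI[OF lim s] by (rule LIMSEQ_Suc)
    ultimately show ?thesis
      by (rule LIMSEQ_unique[symmetric])
  qed
  show thesis
  proof
    show "x 0 = x0"
      using eq[of 0] T by simp
    fix s assume s: "s \<in> {0..T}"
    have "continuous_on {0..T} (\<lambda>r. F (x r))"
      by (rule continuous_on_compose2[OF contF contx]) auto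
    then have "((\<lambda>u. integral {0..u} (\<lambda>r. F (x r))) has_vector_derivative F (x s)) (at s within {0..T})"
      by (rule integral_has_vector_derivative[OF _ s])
    then have "((\<lambda>u. x0 + integral {0..u} (\<lambda>r. F (x r))) has_vector_derivative 0 + F (x s)) (at s within {0..T})"
      by (intro has_vector_derivative_add has_vector_derivative_const)
    then show "(x has_vector_derivative F (x s)) (at s within {0..T})"
      using has_vector_derivative_transform[OF s eq] by simp
  qed
qed

section \<open>Linearisation errors and Lipschitz bounds\<close>

lemma linear_approx:
  assumes G: "smooth_family G" and "G j 0 0 = 0"
  obtains C where "C > 0"
    "\<And>q p. \<bar>q\<bar> + \<bar>p\<bar> \<le> 1 \<Longrightarrow>
      \<bar>G j q p - (dq (G j) 0 0 * q + dp (G j) 0 0 * p)\<bar> \<le> C * (\<bar>q\<bar> + \<bar>p\<bar>)\<^sup>2"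
proof -
  define c d where "c = dq (G j) 0 0" "d = dp (G j) 0 0"
  let ?R = "\<lambda>i q p. G i q p - (c * q + d * p)"
  have R: "smooth_family ?R"
    by (intro smooth_family_arith smooth_family_const smooth_family_vars G)
  have "dq (?R j) 0 0 = 0" "dp (?R j) 0 0 = 0"
    by (auto intro!: dq_eqI dp_eqI derivative_eq_intros
        smooth_family_DERIV[OF G] simp: c_d_def)
  then have "partials m n (?R i) 0 0 = 0" if "i \<in> {j}" "m + n < 2" for i m n
  proof -
    have "m = 0 \<and> n = 0 \<or> m = 1 \<and> n = 0 \<or> m = 0 \<and> n = 1"
      using that by linarith
    with \<open>dq (?R j) 0 0 = 0\<close> \<open>dp (?R j) 0 0 = 0\<close> that assms(2) show ?thesis
      by (auto simp: partials_def)
  qed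
  from taylor_bound[OF R _ this, of "{j}"] that show thesis
    by (auto simp: c_d_def)
qed

lemma smooth_family_lipschitz:
  assumes G: "smooth_family G"
  obtains L where "L > 0"
    "\<And>x y. x \<in> cball 0 r \<Longrightarrow> y \<in> cball 0 r \<Longrightarrow>
      \<bar>G j (fst x) (snd x) - G j (fst y) (snd y)\<bar> \<le> L * norm (x - y)"
proof -
  have bnd: "\<exists>B>0. \<forall>x\<in>cball 0 r. \<bar>H j (fst x) (snd x)\<bar> \<le> B" if "smooth_family H" for H
  proof -
    have "continuous_on (cball 0 r) (\<lambda>x. H j (fst x) (snd x))"
      using smooth_family_has_derivative_plane[OF that] has_derivative_continuous
      by (blast intro: continuous_at_imp_continuous_on)
    then have "bounded ((\<lambda>x. H j (fst x) (snd x)) ` cball 0 r)"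
      by (intro compact_imp_bounded compact_continuous_image) auto
    then show ?thesis
      unfolding bounded_pos by simp
  qed
  obtain B1 B2 where B: "B1 > 0" "\<And>x. x \<in> cball 0 r \<Longrightarrow> \<bar>dq (G j) (fst x) (snd x)\<bar> \<le> B1"
    "B2 > 0" "\<And>x. x \<in> cball 0 r \<Longrightarrow> \<bar>dp (G j) (fst x) (snd x)\<bar> \<le> B2"
    using bnd[OF smooth_family_dq[OF G]] bnd[OF smooth_family_dp[OF G]] by metis
  show thesis
  proof
    show "B1 + B2 > 0" using B by simp
    fix x y :: "real \<times> real" assume xy: "x \<in> cball 0 r" "y \<in> cball 0 r"
    have "norm (G j (fst x) (snd x) - G j (fst y) (snd y)) \<le> (B1 + B2) * norm (x - y)"
    proof (rule differentiable_bound[OF convex_cball _ _ xy])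
      fix z :: "real \<times> real" assume z: "z \<in> cball 0 r"
      show "((\<lambda>x. G j (fst x) (snd x)) has_derivative
          (\<lambda>h. dq (G j) (fst z) (snd z) * fst h + dp (G j) (fst z) (snd z) * snd h)) (at z within cball 0 r)"
        using smooth_family_has_derivative_plane[OF G] has_derivative_at_withinI by blast
      show "onorm (\<lambda>h. dq (G j) (fst z) (snd z) * fst h + dp (G j) (fst z) (snd z) * snd h) \<le> B1 + B2"
      proof (rule onorm_bound)
        fix h :: "real \<times> real"
        have "\<bar>fst h\<bar> \<le> norm h" "\<bar>snd h\<bar> \<le> norm h"
          using norm_fst_le[of "fst h" "snd h"] norm_snd_le[of "snd h" "fst h"] by auto
        then have "\<bar>dq (G j) (fst z) (snd z)\<bar> * \<bar>fst h\<bar> \<le> B1 * norm h"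
          "\<bar>dp (G j) (fst z) (snd z)\<bar> * \<bar>snd h\<bar> \<le> B2 * norm h"
          using B(2)[OF z] B(4)[OF z] B(1,3) by (auto intro!: mult_mono)
        then show "norm (dq (G j) (fst z) (snd z) * fst h + dp (G j) (fst z) (snd z) * snd h) \<le> (B1 + B2) * norm h"
          unfolding abs_mult[symmetric] by (simp add: distrib_right)
      qed (use B in simp)
    qed
    then show "\<bar>G j (fst x) (snd x) - G j (fst y) (snd y)\<bar> \<le> (B1 + B2) * norm (x - y)"
      by simp
  qed
qed

section \<open>Orbits, energy and stability\<close>

lemma ham_solution_DERIV:
  assumes "ham_solution g x I" "s \<in> I"
  shows "((\<lambda>s. fst (x s)) has_real_derivative dp g (fst (x s)) (snd (x s))) (at s within I)"
    "((\<lambda>s. snd (x s)) has_real_derivative - dq g (fst (x s)) (snd (x s))) (at s within I)"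
proof -
  have x: "(x has_derivative (\<lambda>h. h *\<^sub>R (dp g (fst (x s)) (snd (x s)), - dq g (fst (x s)) (snd (x s))))) (at s within I)"
    using assms by (auto simp: ham_solution_def has_vector_derivative_def)
  show "((\<lambda>s. fst (x s)) has_real_derivative dp g (fst (x s)) (snd (x s))) (at s within I)"
    using has_derivative_fst[OF x] by (simp add: has_field_derivative_def mult_commute_abs)
  show "((\<lambda>s. snd (x s)) has_real_derivative - dq g (fst (x s)) (snd (x s))) (at s within I)"
    unfolding has_field_derivative_def
    by (rule has_derivative_eq_rhs[OF has_derivative_snd[OF x]]) auto
qed

lemma ham_solution_continuous: "ham_solution g x I \<Longrightarrow> continuous_on I x"
  unfolding ham_solution_def continuous_on_eq_continuous_within
  using has_vector_derivative_continuous by blast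

lemma ham_solution_energy:
  assumes G: "smooth_family G" and x: "ham_solution (G j) x I" "is_interval I" "r \<in> I" "s \<in> I"
  shows "G j (fst (x r)) (snd (x r)) = G j (fst (x s)) (snd (x s))"
proof -
  have "((\<lambda>s. G j (fst (x s)) (snd (x s))) has_derivative (\<lambda>h. 0)) (at s within I)" if "s \<in> I" for s
    using smooth_family_DERIV_comp[OF G ham_solution_DERIV[OF x(1) that], of j]
    unfolding has_field_derivative_def by (rule has_derivative_eq_rhs) auto
  from has_derivative_zero_constant[OF is_interval_convex[OF x(2)] this]
  obtain c where "\<And>s. s \<in> I \<Longrightarrow> G j (fst (x s)) (snd (x s)) = c"
    by blast
  then show ?thesis using x by simp
qed

lemma sum_abs_sq_le: "(\<bar>q\<bar> + \<bar>p\<bar>)\<^sup>2 \<le> 2 * (q\<^sup>2 + p\<^sup>2)" for q p :: real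
  using zero_le_power2[of "\<bar>q\<bar> - \<bar>p\<bar>"] by (simp add: power2_eq_square algebra_simps)

lemma norm_prod_sq: "(norm x)\<^sup>2 = (fst x)\<^sup>2 + (snd x)\<^sup>2" for x :: "real \<times> real"
  by (simp add: norm_prod_def)

lemma sum_abs_le_norm: "\<bar>fst x\<bar> + \<bar>snd x\<bar> \<le> 2 * norm x" for x :: "real \<times> real"
  using norm_fst_le[of "fst x" "snd x"] norm_snd_le[of "snd x" "fst x"] by auto

lemma posdef_form_ge:
  fixes u v w :: real
  assumes "u * w - v\<^sup>2 > 0" "u > 0"
  obtains c where "c > 0" "\<And>q p. c * (q\<^sup>2 + p\<^sup>2) \<le> u * q\<^sup>2 + 2 * v * q * p + w * p\<^sup>2"
proof -
  have "w > 0"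
    using assms by (metis add_increasing2 diff_gt_0_iff_gt less_eq_real_def not_less
        order_le_less_trans zero_le_power2 zero_less_mult_pos)
  \<comment> \<open>Determinant over trace, which lies below both eigenvalues. The choice is
    convenient because the form reduced by \<open>c\<close> times the identity has determinant
    exactly \<open>c^2\<close>.\<close>
  define c where "c = (u * w - v\<^sup>2) / (u + w)"
  have c: "c > 0" "c * (u + w) = u * w - v\<^sup>2"
    using assms \<open>w > 0\<close> by (auto simp: c_def)
  have "(u - c) * (u + w) > 0"
  proof -
    have "(u - c) * (u + w) = u\<^sup>2 + v\<^sup>2"
      using c by (simp add: algebra_simps power2_eq_square)
    also have "\<dots> > 0" using assms by (simp add: add_pos_nonneg)
    finally show ?thesis .
  qed
  then have uc: "u - c > 0"
    using assms \<open>w > 0\<close> by (simp add: zero_less_mult_iff)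
  show thesis
  proof (rule that[OF c(1)])
    fix q p :: real
    have "(u - c) * ((u - c) * q\<^sup>2 + 2 * v * q * p + (w - c) * p\<^sup>2)
        = ((u - c) * q + v * p)\<^sup>2 + ((u - c) * (w - c) - v\<^sup>2) * p\<^sup>2"
      by (simp add: algebra_simps power2_eq_square)
    also have "(u - c) * (w - c) - v\<^sup>2 = c\<^sup>2"
      using c by (simp add: algebra_simps power2_eq_square)
    finally have "(u - c) * ((u - c) * q\<^sup>2 + 2 * v * q * p + (w - c) * p\<^sup>2) \<ge> 0"
      by simp
    then have "(u - c) * q\<^sup>2 + 2 * v * q * p + (w - c) * p\<^sup>2 \<ge> 0"
      using uc by (simp add: zero_le_mult_iff)
    then show "c * (q\<^sup>2 + p\<^sup>2) \<le> u * q\<^sup>2 + 2 * v * q * p + w * p\<^sup>2"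
      by (simp add: algebra_simps)
  qed
qed

text \<open>The Lagrange-Dirichlet argument: an orbit leaving a small ball would meet its boundary
  sphere, where the conserved energy is bounded away from its value at the origin, although it
  starts close to that value.\<close>

theorem stable_origin_if_definite:
  assumes G: "smooth_family G" and sing: "singular_point (G j) 0 0" and pos: "hess_det (G j) 0 0 > 0"
  shows "stable_origin (G j)"
proof -
  define \<alpha> \<beta> \<gamma> where "\<alpha> = dq (dq (G j)) 0 0" and "\<beta> = dq (dp (G j)) 0 0" and "\<gamma> = dp (dp (G j)) 0 0"
  have cl: "dp (dq (G j)) 0 0 = \<beta>" by (simp add: clairaut[OF G] \<beta>_def)
  have det: "\<alpha> * \<gamma> - \<beta>\<^sup>2 > 0"
    using pos by (simp add: hess_det_def \<alpha>_def \<beta>_def \<gamma>_def)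
  have "\<alpha> \<noteq> 0"
    using det zero_le_power2[of \<beta>] by auto
  \<comment> \<open>\<open>\<sigma>\<close> turns a maximum of the energy into a minimum, so both
    definite cases are treated together.\<close>
  define \<sigma> where "\<sigma> = sgn \<alpha>"
  have \<sigma>: "\<sigma> * \<alpha> > 0" "\<sigma> * \<sigma> = 1" "\<bar>\<sigma>\<bar> = 1"
    using \<open>\<alpha> \<noteq> 0\<close> by (auto simp: \<sigma>_def sgn_if)
  have "(\<sigma> * \<alpha>) * (\<sigma> * \<gamma>) - (\<sigma> * \<beta>)\<^sup>2 = \<alpha> * \<gamma> - \<beta>\<^sup>2"
    using \<sigma>(2) by (simp add: power2_eq_square algebra_simps)
  with det \<sigma> obtain c where c: "c > 0"
    "\<And>q p. c * (q\<^sup>2 + p\<^sup>2) \<le> (\<sigma> * \<alpha>) * q\<^sup>2 + 2 * (\<sigma> * \<beta>) * q * p + (\<sigma> * \<gamma>) * p\<^sup>2"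
    by (metis posdef_form_ge)
  obtain C1 where C1: "C1 > 0" "\<And>q p. \<bar>q\<bar> + \<bar>p\<bar> \<le> 1 \<Longrightarrow>
      \<bar>dq (G j) q p - (\<alpha> * q + \<beta> * p)\<bar> \<le> C1 * (\<bar>q\<bar> + \<bar>p\<bar>)\<^sup>2"
    using linear_approx[OF smooth_family_dq[OF G], of j] sing
    unfolding singular_point_def \<alpha>_def cl by metis
  obtain C2 where C2: "C2 > 0" "\<And>q p. \<bar>q\<bar> + \<bar>p\<bar> \<le> 1 \<Longrightarrow>
      \<bar>dp (G j) q p - (\<beta> * q + \<gamma> * p)\<bar> \<le> C2 * (\<bar>q\<bar> + \<bar>p\<bar>)\<^sup>2"
    using linear_approx[OF smooth_family_dp[OF G], of j] sing
    unfolding singular_point_def \<beta>_def \<gamma>_def by metis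
  define C where "C = C1 + C2"
  have C: "C > 0" using C1 C2 by (simp add: C_def)
  \<comment> \<open>\<open>R\<close> is the energy minus its quadratic part. Its gradient is the
    linearisation error of the gradient of \<open>G j\<close>, hence quadratically small, so the
    mean value theorem on rays makes \<open>R\<close> cubically small up to a constant.\<close>
  define R where "R i q p = G i q p - (\<alpha> / 2 * q\<^sup>2 + \<beta> * q * p + \<gamma> / 2 * p\<^sup>2)" for i q p
  have R: "smooth_family R"
    unfolding R_def by (intro smooth_family_arith smooth_family_power smooth_family_const smooth_family_vars G)
  have dR: "dq (R j) q p = dq (G j) q p - (\<alpha> * q + \<beta> * p)" "dp (R j) q p = dp (G j) q p - (\<beta> * q + \<gamma> * p)" for q p
    unfolding R_def by (auto intro!: dq_eqI dp_eqI derivative_eq_intros smooth_family_DERIV[OF G])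
  have Rb: "\<bar>R j q p - R j 0 0\<bar> \<le> C * (\<bar>q\<bar> + \<bar>p\<bar>) ^ 3" if qp: "\<bar>q\<bar> + \<bar>p\<bar> \<le> 1" for q p
  proof -
    let ?N = "\<bar>q\<bar> + \<bar>p\<bar>"
    obtain s where s: "0 < s" "s < 1"
      "R j q p = R j 0 0 + q * dq (R j) (s * q) (s * p) + p * dp (R j) (s * q) (s * p)"
      by (rule smooth_family_line[OF R])
    have sN: "\<bar>s * q\<bar> + \<bar>s * p\<bar> = s * ?N"
      using s by (simp add: abs_mult algebra_simps)
    have sN1: "s * ?N \<le> ?N"
      using s by (intro mult_left_le_one_le) auto
    then have le: "\<bar>s * q\<bar> + \<bar>s * p\<bar> \<le> 1" using sN qp by linarith
    have pw: "(s * ?N)\<^sup>2 \<le> ?N\<^sup>2"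
      using s sN1 by (intro power_mono) auto
    have 1: "\<bar>dq (R j) (s * q) (s * p)\<bar> \<le> C1 * ?N\<^sup>2"
      using C1(2)[OF le] mult_left_mono[OF pw, of C1] C1(1) unfolding sN dR by linarith
    have 2: "\<bar>dp (R j) (s * q) (s * p)\<bar> \<le> C2 * ?N\<^sup>2"
      using C2(2)[OF le] mult_left_mono[OF pw, of C2] C2(1) unfolding sN dR by linarith
    have "\<bar>R j q p - R j 0 0\<bar> \<le> \<bar>q\<bar> * \<bar>dq (R j) (s * q) (s * p)\<bar> + \<bar>p\<bar> * \<bar>dp (R j) (s * q) (s * p)\<bar>"
      unfolding s(3) abs_mult[symmetric] by linarith
    also have "\<dots> \<le> ?N * (C1 * ?N\<^sup>2) + ?N * (C2 * ?N\<^sup>2)"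
      using 1 2 by (intro add_mono mult_mono) auto
    finally show ?thesis by (simp add: algebra_simps C_def power2_eq_square power3_eq_cube)
  qed
  define V where "V x = \<sigma> * (G j (fst x) (snd x) - G j 0 0)" for x
  \<comment> \<open>For norm at most \<open>r\<close> one has \<open>|q| + |p| \<le> 2 * r\<close>,
    so the cubic remainder is at most \<open>c / 4\<close> times the squared norm, against at least
    \<open>c / 2\<close> from the quadratic part.\<close>
  define r where "r = min (1 / 2) (c / (16 * C))"
  have r: "r > 0" "2 * r \<le> 1" "C * (2 * r) * 2 \<le> c / 4"
    using c(1) C by (auto simp: r_def min_def field_simps)
  have V_ge: "c / 4 * (norm x)\<^sup>2 \<le> V x" if x: "norm x \<le> r" for x
  proof -
    obtain q p where qp: "x = (q, p)" by (cases x)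
    let ?N = "\<bar>q\<bar> + \<bar>p\<bar>"
    have N: "?N \<le> 2 * r" "?N \<le> 1"
      using sum_abs_le_norm[of x] x r by (auto simp: qp)
    have "C * ?N ^ 3 = C * ?N * ?N\<^sup>2"
      by (simp add: power2_eq_square power3_eq_cube)
    also have "\<dots> \<le> C * (2 * r) * (2 * (q\<^sup>2 + p\<^sup>2))"
      using N C r(1) sum_abs_sq_le[of q p] by (intro mult_mono) auto
    also have "\<dots> \<le> c / 4 * (q\<^sup>2 + p\<^sup>2)"
      using mult_right_mono[OF r(3), of "q\<^sup>2 + p\<^sup>2"] by (simp add: mult_ac)
    finally have 1: "\<bar>R j q p - R j 0 0\<bar> \<le> c / 4 * (q\<^sup>2 + p\<^sup>2)"
      using Rb[OF N(2)] by linarith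
    have "V x = ((\<sigma> * \<alpha>) * q\<^sup>2 + 2 * (\<sigma> * \<beta>) * q * p + (\<sigma> * \<gamma>) * p\<^sup>2) / 2 + \<sigma> * (R j q p - R j 0 0)"
      by (simp add: V_def R_def qp algebra_simps)
    moreover have "\<bar>\<sigma> * (R j q p - R j 0 0)\<bar> \<le> c * (q\<^sup>2 + p\<^sup>2) / 4"
      using 1 by (simp add: abs_mult \<sigma>)
    ultimately have "V x \<ge> c * (q\<^sup>2 + p\<^sup>2) / 4"
      using c(2)[of q p] by (simp only: abs_le_iff) argo
    then show ?thesis
      unfolding norm_prod_sq by (simp add: qp)
  qed
  have contV: "isCont V 0"
    unfolding V_def
    using smooth_family_has_derivative_plane[OF G, of j 0] has_derivative_continuous
    by (intro continuous_intros) blast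
  show ?thesis
    unfolding stable_origin_def
  proof (intro allI impI)
    fix \<epsilon>0 :: real assume "\<epsilon>0 > 0"
    define \<epsilon> where "\<epsilon> = min \<epsilon>0 r"
    have \<epsilon>: "\<epsilon> > 0" "\<epsilon> \<le> r" "\<epsilon> \<le> \<epsilon>0" using \<open>\<epsilon>0 > 0\<close> r by (auto simp: \<epsilon>_def)
    have "V 0 = 0" by (simp add: V_def)
    moreover have "c / 4 * \<epsilon>\<^sup>2 > 0" using c \<epsilon> by simp
    ultimately obtain \<delta>0 where \<delta>0: "\<delta>0 > 0" "\<And>x. norm x < \<delta>0 \<Longrightarrow> \<bar>V x\<bar> < c / 4 * \<epsilon>\<^sup>2"
      using contV unfolding continuous_at_eps_delta by (metis dist_0_norm dist_commute dist_real_def diff_0_right)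
    define \<delta> where "\<delta> = min \<delta>0 \<epsilon>"
    have "norm (x s) < \<epsilon>"
      if "is_interval I" "0 \<in> I" "ham_solution (G j) x I" "norm (x 0) < \<delta>" "s \<in> I" for I x s
    proof (rule ccontr)
      assume "\<not> norm (x s) < \<epsilon>"
      have "connected ((\<lambda>s. norm (x s)) ` I)"
        using ham_solution_continuous[OF that(3)] is_interval_connected[OF that(1)]
        by (intro connected_continuous_image continuous_intros)
      then have "\<epsilon> \<in> (\<lambda>s. norm (x s)) ` I"
        using connectedD_interval[of _ "norm (x 0)" "norm (x s)" \<epsilon>] \<open>\<not> norm (x s) < \<epsilon>\<close> that
        by (auto simp: \<delta>_def)
      then obtain u where u: "u \<in> I" "norm (x u) = \<epsilon>" by auto
      have "V (x u) = V (x 0)"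
        unfolding V_def using ham_solution_energy[OF G that(3,1) u(1) that(2)] by simp
      moreover have "V (x 0) < c / 4 * \<epsilon>\<^sup>2"
        using \<delta>0(2)[of "x 0"] that(4) by (auto simp: \<delta>_def)
      ultimately show False
        using V_ge[of "x u"] u \<epsilon> by simp
    qed
    moreover have "\<delta> > 0" using \<delta>0 \<epsilon> by (simp add: \<delta>_def)
    ultimately show "\<exists>\<delta>>0. \<forall>I x. is_interval I \<and> 0 \<in> I \<and> ham_solution (G j) x I \<and> norm (x 0) < \<delta> \<longrightarrow>
        (\<forall>s\<in>I. norm (x s) < \<epsilon>0)"
      using \<epsilon>(3) by (meson less_le_trans)
  qed
qed

text \<open>Composing the field with the nearest-point projection onto the closed ball makes it
  globally Lipschitz, and a solution of the modified equation solves the original one as long as it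
  stays in the ball. The hypothesis \<open>confined\<close> speaks of true solutions only, so it can
  be supplied by stability.\<close>

lemma ham_solution_exists_while_in_ball:
  assumes G: "smooth_family G" and r: "r > 0" and x0: "norm x0 < r" and T: "T \<ge> 0"
    and confined: "\<And>x s. s \<ge> 0 \<Longrightarrow> ham_solution (G j) x {0..s} \<Longrightarrow> x 0 = x0 \<Longrightarrow> norm (x s) < r"
  obtains x where "x 0 = x0" "ham_solution (G j) x {0..T}"
proof -
  define X where "X y = (dp (G j) (fst y) (snd y), - dq (G j) (fst y) (snd y))" for y
  define F where "F y = X (closest_point (cball 0 r) y)" for y
  obtain L1 where L1: "L1 > 0" "\<And>x y. x \<in> cball 0 r \<Longrightarrow> y \<in> cball 0 r \<Longrightarrow>
      \<bar>dp (G j) (fst x) (snd x) - dp (G j) (fst y) (snd y)\<bar> \<le> L1 * norm (x - y)"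
    by (metis smooth_family_lipschitz[OF smooth_family_dp[OF G]])
  obtain L2 where L2: "L2 > 0" "\<And>x y. x \<in> cball 0 r \<Longrightarrow> y \<in> cball 0 r \<Longrightarrow>
      \<bar>dq (G j) (fst x) (snd x) - dq (G j) (fst y) (snd y)\<bar> \<le> L2 * norm (x - y)"
    by (metis smooth_family_lipschitz[OF smooth_family_dq[OF G]])
  have lip: "norm (F x - F y) \<le> (L1 + L2) * norm (x - y)" for x y
  proof -
    let ?x = "closest_point (cball 0 r) x" and ?y = "closest_point (cball 0 r) y"
    have ne: "cball 0 r \<noteq> ({} :: (real \<times> real) set)" using r by simp
    have mem: "?x \<in> cball 0 r" "?y \<in> cball 0 r"
      by (rule closest_point_in_set[OF closed_cball ne])+
    have "F x - F y = (dp (G j) (fst ?x) (snd ?x) - dp (G j) (fst ?y) (snd ?y),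
        - (dq (G j) (fst ?x) (snd ?x) - dq (G j) (fst ?y) (snd ?y)))"
      by (simp add: F_def X_def)
    then have "norm (F x - F y) \<le> \<bar>dp (G j) (fst ?x) (snd ?x) - dp (G j) (fst ?y) (snd ?y)\<bar>
        + \<bar>dq (G j) (fst ?x) (snd ?x) - dq (G j) (fst ?y) (snd ?y)\<bar>"
      using norm_Pair_le by (metis norm_minus_cancel real_norm_def)
    also have "\<dots> \<le> (L1 + L2) * norm (?x - ?y)"
      using L1(2)[OF mem] L2(2)[OF mem] by (simp add: distrib_right)
    also have "\<dots> \<le> (L1 + L2) * norm (x - y)"
      using L1(1) L2(1) closest_point_lipschitz[OF convex_cball closed_cball ne, of x y]
      by (intro mult_left_mono) (auto simp: dist_norm)
    finally show ?thesis .
  qed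
  obtain x where x: "x 0 = x0"
    "\<And>s. s \<in> {0..T} \<Longrightarrow> (x has_vector_derivative F (x s)) (at s within {0..T})"
    using picard_global[OF lip _ T, of x0] L1(1) L2(1) by auto
  have sol: "ham_solution (G j) x {0..u}" if "u \<le> T" "\<And>s. s \<in> {0..u} \<Longrightarrow> norm (x s) \<le> r" for u
    unfolding ham_solution_def
  proof
    fix s assume s: "s \<in> {0..u}"
    then have "(x has_vector_derivative F (x s)) (at s within {0..u})"
      using x(2)[of s] that(1) by (intro has_vector_derivative_within_subset[OF x(2)]) auto
    moreover have "closest_point (cball 0 r) (x s) = x s"
      using that(2)[OF s] by (intro closest_point_self) auto
    ultimately show "(x has_vector_derivative (dp (G j) (fst (x s)) (snd (x s)),
        - dq (G j) (fst (x s)) (snd (x s)))) (at s within {0..u})"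
      by (simp add: F_def X_def)
  qed
  have contx: "continuous_on {0..T} (\<lambda>s. norm (x s))"
    unfolding continuous_on_eq_continuous_within
    using x(2) has_vector_derivative_continuous by (blast intro: continuous_norm)
  have "norm (x s) < r" if "s \<in> {0..T}" for s
  proof (rule ccontr)
    assume "\<not> norm (x s) < r"
    \<comment> \<open>At the first time \<open>u\<close> of norm at least \<open>r\<close> the norm
      would be exactly \<open>r\<close>, and at most \<open>r\<close> before. Thus the orbit would
      be a true solution on \<open>[0, u]\<close>, and \<open>confined\<close> forbids its norm at
      \<open>u\<close>.\<close>
    define E where "E = {0..T} \<inter> (\<lambda>s. norm (x s)) -` {r..}"
    have "closed E"
      unfolding E_def by (intro continuous_closed_preimage contx) auto
    then have "compact E"
      using compact_Int_closed[of "{0..T}" E] by (simp add: E_def Int_absorb1)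
    moreover have "s \<in> E" using that \<open>\<not> norm (x s) < r\<close> by (simp add: E_def)
    ultimately obtain u where u: "u \<in> E" "\<And>v. v \<in> E \<Longrightarrow> u \<le> v"
      using compact_attains_inf[of E] by blast
    have "0 \<le> u" "u \<le> T" "r \<le> norm (x u)" using u by (auto simp: E_def)
    then obtain v where v: "0 \<le> v" "v \<le> u" "norm (x v) = r"
      using IVT'[of "\<lambda>s. norm (x s)" 0 r u] x0 x(1) continuous_on_subset[OF contx] by auto
    then have "v = u"
      using u(2)[of v] \<open>u \<le> T\<close> by (auto simp: E_def)
    have "norm (x w) \<le> r" if "w \<in> {0..u}" for w
      using u(2)[of w] that v(3) \<open>v = u\<close> \<open>u \<le> T\<close> by (cases "r \<le> norm (x w)") (auto simp: E_def)
    from confined[OF \<open>0 \<le> u\<close> sol[OF \<open>u \<le> T\<close> this] x(1)] v(3) \<open>v = u\<close> show False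
      by simp
  qed
  then have "ham_solution (G j) x {0..T}"
    by (intro sol) (auto simp: less_imp_le)
  with x(1) that show thesis by blast
qed

text \<open>By contradiction: stability confines an orbit that starts near the origin where
  \<open>V > 0\<close>, and thereby guarantees that it exists for any prescribed time. Along it
  \<open>V\<close> increases at a rate bounded below, yet \<open>V\<close> is bounded on the
  ball.\<close>

theorem not_stable_origin_if_indefinite:
  assumes G: "smooth_family G" and sing: "singular_point (G j) 0 0" and neg: "hess_det (G j) 0 0 < 0"
  shows "\<not> stable_origin (G j)"
proof
  assume stable: "stable_origin (G j)"
  define \<alpha> \<beta> \<gamma> where "\<alpha> = dq (dq (G j)) 0 0" and "\<beta> = dq (dp (G j)) 0 0" and "\<gamma> = dp (dp (G j)) 0 0"
  have cl: "dp (dq (G j)) 0 0 = \<beta>" by (simp add: clairaut[OF G] \<beta>_def)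
  define \<Lambda> where "\<Lambda> = \<beta>\<^sup>2 - \<alpha> * \<gamma>"
  have \<Lambda>: "\<Lambda> > 0"
    using neg by (simp add: hess_det_def \<alpha>_def \<beta>_def \<gamma>_def \<Lambda>_def)
  obtain C1 where C1: "C1 > 0" "\<And>q p. \<bar>q\<bar> + \<bar>p\<bar> \<le> 1 \<Longrightarrow>
      \<bar>dq (G j) q p - (\<alpha> * q + \<beta> * p)\<bar> \<le> C1 * (\<bar>q\<bar> + \<bar>p\<bar>)\<^sup>2"
    using linear_approx[OF smooth_family_dq[OF G], of j] sing
    unfolding singular_point_def \<alpha>_def cl by metis
  obtain C2 where C2: "C2 > 0" "\<And>q p. \<bar>q\<bar> + \<bar>p\<bar> \<le> 1 \<Longrightarrow>
      \<bar>dp (G j) q p - (\<beta> * q + \<gamma> * p)\<bar> \<le> C2 * (\<bar>q\<bar> + \<bar>p\<bar>)\<^sup>2"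
    using linear_approx[OF smooth_family_dp[OF G], of j] sing
    unfolding singular_point_def \<beta>_def \<gamma>_def by metis
  \<comment> \<open>Chetaev function V(x) = x . Ax for the linearisation A. As A^2 = \<Lambda> I, its derivative
    along the linear flow is |Ax|^2 + \<Lambda> |x|^2.\<close>
  define V where "V q p = \<beta> * q\<^sup>2 + (\<gamma> - \<alpha>) * q * p - \<beta> * p\<^sup>2" for q p
  define V1 V2 where "V1 q p = 2 * \<beta> * q + (\<gamma> - \<alpha>) * p" and "V2 q p = (\<gamma> - \<alpha>) * q - 2 * \<beta> * p" for q p
  define W where "W q p = V1 q p * dp (G j) q p - V2 q p * dq (G j) q p" for q p
  define K where "K = 2 * \<bar>\<beta>\<bar> + \<bar>\<gamma>\<bar> + \<bar>\<alpha>\<bar> + 1"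
  have K: "K > 0" by (simp add: K_def)
  have V1b: "\<bar>V1 q p\<bar> \<le> K * (\<bar>q\<bar> + \<bar>p\<bar>)" for q p
  proof -
    have "\<bar>V1 q p\<bar> \<le> \<bar>2 * \<beta>\<bar> * \<bar>q\<bar> + \<bar>\<gamma> - \<alpha>\<bar> * \<bar>p\<bar>"
      unfolding V1_def abs_mult[symmetric] by (rule abs_triangle_ineq)
    also have "\<dots> \<le> K * \<bar>q\<bar> + K * \<bar>p\<bar>"
      by (intro add_mono mult_right_mono) (auto simp: K_def)
    finally show ?thesis by (simp add: distrib_left)
  qed
  have V2b: "\<bar>V2 q p\<bar> \<le> K * (\<bar>q\<bar> + \<bar>p\<bar>)" for q p
  proof -
    have "\<bar>V2 q p\<bar> \<le> \<bar>\<gamma> - \<alpha>\<bar> * \<bar>q\<bar> + \<bar>2 * \<beta>\<bar> * \<bar>p\<bar>"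
      unfolding V2_def abs_mult[symmetric] by (rule abs_triangle_ineq4)
    also have "\<dots> \<le> K * \<bar>q\<bar> + K * \<bar>p\<bar>"
      by (intro add_mono mult_right_mono) (auto simp: K_def)
    finally show ?thesis by (simp add: distrib_left)
  qed
  have Vb: "V q p \<le> 2 * K * (q\<^sup>2 + p\<^sup>2)" for q p
  proof -
    have "V q p = (q * V1 q p + p * V2 q p) / 2"
      by (simp add: V_def V1_def V2_def field_simps power2_eq_square)
    also have "\<dots> \<le> (\<bar>q\<bar> * (K * (\<bar>q\<bar> + \<bar>p\<bar>)) + \<bar>p\<bar> * (K * (\<bar>q\<bar> + \<bar>p\<bar>))) / 2"
    proof -
      have "q * V1 q p \<le> \<bar>q\<bar> * (K * (\<bar>q\<bar> + \<bar>p\<bar>))"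
        using mult_left_mono[OF V1b[of q p], of "\<bar>q\<bar>"] abs_ge_self[of "q * V1 q p"]
        by (simp add: abs_mult)
      moreover have "p * V2 q p \<le> \<bar>p\<bar> * (K * (\<bar>q\<bar> + \<bar>p\<bar>))"
        using mult_left_mono[OF V2b[of q p], of "\<bar>p\<bar>"] abs_ge_self[of "p * V2 q p"]
        by (simp add: abs_mult)
      ultimately show ?thesis by simp
    qed
    also have "\<dots> = K / 2 * (\<bar>q\<bar> + \<bar>p\<bar>)\<^sup>2"
      by (simp add: power2_eq_square algebra_simps)
    also have "\<dots> \<le> K / 2 * (2 * (q\<^sup>2 + p\<^sup>2))"
      using sum_abs_sq_le K by (intro mult_left_mono) auto
    also have "\<dots> \<le> 2 * K * (q\<^sup>2 + p\<^sup>2)"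
      using K by (simp add: mult_right_mono)
    finally show ?thesis .
  qed
  define C where "C = C1 + C2"
  have C: "C > 0" using C1 C2 by (simp add: C_def)
  \<comment> \<open>Makes the cubic error in \<open>W\<close> at most \<open>\<Lambda> / 2\<close>
    times the squared norm. The two squares in the derivative along the linear flow are non-negative
    and are dropped.\<close>
  define r where "r = min (1 / 2) (\<Lambda> / (8 * K * C))"
  have r: "r > 0" "2 * r \<le> 1" "K * C * (2 * r) * 2 \<le> \<Lambda> / 2"
    using \<Lambda> C K by (auto simp: r_def min_def field_simps)
  have W_ge: "\<Lambda> / 2 * (q\<^sup>2 + p\<^sup>2) \<le> W q p" if "norm (q, p) \<le> r" for q p
  proof -
    let ?N = "\<bar>q\<bar> + \<bar>p\<bar>"
    have N: "?N \<le> 2 * r" "?N \<le> 1"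
      using sum_abs_le_norm[of "(q, p)"] that r by auto
    define e1 e2 where "e1 = dq (G j) q p - (\<alpha> * q + \<beta> * p)" and "e2 = dp (G j) q p - (\<beta> * q + \<gamma> * p)"
    have lin: "V1 q p * (\<beta> * q + \<gamma> * p) - V2 q p * (\<alpha> * q + \<beta> * p)
        = (\<beta> * q + \<gamma> * p)\<^sup>2 + (\<alpha> * q + \<beta> * p)\<^sup>2 + \<Lambda> * (q\<^sup>2 + p\<^sup>2)"
      by (simp add: V1_def V2_def \<Lambda>_def algebra_simps power2_eq_square)
    have W: "W q p = (\<beta> * q + \<gamma> * p)\<^sup>2 + (\<alpha> * q + \<beta> * p)\<^sup>2 + \<Lambda> * (q\<^sup>2 + p\<^sup>2)
        + (V1 q p * e2 - V2 q p * e1)"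
      unfolding lin[symmetric] by (simp add: W_def e1_def e2_def algebra_simps)
    have "\<bar>V1 q p * e2\<bar> \<le> K * ?N * (C2 * ?N\<^sup>2)" "\<bar>V2 q p * e1\<bar> \<le> K * ?N * (C1 * ?N\<^sup>2)"
      unfolding abs_mult using V1b[of q p] V2b[of q p] C1(2)[OF N(2)] C2(2)[OF N(2)] K
      by (auto intro!: mult_mono simp: e1_def e2_def)
    then have "\<bar>V1 q p * e2 - V2 q p * e1\<bar> \<le> K * C * ?N * ?N\<^sup>2"
      using abs_triangle_ineq4[of "V1 q p * e2" "V2 q p * e1"] by (simp add: C_def algebra_simps)
    also have "\<dots> \<le> K * C * (2 * r) * (2 * (q\<^sup>2 + p\<^sup>2))"
      using N C K r(1) sum_abs_sq_le[of q p] by (intro mult_mono) auto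
    also have "\<dots> \<le> \<Lambda> / 2 * (q\<^sup>2 + p\<^sup>2)"
      using mult_right_mono[OF r(3), of "q\<^sup>2 + p\<^sup>2"] by (simp add: mult_ac)
    finally have "V1 q p * e2 - V2 q p * e1 \<ge> - (\<Lambda> / 2 * (q\<^sup>2 + p\<^sup>2))"
      by linarith
    then show ?thesis
      unfolding W using zero_le_power2[of "\<beta> * q + \<gamma> * p"] zero_le_power2[of "\<alpha> * q + \<beta> * p"]
      by linarith
  qed
  obtain \<delta> where \<delta>: "\<delta> > 0" "\<And>I x s. is_interval I \<Longrightarrow> 0 \<in> I \<Longrightarrow> ham_solution (G j) x I \<Longrightarrow>
      norm (x 0) < \<delta> \<Longrightarrow> s \<in> I \<Longrightarrow> norm (x s) < r"
    using stable r(1) unfolding stable_origin_def by metis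
  \<comment> \<open>The matrix of the quadratic form \<open>V\<close> has trace 0, and it is
    non-zero: \<open>\<beta> = 0\<close> together with \<open>\<alpha> = \<gamma>\<close> would give
    \<open>\<Lambda> \<le> 0\<close>.\<close>
  have "\<exists>q p. V q p > 0"
  proof (cases "\<beta> = 0")
    case True
    then have "\<gamma> - \<alpha> \<noteq> 0"
      using \<Lambda> by (auto simp: \<Lambda>_def)
    moreover have "V 1 (\<gamma> - \<alpha>) = (\<gamma> - \<alpha>)\<^sup>2"
      by (simp add: V_def True power2_eq_square)
    ultimately have "V 1 (\<gamma> - \<alpha>) > 0"
      by simp
    then show ?thesis by blast
  next
    case False
    then have "V 1 0 > 0 \<or> V 0 1 > 0"
      by (auto simp: V_def)
    then show ?thesis by blast
  qed
  then obtain q1 p1 where q1: "V q1 p1 > 0" by blast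
  define n where "n = norm (q1, p1)"
  define m where "m = min \<delta> r"
  have m: "m > 0" "m \<le> \<delta>" "m \<le> r"
    using \<delta> r by (auto simp: m_def)
  \<comment> \<open>Scales a direction with \<open>V > 0\<close> into both the stability radius and
    the ball; the sign of \<open>V\<close> survives because \<open>V\<close> is homogeneous.\<close>
  define k where "k = m / (2 * (n + 1))"
  have k: "k > 0" "k * n < m"
  proof -
    have "n \<ge> 0" by (simp add: n_def)
    then show "k > 0" using m by (simp add: k_def)
    have "m * n < m * (2 * (n + 1))"
      using m \<open>n \<ge> 0\<close> by (intro mult_strict_left_mono) auto
    then show "k * n < m"
      using \<open>n \<ge> 0\<close> by (simp add: k_def field_simps)
  qed
  define x0 where "x0 = k *\<^sub>R (q1, p1)"
  have x0: "norm x0 < \<delta>" "norm x0 < r"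
    using k m unfolding x0_def norm_scaleR n_def by auto
  define v0 where "v0 = V (fst x0) (snd x0)"
  have "v0 = k\<^sup>2 * V q1 p1"
    by (simp add: v0_def x0_def V_def power2_eq_square algebra_simps)
  then have v0: "v0 > 0" using k q1 by simp
  \<comment> \<open>\<open>V\<close> is at most \<open>2 * K\<close> times the squared norm and
    \<open>W\<close> at least \<open>\<Lambda> / 2\<close> times it, whence
    \<open>\<mu> * V \<le> W\<close>. Linear growth at rate \<open>\<mu> * v0\<close> is already
    enough: in time \<open>T\<close> it adds the whole bound \<open>2 * K * r^2\<close> of
    \<open>V\<close> on the ball to a positive initial value.\<close>
  define \<mu> where "\<mu> = \<Lambda> / (4 * K)"
  have \<mu>: "\<mu> > 0" using \<Lambda> K by (simp add: \<mu>_def)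
  define T where "T = 2 * K * r\<^sup>2 / (\<mu> * v0)"
  have T: "T > 0" using K r \<mu> v0 by (simp add: T_def)
  obtain x where x: "x 0 = x0" "ham_solution (G j) x {0..T}"
  proof (rule ham_solution_exists_while_in_ball[OF G r(1) x0(2)])
    show "0 \<le> T" using T by simp
    show "norm (x s) < r" if "s \<ge> 0" "ham_solution (G j) x {0..s}" "x 0 = x0" for x s
      using \<delta>(2)[of "{0..s}" x s] that x0 by (simp add: is_interval_cc)
  qed
  have small: "norm (x s) < r" if "s \<in> {0..T}" for s
    using \<delta>(2)[OF _ _ x(2) _ that] x0 x(1) T by (simp add: is_interval_cc)
  define v where "v s = V (fst (x s)) (snd (x s))" for s
  have dv: "(v has_derivative (\<lambda>h. W (fst (x s)) (snd (x s)) * h)) (at s within {0..T})"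
    if s: "s \<in> {0..T}" for s
  proof -
    have "(v has_real_derivative W (fst (x s)) (snd (x s))) (at s within {0..T})"
      unfolding v_def V_def
      by (rule derivative_eq_intros ham_solution_DERIV[OF x(2) s] refl)+
        (simp add: W_def V1_def V2_def algebra_simps)
    then show ?thesis
      by (simp add: has_field_derivative_def)
  qed
  have W_x: "\<Lambda> / 2 * ((fst (x s))\<^sup>2 + (snd (x s))\<^sup>2) \<le> W (fst (x s)) (snd (x s))" if "s \<in> {0..T}" for s
    using W_ge[of "fst (x s)" "snd (x s)"] small[OF that] by simp
  have W_v: "\<mu> * v s \<le> W (fst (x s)) (snd (x s))" if "s \<in> {0..T}" for s
  proof -
    have "\<mu> * v s \<le> \<mu> * (2 * K * ((fst (x s))\<^sup>2 + (snd (x s))\<^sup>2))"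
      using Vb \<mu> by (intro mult_left_mono) (auto simp: v_def)
    also have "\<dots> = \<Lambda> / 2 * ((fst (x s))\<^sup>2 + (snd (x s))\<^sup>2)"
      using K by (simp add: \<mu>_def field_simps)
    finally show ?thesis using W_x[OF that] by linarith
  qed
  have mvt: "\<exists>u\<in>{0..T}. v s - v 0 = W (fst (x u)) (snd (x u)) * s" if "s \<in> {0<..T}" for s
  proof -
    have "\<exists>u\<in>{0<..<s}. v s - v 0 = (\<lambda>h. W (fst (x u)) (snd (x u)) * h) (s - 0)"
    proof (rule mvt_simple)
      show "0 < s" using that by simp
      fix u assume "0 \<le> u" "u \<le> s"
      then show "(v has_derivative (\<lambda>h. W (fst (x u)) (snd (x u)) * h)) (at u within {0..s})"
        using that by (intro has_derivative_subset[OF dv]) auto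
    qed
    then show ?thesis using that by auto
  qed
  have v_ge: "v s \<ge> v0" if s: "s \<in> {0..T}" for s
  proof (cases "s = 0")
    case False
    then obtain u where "u \<in> {0..T}" "v s - v 0 = W (fst (x u)) (snd (x u)) * s"
      using mvt[of s] s by auto
    moreover have "W (fst (x u)) (snd (x u)) \<ge> 0" if "u \<in> {0..T}" for u
      using W_x[OF that] \<Lambda> by (smt (verit) mult_nonneg_nonneg half_gt_zero zero_le_power2)
    ultimately have "v s \<ge> v 0"
      using s by (metis atLeastAtMost_iff diff_ge_0_iff_ge mult_nonneg_nonneg)
    then show ?thesis by (simp add: v_def v0_def x(1))
  qed (simp add: v_def v0_def x(1))
  obtain u where u: "u \<in> {0..T}" "v T - v 0 = W (fst (x u)) (snd (x u)) * T"
    using mvt[of T] T by auto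
  have "\<mu> * v0 \<le> W (fst (x u)) (snd (x u))"
    using W_v[OF u(1)] mult_left_mono[OF v_ge[OF u(1)], of \<mu>] \<mu> by linarith
  then have "v T - v 0 \<ge> \<mu> * v0 * T"
    unfolding u(2) using T by (intro mult_right_mono) auto
  moreover have "\<mu> * v0 * T = 2 * K * r\<^sup>2"
    using \<mu> v0 by (simp add: T_def)
  moreover have "v 0 > 0"
    using v0 by (simp add: v_def v0_def x(1))
  moreover have "v T \<le> 2 * K * r\<^sup>2"
  proof -
    have "v T \<le> 2 * K * (norm (x T))\<^sup>2"
      unfolding norm_prod_sq v_def by (rule Vb)
    also have "\<dots> \<le> 2 * K * r\<^sup>2"
      using small[of T] T K by (intro mult_left_mono power_mono) auto
    finally show ?thesis .
  qed
  ultimately show False by linarith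
qed

section \<open>Changes of coordinates\<close>

text \<open>Second derivatives of the change of coordinates occur multiplied by first derivatives of
  \<open>F\<close>, which vanish at a critical point. What remains is a congruence of the Hessian by
  the Jacobian matrix.\<close>

lemma hess_det_compose:
  assumes F: "smooth_family F" and U: "smooth_family U" and V: "smooth_family V"
    and sing: "singular_point (F j) (U j q p) (V j q p)"
  shows "hess_det (\<lambda>q p. F j (U j q p) (V j q p)) q p = hess_det (F j) (U j q p) (V j q p) *
    (dq (U j) q p * dp (V j) q p - dp (U j) q p * dq (V j) q p)\<^sup>2"
proof -
  let ?x = "U j q p" and ?y = "V j q p"
  define \<alpha> \<beta> \<gamma> where "\<alpha> = dq (dq (F j)) ?x ?y" and "\<beta> = dq (dp (F j)) ?x ?y" and "\<gamma> = dp (dp (F j)) ?x ?y"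
  note F1 = smooth_family_dq[OF F] smooth_family_dp[OF F]
  note U1 = smooth_family_dq[OF U] smooth_family_dp[OF U]
  note V1 = smooth_family_dq[OF V] smooth_family_dp[OF V]
  have z: "dq (F j) ?x ?y = 0" "dp (F j) ?x ?y = 0"
    using sing by (auto simp: singular_point_def)
  have cl: "dp (dq (F j)) ?x ?y = \<beta>"
    by (simp add: clairaut[OF F] \<beta>_def)
  have q1: "((\<lambda>s. dq (F j) (U j s p) (V j s p)) has_real_derivative \<alpha> * dq (U j) q p + \<beta> * dq (V j) q p) (at q)"
    by (rule DERIV_cong[OF smooth_family_DERIV_comp[OF F1(1) smooth_family_DERIV(1)[OF U] smooth_family_DERIV(1)[OF V]]])
      (simp add: cl \<alpha>_def)
  have q2: "((\<lambda>s. dp (F j) (U j s p) (V j s p)) has_real_derivative \<beta> * dq (U j) q p + \<gamma> * dq (V j) q p) (at q)"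
    by (rule DERIV_cong[OF smooth_family_DERIV_comp[OF F1(2) smooth_family_DERIV(1)[OF U] smooth_family_DERIV(1)[OF V]]])
      (simp add: \<beta>_def \<gamma>_def)
  have p2: "((\<lambda>s. dp (F j) (U j q s) (V j q s)) has_real_derivative \<beta> * dp (U j) q p + \<gamma> * dp (V j) q p) (at p)"
    by (rule DERIV_cong[OF smooth_family_DERIV_comp[OF F1(2) smooth_family_DERIV(2)[OF U] smooth_family_DERIV(2)[OF V]]])
      (simp add: \<beta>_def \<gamma>_def)
  have p1: "((\<lambda>s. dq (F j) (U j q s) (V j q s)) has_real_derivative \<alpha> * dp (U j) q p + \<beta> * dp (V j) q p) (at p)"
    by (rule DERIV_cong[OF smooth_family_DERIV_comp[OF F1(1) smooth_family_DERIV(2)[OF U] smooth_family_DERIV(2)[OF V]]])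
      (simp add: cl \<alpha>_def)
  have qq: "dq (dq (\<lambda>q p. F j (U j q p) (V j q p))) q p =
      (\<alpha> * dq (U j) q p + \<beta> * dq (V j) q p) * dq (U j) q p + (\<beta> * dq (U j) q p + \<gamma> * dq (V j) q p) * dq (V j) q p"
    unfolding chain_rule_partials[OF F U V]
    by (rule dq_eqI, rule DERIV_cong[OF DERIV_add[OF DERIV_mult[OF q1 smooth_family_DERIV(1)[OF U1(1)]]
            DERIV_mult[OF q2 smooth_family_DERIV(1)[OF V1(1)]]]])
      (simp add: z)
  have qp: "dq (dp (\<lambda>q p. F j (U j q p) (V j q p))) q p =
      (\<alpha> * dq (U j) q p + \<beta> * dq (V j) q p) * dp (U j) q p + (\<beta> * dq (U j) q p + \<gamma> * dq (V j) q p) * dp (V j) q p"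
    unfolding chain_rule_partials[OF F U V]
    by (rule dq_eqI, rule DERIV_cong[OF DERIV_add[OF DERIV_mult[OF q1 smooth_family_DERIV(1)[OF U1(2)]]
            DERIV_mult[OF q2 smooth_family_DERIV(1)[OF V1(2)]]]])
      (simp add: z)
  have pp: "dp (dp (\<lambda>q p. F j (U j q p) (V j q p))) q p =
      (\<alpha> * dp (U j) q p + \<beta> * dp (V j) q p) * dp (U j) q p + (\<beta> * dp (U j) q p + \<gamma> * dp (V j) q p) * dp (V j) q p"
    unfolding chain_rule_partials[OF F U V]
    by (rule dp_eqI, rule DERIV_cong[OF DERIV_add[OF DERIV_mult[OF p1 smooth_family_DERIV(2)[OF U1(2)]]
            DERIV_mult[OF p2 smooth_family_DERIV(2)[OF V1(2)]]]])
      (simp add: z)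
  have alg: "((\<alpha>' * a + \<beta>' * c) * a + (\<beta>' * a + \<gamma>' * c) * c) * ((\<alpha>' * b + \<beta>' * d) * b + (\<beta>' * b + \<gamma>' * d) * d)
      - ((\<alpha>' * a + \<beta>' * c) * b + (\<beta>' * a + \<gamma>' * c) * d)\<^sup>2
      = (\<alpha>' * \<gamma>' - \<beta>'\<^sup>2) * (a * d - b * c)\<^sup>2" for \<alpha>' \<beta>' \<gamma>' a b c d :: real
    by (simp add: power2_eq_square algebra_simps)
  show ?thesis
    unfolding hess_det_def[of "\<lambda>q p. F j (U j q p) (V j q p)"] qq qp pp alg
    by (simp add: hess_det_def \<alpha>_def \<beta>_def \<gamma>_def)
qed

text \<open>The gradient is multiplied by an invertible matrix, and Cramer's rule recovers
  it.\<close>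

lemma singular_point_compose_iff:
  assumes F: "smooth_family F" and U: "smooth_family U" and V: "smooth_family V"
    and det: "dq (U j) q p * dp (V j) q p - dp (U j) q p * dq (V j) q p \<noteq> 0"
  shows "singular_point (\<lambda>q p. F j (U j q p) (V j q p)) q p \<longleftrightarrow>
    singular_point (F j) (U j q p) (V j q p)"
proof -
  have "x * a + y * c = 0 \<and> x * b + y * d = 0 \<longleftrightarrow> x = 0 \<and> y = 0"
    if "a * d - b * c \<noteq> 0" for x y a b c d :: real
  proof (intro iffI conjI; (elim conjE)?)
    assume *: "x * a + y * c = 0" "x * b + y * d = 0"
    have "x * (a * d - b * c) = (x * a + y * c) * d - (x * b + y * d) * c"
      "y * (a * d - b * c) = (x * b + y * d) * a - (x * a + y * c) * b"
      by (simp_all add: algebra_simps)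
    with * that show "x = 0" "y = 0" by auto
  qed auto
  from this[OF det] show ?thesis
    by (simp add: singular_point_def chain_rule_partials[OF F U V])
qed

section \<open>Inverse functions depending on a parameter\<close>

lemma open_contains_box:
  assumes "open S" "(j0, 0, 0) \<in> S"
  obtains d where "d > 0" "\<And>j q p::real. \<bar>j - j0\<bar> < d \<Longrightarrow> \<bar>q\<bar> < d \<Longrightarrow> \<bar>p\<bar> < d \<Longrightarrow> (j, q, p) \<in> S"
proof -
  obtain e where e: "e > 0" "ball (j0, 0, 0) e \<subseteq> S"
    using assms open_contains_ball by metis
  show thesis
  proof
    show "e / 3 > 0" using e by simp
    fix j q p :: real assume *: "\<bar>j - j0\<bar> < e / 3" "\<bar>q\<bar> < e / 3" "\<bar>p\<bar> < e / 3"
    have "dist (j, q, p) (j0, 0, 0) \<le> \<bar>j - j0\<bar> + (\<bar>q\<bar> + \<bar>p\<bar>)"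
      using norm_Pair_le[of "j - j0" "(q, p)"] norm_Pair_le[of q p] by (simp add: dist_norm)
    with * have "(j, q, p) \<in> ball (j0, 0, 0) e"
      by (simp add: dist_commute)
    with e show "(j, q, p) \<in> S" by blast
  qed
qed

text \<open>Carrying \<open>j\<close> along as a coordinate gives a map of three-space whose
  derivative has the planar Jacobian as its determinant. A single use of the inverse function
  theorem then serves all nearby \<open>j\<close>, with neighbourhoods that do not shrink.\<close>

lemma inverse_function_family:
  assumes A: "smooth_family A" and B: "smooth_family B"
    and det: "dq (A j0) 0 0 * dp (B j0) 0 0 - dp (A j0) 0 0 * dq (B j0) 0 0 \<noteq> 0"
  obtains S T \<Psi> where "open S" "(j0, 0, 0) \<in> S" "open T" "(j0, A j0 0 0, B j0 0 0) \<in> T"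
    "homeomorphism S T (\<lambda>(j, q, p). (j, A j q p, B j q p)) \<Psi>"
proof -
  define \<Phi> where "\<Phi> = (\<lambda>(j, q, p). (j, A j q p, B j q p))"
  define D where "D = (\<lambda>(j, q, p) (i, h, k).
      (i, deriv (\<lambda>i. A i q p) j * i + dq (A j) q p * h + dp (A j) q p * k,
          deriv (\<lambda>i. B i q p) j * i + dq (B j) q p * h + dp (B j) q p * k))"
  have D: "(\<Phi> has_derivative D x) (at x)" for x
  proof (cases x)
    case (fields j q p)
    have "((\<lambda>x. (fst x, (\<lambda>(j, q, p). A j q p) x, (\<lambda>(j, q, p). B j q p) x)) has_derivative
       (\<lambda>y. (fst y, (\<lambda>(i, h, k). deriv (\<lambda>i. A i q p) j * i + dq (A j) q p * h + dp (A j) q p * k) y,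
         (\<lambda>(i, h, k). deriv (\<lambda>i. B i q p) j * i + dq (B j) q p * h + dp (B j) q p * k) y))) (at (j, q, p))"
      by (intro has_derivative_Pair has_derivative_fst has_derivative_ident
          smooth_family_has_derivative A B)
    moreover have "\<Phi> = (\<lambda>x. (fst x, (\<lambda>(j, q, p). A j q p) x, (\<lambda>(j, q, p). B j q p) x))"
      by (auto simp: \<Phi>_def)
    moreover have "D x = (\<lambda>y. (fst y, (\<lambda>(i, h, k). deriv (\<lambda>i. A i q p) j * i + dq (A j) q p * h + dp (A j) q p * k) y,
         (\<lambda>(i, h, k). deriv (\<lambda>i. B i q p) j * i + dq (B j) q p * h + dp (B j) q p * k) y))"
      by (auto simp: D_def fields)
    ultimately show ?thesis by (simp add: fields)
  qed
  have bl: "bounded_linear (D x)" for x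
    using D has_derivative_bounded_linear by blast
  let ?f' = "\<lambda>x. Blinfun (D x)"
  have cont: "continuous_on UNIV ?f'"
  proof (rule continuous_on_blinfun_componentwise)
    fix i :: "real \<times> real \<times> real"
    obtain i1 h k where i: "i = (i1, h, k)" by (cases i)
    have eq: "(\<lambda>x. blinfun_apply (?f' x) i) = (\<lambda>x. (i1,
        (\<lambda>(j, q, p). deriv (\<lambda>i. A i q p) j) x * i1 + (\<lambda>(j, q, p). dq (A j) q p) x * h + (\<lambda>(j, q, p). dp (A j) q p) x * k,
        (\<lambda>(j, q, p). deriv (\<lambda>i. B i q p) j) x * i1 + (\<lambda>(j, q, p). dq (B j) q p) x * h + (\<lambda>(j, q, p). dp (B j) q p) x * k))"
      unfolding bounded_linear_Blinfun_apply[OF bl] by (auto simp: D_def i)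
    show "continuous_on UNIV (\<lambda>x. blinfun_apply (?f' x) i)"
      unfolding eq
      by (intro continuous_intros smooth_family_continuous smooth_family_dj smooth_family_dq
          smooth_family_dp A B)
  qed
  have inj: "inj (D (j0, 0, 0))"
  proof -
    have lin: "linear (D (j0, 0, 0))"
      using bl bounded_linear.linear by blast
    have "y = 0" if "D (j0, 0, 0) y = 0" for y
    proof -
      obtain i h k where y: "y = (i, h, k)" by (cases y)
      have "i = 0" "dq (A j0) 0 0 * h + dp (A j0) 0 0 * k = 0" "dq (B j0) 0 0 * h + dp (B j0) 0 0 * k = 0"
        using that by (auto simp: D_def y zero_prod_def)
      moreover have "h * (dq (A j0) 0 0 * dp (B j0) 0 0 - dp (A j0) 0 0 * dq (B j0) 0 0) =
          (dq (A j0) 0 0 * h + dp (A j0) 0 0 * k) * dp (B j0) 0 0 - (dq (B j0) 0 0 * h + dp (B j0) 0 0 * k) * dp (A j0) 0 0"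
        "k * (dq (A j0) 0 0 * dp (B j0) 0 0 - dp (A j0) 0 0 * dq (B j0) 0 0) =
          (dq (B j0) 0 0 * h + dp (B j0) 0 0 * k) * dq (A j0) 0 0 - (dq (A j0) 0 0 * h + dp (A j0) 0 0 * k) * dq (B j0) 0 0"
        by (simp_all add: algebra_simps)
      ultimately show ?thesis
        using det by (auto simp: y zero_prod_def)
    qed
    then show ?thesis
      using linear_injective_0[OF lin] by blast
  qed
  then obtain g where g: "linear g" "g \<circ> D (j0, 0, 0) = id"
    using linear_injective_left_inverse bl bounded_linear.linear by metis
  have blg: "bounded_linear g"
    using g(1) linear_conv_bounded_linear by blast
  have inv: "Blinfun g o\<^sub>L ?f' (j0, 0, 0) = id_blinfun"
    by (rule blinfun_eqI)
      (use pointfree_idE[OF g(2)] in \<open>simp add: bounded_linear_Blinfun_apply[OF bl] bounded_linear_Blinfun_apply[OF blg]\<close>)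
  have der: "(\<Phi> has_derivative blinfun_apply (?f' x)) (at x)" for x
    using D by (simp add: bounded_linear_Blinfun_apply[OF bl])
  show thesis
  proof (rule inverse_function_theorem[OF open_UNIV der cont UNIV_I inv])
    fix S T \<Psi>
    assume "open S" "(j0, 0, 0) \<in> S" "open T" "\<Phi> (j0, 0, 0) \<in> T" "homeomorphism S T \<Phi> \<Psi>"
    then show thesis
      by (intro that[of S T \<Psi>]) (auto simp: \<Phi>_def)
  qed
qed

text \<open>Serves two purposes. With \<open>q\<close> for \<open>A\<close> and the derivative in
  \<open>p\<close> for \<open>B\<close> it is an implicit function theorem for the curve on which
  that derivative vanishes; with \<open>U\<close> and \<open>V\<close> it inverts the change of
  coordinates.\<close>

lemma local_inverse_family:
  assumes A: "smooth_family A" and B: "smooth_family B"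
    and z: "A j0 0 0 = 0" "B j0 0 0 = 0"
    and det: "dq (A j0) 0 0 * dp (B j0) 0 0 - dp (A j0) 0 0 * dq (B j0) 0 0 \<noteq> 0"
    and r: "r > 0"
  obtains d P Q where "d > 0"
    "\<And>j x y. \<bar>j - j0\<bar> < d \<Longrightarrow> \<bar>x\<bar> < d \<Longrightarrow> \<bar>y\<bar> < d \<Longrightarrow>
       \<bar>P j x y\<bar> + \<bar>Q j x y\<bar> < r \<and> A j (P j x y) (Q j x y) = x \<and> B j (P j x y) (Q j x y) = y"
    "\<And>j. \<bar>j - j0\<bar> < d \<Longrightarrow> continuous_on {x. \<bar>x\<bar> < d} (\<lambda>x. Q j x 0)"
    "\<And>j q p q' p'. \<bar>j - j0\<bar> < d \<Longrightarrow> \<bar>q\<bar> < d \<Longrightarrow> \<bar>p\<bar> < d \<Longrightarrow> \<bar>q'\<bar> < d \<Longrightarrow> \<bar>p'\<bar> < d \<Longrightarrow>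
       A j q p = A j q' p' \<Longrightarrow> B j q p = B j q' p' \<Longrightarrow> (q, p) = (q', p')"
proof -
  let ?\<Phi> = "\<lambda>(j, q, p). (j, A j q p, B j q p)"
  obtain S T \<Psi> where ST: "open S" "(j0, 0, 0) \<in> S" "open T" "(j0, 0, 0) \<in> T" "homeomorphism S T ?\<Phi> \<Psi>"
    by (rule inverse_function_family[OF A B det, unfolded z])
  define P where "P j x y = fst (snd (\<Psi> (j, x, y)))" for j x y
  define Q where "Q j x y = snd (snd (\<Psi> (j, x, y)))" for j x y
  have hom: "\<And>x. x \<in> S \<Longrightarrow> \<Psi> (?\<Phi> x) = x" "\<And>y. y \<in> T \<Longrightarrow> ?\<Phi> (\<Psi> y) = y" "continuous_on T \<Psi>"
    using ST(5) by (auto simp: homeomorphism_def)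
  have \<Psi>: "\<Psi> (j, x, y) = (j, P j x y, Q j x y)" if "(j, x, y) \<in> T" for j x y
    using hom(2)[OF that] by (auto simp: P_def Q_def split: prod.splits)
  have \<Psi>0: "\<Psi> (j0, 0, 0) = (j0, 0, 0)"
    using hom(1)[OF ST(2)] by (simp add: z)
  define E where "E = T \<inter> \<Psi> -` {x. \<bar>fst (snd x)\<bar> + \<bar>snd (snd x)\<bar> < r}"
  have "open {x::real \<times> real \<times> real. \<bar>fst (snd x)\<bar> + \<bar>snd (snd x)\<bar> < r}"
    by (intro open_Collect_less continuous_intros)
  then have "open E"
    unfolding E_def using hom(3) ST(3) continuous_open_preimage by blast
  moreover have "(j0, 0, 0) \<in> E"
    using ST(4) r by (simp add: E_def \<Psi>0)
  ultimately have "open (E \<inter> S)" "(j0, 0, 0) \<in> E \<inter> S"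
    using ST by auto
  \<comment> \<open>The box lies in \<open>E\<close>, so each of its points is a value with a
    preimage of size below \<open>r\<close>, and in \<open>S\<close>, so the map is injective on its
    slices.\<close>
  then obtain d where d: "d > 0"
    "\<And>j q p::real. \<bar>j - j0\<bar> < d \<Longrightarrow> \<bar>q\<bar> < d \<Longrightarrow> \<bar>p\<bar> < d \<Longrightarrow> (j, q, p) \<in> E \<inter> S"
    by (rule open_contains_box) blast
  show thesis
  proof
    show "d > 0" by fact
    show "\<bar>P j x y\<bar> + \<bar>Q j x y\<bar> < r \<and> A j (P j x y) (Q j x y) = x \<and> B j (P j x y) (Q j x y) = y"
      if "\<bar>j - j0\<bar> < d" "\<bar>x\<bar> < d" "\<bar>y\<bar> < d" for j x y
    proof -
      have "(j, x, y) \<in> E" using d that by blast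
      then have "(j, x, y) \<in> T" "\<bar>P j x y\<bar> + \<bar>Q j x y\<bar> < r"
        by (auto simp: E_def P_def Q_def)
      with hom(2)[of "(j, x, y)"] show ?thesis
        by (simp add: \<Psi>)
    qed
    show "continuous_on {x. \<bar>x\<bar> < d} (\<lambda>x. Q j x 0)" if "\<bar>j - j0\<bar> < d" for j
      unfolding Q_def
      by (intro continuous_on_snd continuous_on_compose2[OF hom(3), of _ "\<lambda>x. (j, x, 0)"] continuous_intros)
        (use d that in \<open>auto simp: E_def\<close>)
    show "(q, p) = (q', p')" if "\<bar>j - j0\<bar> < d" "\<bar>q\<bar> < d" "\<bar>p\<bar> < d" "\<bar>q'\<bar> < d" "\<bar>p'\<bar> < d"
      "A j q p = A j q' p'" "B j q p = B j q' p'" for j q p q' p'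
    proof -
      have "(j, q, p) \<in> S" "(j, q', p') \<in> S" using d that by blast+
      then show ?thesis
        using hom(1)[of "(j, q, p)"] hom(1)[of "(j, q', p')"] that by simp
    qed
  qed
qed

section \<open>Flips at simple zeros of the quadratic coefficient\<close>

lemma DERIV_bounds:
  assumes "(f has_real_derivative D) (at x)" "e > 0"
  obtains d where "d > 0" "\<And>y. \<bar>y - x\<bar> < d \<Longrightarrow> \<bar>f y - f x - D * (y - x)\<bar> \<le> e * \<bar>y - x\<bar>"
proof -
  have "\<exists>d>0. \<forall>y. norm (y - x) < d \<longrightarrow> norm (f y - f x - D * (y - x)) \<le> e * norm (y - x)"
    using assms unfolding has_field_derivative_def has_derivative_at_alt by blast
  then show thesis using that by auto
qed

lemma smooth_isCont: "smooth f \<Longrightarrow> isCont f x" for f :: "real \<Rightarrow> real"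
  using smooth_deriv(1) DERIV_isCont by blast

lemma isCont_real_near:
  fixes f :: "real \<Rightarrow> real"
  assumes "isCont f x" "e > 0"
  obtains d where "d > 0" "\<And>y. \<bar>y - x\<bar> < d \<Longrightarrow> \<bar>f y - f x\<bar> < e"
  using assms unfolding continuous_at_eps_delta dist_real_def by metis

text \<open>The situation at frozen \<open>t\<close>, recentred at an arbitrary \<open>j0\<close>.
  That \<open>n1\<close> vanishes at \<open>j0\<close> is not built in, so the locale serves both
  for the presence of a flip and for its absence.\<close>

locale normal_form_family =
  fixes a b :: real and n1 n2 :: "real \<Rightarrow> real" and F U V :: "real \<Rightarrow> real \<Rightarrow> real \<Rightarrow> real"
    and j0 \<rho> :: real
  assumes a: "a \<noteq> 0" and b: "b \<noteq> 0" and n1: "smooth n1" and n2: "smooth n2"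
    and F: "smooth_family F" and U: "smooth_family U" and V: "smooth_family V" and \<rho>: "\<rho> > 0"
    and origin: "\<And>j. \<bar>j - j0\<bar> < \<rho> \<Longrightarrow> U j 0 0 = 0" "\<And>j. \<bar>j - j0\<bar> < \<rho> \<Longrightarrow> V j 0 0 = 0"
    and jac: "\<And>j. \<bar>j - j0\<bar> < \<rho> \<Longrightarrow> dq (U j) 0 0 * dp (V j) 0 0 - dp (U j) 0 0 * dq (V j) 0 0 \<noteq> 0"
    and jet: "\<And>j. \<bar>j - j0\<bar> < \<rho> \<Longrightarrow> same_jet_at0 6 (\<lambda>q p. F j (U j q p) (V j q p))
        (\<lambda>q p. a / 2 * p ^ 2 + b / 6 * q ^ 6 + n1 j / 2 * q ^ 2 + n2 j / 4 * q ^ 4)"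
begin

definition g where "g j q p = F j (U j q p) (V j q p)"

lemma g_smooth: "smooth_family g"
  unfolding g_def by (rule smooth_family_compose[OF F U V])

lemma g_eq: "(\<lambda>q p. F j (U j q p) (V j q p)) = g j"
  by (simp add: g_def fun_eq_iff)

text \<open>The difference to the normal form has vanishing 6-jet and is thus of order 7; each
  derivative costs one order, which leaves 6 for the gradient and 5 for the Hessian. Halving the
  width provides a compact set of parameters, hence one constant for all \<open>j\<close>.\<close>

lemma estimates:
  obtains C where "C > 0"
    "\<And>j q p. \<bar>j - j0\<bar> \<le> \<rho> / 2 \<Longrightarrow> \<bar>q\<bar> + \<bar>p\<bar> \<le> 1 \<Longrightarrow>
      \<bar>dq (g j) q p - q * (n1 j + n2 j * q\<^sup>2 + b * q ^ 4)\<bar> \<le> C * (\<bar>q\<bar> + \<bar>p\<bar>) ^ 6 \<and>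
      \<bar>dp (g j) q p - a * p\<bar> \<le> C * (\<bar>q\<bar> + \<bar>p\<bar>) ^ 6 \<and>
      \<bar>dq (dq (g j)) q p - (n1 j + 3 * n2 j * q\<^sup>2 + 5 * b * q ^ 4)\<bar> \<le> C * (\<bar>q\<bar> + \<bar>p\<bar>) ^ 5 \<and>
      \<bar>dq (dp (g j)) q p\<bar> \<le> C * (\<bar>q\<bar> + \<bar>p\<bar>) ^ 5 \<and>
      \<bar>dp (dp (g j)) q p - a\<bar> \<le> C * (\<bar>q\<bar> + \<bar>p\<bar>) ^ 5"
proof -
  define h where "h j q p = a / 2 * p ^ 2 + b / 6 * q ^ 6 + n1 j / 2 * q ^ 2 + n2 j / 4 * q ^ 4" for j q p
  define R where "R j q p = g j q p - h j q p" for j q p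
  have div: "smooth_family (\<lambda>j q p. c j / k)" if "smooth c" for c and k :: real
    using smooth_family_parameter[OF smooth_mult[OF smooth_const that, of "inverse k"]]
    by (simp add: field_simps)
  have h: "smooth_family h"
    unfolding h_def by (intro smooth_family_arith smooth_family_power smooth_family_const
        smooth_family_vars div n1 n2)
  have R: "smooth_family R"
    unfolding R_def by (intro smooth_family_arith g_smooth h)
  let ?J = "{j0 - \<rho> / 2..j0 + \<rho> / 2}"
  have J: "j \<in> ?J \<longleftrightarrow> \<bar>j - j0\<bar> \<le> \<rho> / 2" for j
    by (simp only: atLeastAtMost_iff) arith
  have jetR: "partials m n (R j) 0 0 = 0" if "j \<in> ?J" "m + n < 7" for j m n
  proof -
    have "\<bar>j - j0\<bar> < \<rho>" using that(1) \<rho> unfolding J by linarith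
    moreover have "(\<lambda>q p. a / 2 * p ^ 2 + b / 6 * q ^ 6 + n1 j / 2 * q ^ 2 + n2 j / 4 * q ^ 4) = h j"
      by (simp add: h_def fun_eq_iff)
    ultimately have "same_jet_at0 6 (g j) (h j)"
      using jet[of j] unfolding g_eq by simp
    then have "partials m n (g j) 0 0 = partials m n (h j) 0 0"
      using that(2) unfolding same_jet_at0_def by simp
    moreover have "R j = (\<lambda>q p. g j q p - h j q p)"
      by (simp add: R_def fun_eq_iff)
    ultimately show ?thesis
      using partials_diff[OF g_smooth h, of m n j] by simp
  qed
  note Rq = smooth_family_dq[OF R] and Rp = smooth_family_dp[OF R]
  have "partials m n (dq (R j)) 0 0 = 0" "partials m n (dp (R j)) 0 0 = 0"
    if "j \<in> ?J" "m + n < 6" for j m n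
    using that jetR[of j "Suc m" n] jetR[of j m "Suc n"] by (simp_all add: partials_dq[OF R] partials_dp)
  note jet1 = this
  have "partials m n (dq (dq (R j))) 0 0 = 0" "partials m n (dq (dp (R j))) 0 0 = 0"
    "partials m n (dp (dp (R j))) 0 0 = 0"
    if "j \<in> ?J" "m + n < 5" for j m n
    using that jet1(1)[of j "Suc m" n] jet1(2)[of j "Suc m" n] jet1(2)[of j m "Suc n"]
    by (simp_all add: partials_dq[OF Rq] partials_dq[OF Rp] partials_dp)
  note jet2 = this
  have cJ: "compact ?J" by simp
  obtain C1 where C1: "C1 > 0" "\<forall>j\<in>?J. \<forall>q p. \<bar>q\<bar> + \<bar>p\<bar> \<le> 1 \<longrightarrow> \<bar>dq (R j) q p\<bar> \<le> C1 * (\<bar>q\<bar> + \<bar>p\<bar>) ^ 6"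
    using taylor_bound[OF Rq cJ jet1(1)] by blast
  obtain C2 where C2: "C2 > 0" "\<forall>j\<in>?J. \<forall>q p. \<bar>q\<bar> + \<bar>p\<bar> \<le> 1 \<longrightarrow> \<bar>dp (R j) q p\<bar> \<le> C2 * (\<bar>q\<bar> + \<bar>p\<bar>) ^ 6"
    using taylor_bound[OF Rp cJ jet1(2)] by blast
  obtain C3 where C3: "C3 > 0" "\<forall>j\<in>?J. \<forall>q p. \<bar>q\<bar> + \<bar>p\<bar> \<le> 1 \<longrightarrow> \<bar>dq (dq (R j)) q p\<bar> \<le> C3 * (\<bar>q\<bar> + \<bar>p\<bar>) ^ 5"
    using taylor_bound[OF smooth_family_dq[OF Rq] cJ jet2(1)] by blast
  obtain C4 where C4: "C4 > 0" "\<forall>j\<in>?J. \<forall>q p. \<bar>q\<bar> + \<bar>p\<bar> \<le> 1 \<longrightarrow> \<bar>dq (dp (R j)) q p\<bar> \<le> C4 * (\<bar>q\<bar> + \<bar>p\<bar>) ^ 5"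
    using taylor_bound[OF smooth_family_dq[OF Rp] cJ jet2(2)] by blast
  obtain C5 where C5: "C5 > 0" "\<forall>j\<in>?J. \<forall>q p. \<bar>q\<bar> + \<bar>p\<bar> \<le> 1 \<longrightarrow> \<bar>dp (dp (R j)) q p\<bar> \<le> C5 * (\<bar>q\<bar> + \<bar>p\<bar>) ^ 5"
    using taylor_bound[OF smooth_family_dp[OF Rp] cJ jet2(3)] by blast
  define C where "C = C1 + C2 + C3 + C4 + C5"
  have Cge: "C1 \<le> C" "C2 \<le> C" "C3 \<le> C" "C4 \<le> C" "C5 \<le> C" "C > 0"
    using C1(1) C2(1) C3(1) C4(1) C5(1) by (simp_all add: C_def)
  have dR: "dq (R j) = (\<lambda>q p. dq (g j) q p - q * (n1 j + n2 j * q\<^sup>2 + b * q ^ 4))"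
    "dp (R j) = (\<lambda>q p. dp (g j) q p - a * p)" for j
    unfolding R_def h_def
    by (intro ext dq_eqI, rule DERIV_cong, rule DERIV_diff, rule smooth_family_DERIV(1)[OF g_smooth],
        (rule derivative_eq_intros refl)+, simp add: field_simps power2_eq_square power4_eq_xxxx eval_nat_numeral)
      (intro ext dp_eqI, rule DERIV_cong, rule DERIV_diff, rule smooth_family_DERIV(2)[OF g_smooth],
        (rule derivative_eq_intros refl)+, simp)
  have ddR: "dq (dq (R j)) q p = dq (dq (g j)) q p - (n1 j + 3 * n2 j * q\<^sup>2 + 5 * b * q ^ 4)" for j q p
    unfolding dR
    by (rule dq_eqI, rule DERIV_cong, rule DERIV_diff, rule smooth_family_DERIV(1)[OF smooth_family_dq[OF g_smooth]],
        (rule derivative_eq_intros refl)+, simp add: field_simps power2_eq_square power4_eq_xxxx eval_nat_numeral)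
  have dqp: "dq (dp (R j)) q p = dq (dp (g j)) q p" for j q p
    unfolding dR
    by (rule dq_eqI, rule DERIV_cong, rule DERIV_diff, rule smooth_family_DERIV(1)[OF smooth_family_dp[OF g_smooth]],
        (rule derivative_eq_intros refl)+, simp)
  have dpp: "dp (dp (R j)) q p = dp (dp (g j)) q p - a" for j q p
    unfolding dR
    by (rule dp_eqI, rule DERIV_cong, rule DERIV_diff, rule smooth_family_DERIV(2)[OF smooth_family_dp[OF g_smooth]],
        (rule derivative_eq_intros refl)+, simp)
  have up: "\<bar>z\<bar> \<le> C * (\<bar>q\<bar> + \<bar>p\<bar>) ^ k" if "\<bar>z\<bar> \<le> D * (\<bar>q\<bar> + \<bar>p\<bar>) ^ k" "D \<le> C" for z q p D :: real and k
    using that mult_right_mono[OF that(2), of "(\<bar>q\<bar> + \<bar>p\<bar>) ^ k"] by simp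
  show thesis
  proof
    show "C > 0" by fact
    fix j q p :: real assume j: "\<bar>j - j0\<bar> \<le> \<rho> / 2" and qp: "\<bar>q\<bar> + \<bar>p\<bar> \<le> 1"
    from j have j: "j \<in> ?J" unfolding J .
    show "\<bar>dq (g j) q p - q * (n1 j + n2 j * q\<^sup>2 + b * q ^ 4)\<bar> \<le> C * (\<bar>q\<bar> + \<bar>p\<bar>) ^ 6 \<and>
      \<bar>dp (g j) q p - a * p\<bar> \<le> C * (\<bar>q\<bar> + \<bar>p\<bar>) ^ 6 \<and>
      \<bar>dq (dq (g j)) q p - (n1 j + 3 * n2 j * q\<^sup>2 + 5 * b * q ^ 4)\<bar> \<le> C * (\<bar>q\<bar> + \<bar>p\<bar>) ^ 5 \<and>
      \<bar>dq (dp (g j)) q p\<bar> \<le> C * (\<bar>q\<bar> + \<bar>p\<bar>) ^ 5 \<and>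
      \<bar>dp (dp (g j)) q p - a\<bar> \<le> C * (\<bar>q\<bar> + \<bar>p\<bar>) ^ 5"
      using up[OF C1(2)[rule_format, OF j qp] Cge(1)] up[OF C2(2)[rule_format, OF j qp] Cge(2)]
        up[OF C3(2)[rule_format, OF j qp] Cge(3)] up[OF C4(2)[rule_format, OF j qp] Cge(4)]
        up[OF C5(2)[rule_format, OF j qp] Cge(5)]
      unfolding ddR dqp dpp by (simp add: dR)
  qed
qed

lemma at_origin:
  assumes "\<bar>j - j0\<bar> \<le> \<rho> / 2"
  shows "dq (g j) 0 0 = 0" "dp (g j) 0 0 = 0" "dq (dq (g j)) 0 0 = n1 j" "dq (dp (g j)) 0 0 = 0"
    "dp (dp (g j)) 0 0 = a"
proof -
  obtain C where C: "C > 0"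
    "\<And>j q p. \<bar>j - j0\<bar> \<le> \<rho> / 2 \<Longrightarrow> \<bar>q\<bar> + \<bar>p\<bar> \<le> 1 \<Longrightarrow>
      \<bar>dq (g j) q p - q * (n1 j + n2 j * q\<^sup>2 + b * q ^ 4)\<bar> \<le> C * (\<bar>q\<bar> + \<bar>p\<bar>) ^ 6 \<and>
      \<bar>dp (g j) q p - a * p\<bar> \<le> C * (\<bar>q\<bar> + \<bar>p\<bar>) ^ 6 \<and>
      \<bar>dq (dq (g j)) q p - (n1 j + 3 * n2 j * q\<^sup>2 + 5 * b * q ^ 4)\<bar> \<le> C * (\<bar>q\<bar> + \<bar>p\<bar>) ^ 5 \<and>
      \<bar>dq (dp (g j)) q p\<bar> \<le> C * (\<bar>q\<bar> + \<bar>p\<bar>) ^ 5 \<and>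
      \<bar>dp (dp (g j)) q p - a\<bar> \<le> C * (\<bar>q\<bar> + \<bar>p\<bar>) ^ 5"
    by (rule estimates) blast
  from C(2)[OF assms, of 0 0] show "dq (g j) 0 0 = 0" "dp (g j) 0 0 = 0" "dq (dq (g j)) 0 0 = n1 j" "dq (dp (g j)) 0 0 = 0"
    "dp (dp (g j)) 0 0 = a"
    by simp_all
qed

lemma stability:
  assumes "\<bar>j - j0\<bar> \<le> \<rho> / 2"
  shows "a * n1 j > 0 \<Longrightarrow> stable_origin (F j)" "a * n1 j < 0 \<Longrightarrow> \<not> stable_origin (F j)"
proof -
  have j: "\<bar>j - j0\<bar> < \<rho>" using assms \<rho> by linarith
  let ?D = "dq (U j) 0 0 * dp (V j) 0 0 - dp (U j) 0 0 * dq (V j) 0 0"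
  have "singular_point (g j) 0 0"
    using at_origin[OF assms] by (simp add: singular_point_def)
  then have sing: "singular_point (F j) 0 0"
    using singular_point_compose_iff[OF F U V jac[OF j]] origin j unfolding g_eq by simp
  have "hess_det (g j) 0 0 = n1 j * a"
    using at_origin[OF assms] by (simp add: hess_det_def)
  then have eq: "a * n1 j = hess_det (F j) 0 0 * ?D\<^sup>2"
    using hess_det_compose[OF F U V, of j 0 0] sing origin j unfolding g_eq by simp
  have "?D\<^sup>2 > 0" using jac[OF j] by simp
  then show "a * n1 j > 0 \<Longrightarrow> stable_origin (F j)" "a * n1 j < 0 \<Longrightarrow> \<not> stable_origin (F j)"
    using stable_origin_if_definite[OF F sing] not_stable_origin_if_indefinite[OF F sing]
    unfolding eq by (auto simp: zero_less_mult_iff mult_less_0_iff)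
qed

text \<open>By continuity \<open>n1\<close> keeps its sign near \<open>j0\<close>, so stability of
  the origin is constant there, while either kind of flip demands that it differ on the two sides of
  \<open>j0\<close>.\<close>

lemma no_flip:
  assumes "n1 j0 \<noteq> 0"
  shows "\<not> ham_flip F j0" "\<not> dual_ham_flip F j0"
proof -
  obtain d where d: "d > 0" "\<And>y. \<bar>y - j0\<bar> < d \<Longrightarrow> \<bar>n1 y - n1 j0\<bar> < \<bar>n1 j0\<bar>"
    using isCont_real_near[OF smooth_isCont[OF n1], of "\<bar>n1 j0\<bar>" j0] assms by auto
  have const: "stable_origin (F j) \<longleftrightarrow> a * n1 j0 > 0" if "\<bar>j - j0\<bar> < min d (\<rho> / 2)" for j
  proof -
    have "n1 j0 > 0 \<and> n1 j > 0 \<or> n1 j0 < 0 \<and> n1 j < 0"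
      using d(2)[of j] that assms by auto
    then have "a * n1 j > 0 \<and> a * n1 j0 > 0 \<or> a * n1 j < 0 \<and> a * n1 j0 < 0"
      using a by (auto simp: zero_less_mult_iff mult_less_0_iff)
    then show ?thesis
      using stability[of j] that by auto
  qed
  have contra: False if "flip_shape F j0 B T" "\<And>j. \<bar>j - j0\<bar> < min d (\<rho> / 2) \<Longrightarrow> B (F j) \<longleftrightarrow> P" for B T P
  proof -
    from that(1) obtain \<sigma> \<epsilon> :: real where "\<sigma> \<in> {-1, 1}" and e: "\<epsilon> > 0"
      "\<And>j. 0 < \<sigma> * (j0 - j) \<and> \<sigma> * (j0 - j) < \<epsilon> \<Longrightarrow> B (F j)"
      "\<And>j. 0 < \<sigma> * (j - j0) \<and> \<sigma> * (j - j0) < \<epsilon> \<Longrightarrow> \<not> B (F j)"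
      unfolding flip_shape_def by blast
    then have \<sigma>: "\<sigma> = -1 \<or> \<sigma> = 1" by simp
    define s where "s = min \<epsilon> (min d (\<rho> / 2)) / 2"
    have s: "s > 0" "s < \<epsilon>" "s < min d (\<rho> / 2)"
      using e(1) d(1) \<rho> by (auto simp: s_def min_def)
    have "B (F (j0 - \<sigma> * s))"
      using s \<sigma> by (intro e(2)) auto
    moreover have "\<not> B (F (j0 + \<sigma> * s))"
      using s \<sigma> by (intro e(3)) auto
    moreover have "\<bar>j0 - \<sigma> * s - j0\<bar> < min d (\<rho> / 2)" "\<bar>j0 + \<sigma> * s - j0\<bar> < min d (\<rho> / 2)"
      using s \<sigma> by auto
    ultimately show False using that(2) by blast
  qed
  show "\<not> ham_flip F j0"
    unfolding ham_flip_def using contra[where B = stable_origin] const by blast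
  show "\<not> dual_ham_flip F j0"
    unfolding dual_ham_flip_def using contra[where B = "\<lambda>g. \<not> stable_origin g" and P = "\<not> (a * n1 j0 > 0)"] const by blast
qed

text \<open>Near a simple zero of \<open>n1\<close> the lower-order coefficient \<open>n2\<close> is either non-zero, and its term
  dominates \<open>b q^4\<close>, or it vanishes, and then it is \<open>O(n1)\<close>. Either way the reduced equation
  becomes \<open>n1 + \<kappa> q^m\<close> up to a relatively small error.\<close>

lemma leading_term:
  assumes z: "n1 j0 = 0" and dz: "deriv n1 j0 \<noteq> 0"
  obtains \<kappa> m where "\<kappa> \<noteq> 0" "m = 2 \<or> m = (4::nat)" "n2 j0 \<noteq> 0 \<Longrightarrow> \<kappa> = n2 j0"
    "\<And>\<eta>. \<eta> > 0 \<Longrightarrow> \<exists>r>0. \<forall>j q. \<bar>j - j0\<bar> < r \<longrightarrow> \<bar>q\<bar> < r \<longrightarrow>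
       \<bar>n2 j * q\<^sup>2 + b * q ^ 4 - \<kappa> * q ^ m\<bar> \<le> \<eta> * (\<bar>n1 j\<bar> + q ^ m) \<and>
       \<bar>3 * n2 j * q\<^sup>2 + 5 * b * q ^ 4 - (real m + 1) * \<kappa> * q ^ m\<bar> \<le> \<eta> * (\<bar>n1 j\<bar> + q ^ m)"
proof (cases "n2 j0 = 0")
  case False
  have "\<exists>r>0. \<forall>j q. \<bar>j - j0\<bar> < r \<longrightarrow> \<bar>q\<bar> < r \<longrightarrow>
       \<bar>n2 j * q\<^sup>2 + b * q ^ 4 - n2 j0 * q ^ 2\<bar> \<le> \<eta> * (\<bar>n1 j\<bar> + q ^ 2) \<and>
       \<bar>3 * n2 j * q\<^sup>2 + 5 * b * q ^ 4 - (real 2 + 1) * n2 j0 * q ^ 2\<bar> \<le> \<eta> * (\<bar>n1 j\<bar> + q ^ 2)"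
    if \<eta>: "\<eta> > 0" for \<eta>
  proof -
    obtain d where d: "d > 0" "\<And>y. \<bar>y - j0\<bar> < d \<Longrightarrow> \<bar>n2 y - n2 j0\<bar> < \<eta> / 6"
      using isCont_real_near[OF smooth_isCont[OF n2], of "\<eta> / 6" j0] \<eta> by auto
    define r where "r = min d (min 1 (\<eta> / (10 * \<bar>b\<bar>)))"
    have r: "r > 0" "r \<le> d" "r \<le> 1" "r * (5 * \<bar>b\<bar>) \<le> \<eta> / 2"
    proof -
      show "r > 0" using d \<eta> b by (simp add: r_def)
      show "r \<le> d" "r \<le> 1" by (simp_all add: r_def)
      have "r \<le> \<eta> / (10 * \<bar>b\<bar>)" by (simp add: r_def)
      then show "r * (5 * \<bar>b\<bar>) \<le> \<eta> / 2" using b by (simp add: field_simps)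
    qed
    \<comment> \<open>One bound for both inequalities: the coefficients are \<open>1, 1\<close> in
      the reduced equation and \<open>3, 5\<close> in its derivative.\<close>
    have "\<bar>k1 * (n2 j - n2 j0) * q\<^sup>2 + k2 * b * q ^ 4\<bar> \<le> \<eta> * (\<bar>n1 j\<bar> + q ^ 2)"
      if "\<bar>j - j0\<bar> < r" "\<bar>q\<bar> < r" "0 \<le> k1" "k1 \<le> 3" "0 \<le> k2" "k2 \<le> 5" for j q k1 k2 :: real
    proof -
      have "\<bar>q\<bar> * \<bar>q\<bar> \<le> r * 1"
        using that r by (intro mult_mono) auto
      then have "q\<^sup>2 \<le> r" by (simp add: power2_eq_square)
      have "\<bar>k1 * (n2 j - n2 j0)\<bar> \<le> 3 * (\<eta> / 6)"
        using d(2)[of j] that r(2) unfolding abs_mult by (intro mult_mono) auto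
      then have 1: "\<bar>k1 * (n2 j - n2 j0) * q\<^sup>2\<bar> \<le> \<eta> / 2 * q\<^sup>2"
        unfolding abs_mult[of _ "q\<^sup>2"] by (intro mult_mono) auto
      have "\<bar>k2 * b * q\<^sup>2\<bar> \<le> 5 * \<bar>b\<bar> * r"
        using that \<open>q\<^sup>2 \<le> r\<close> r(1) unfolding abs_mult by (intro mult_mono) auto
      also have "\<dots> \<le> \<eta> / 2" using r(4) by (simp add: mult_ac)
      finally have "\<bar>k2 * b * q\<^sup>2\<bar> * q\<^sup>2 \<le> \<eta> / 2 * q\<^sup>2"
        by (intro mult_right_mono) auto
      then have 2: "\<bar>k2 * b * q ^ 4\<bar> \<le> \<eta> / 2 * q\<^sup>2"
        by (simp add: abs_mult power2_eq_square power4_eq_xxxx mult_ac)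
      have "\<eta> * \<bar>n1 j\<bar> \<ge> 0" using \<eta> by simp
      then show ?thesis
        using 1 2 unfolding distrib_left by linarith
    qed
    note * = this
    show ?thesis
    proof (intro exI[of _ r] conjI allI impI r)
      fix j q assume "\<bar>j - j0\<bar> < r" "\<bar>q\<bar> < r"
      from *[OF this, of 1 1] *[OF this, of 3 5]
      show "\<bar>n2 j * q\<^sup>2 + b * q ^ 4 - n2 j0 * q ^ 2\<bar> \<le> \<eta> * (\<bar>n1 j\<bar> + q ^ 2)"
        "\<bar>3 * n2 j * q\<^sup>2 + 5 * b * q ^ 4 - (real 2 + 1) * n2 j0 * q ^ 2\<bar> \<le> \<eta> * (\<bar>n1 j\<bar> + q ^ 2)"
        by (auto simp: algebra_simps)
    qed
  qed
  with False show thesis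
    by (intro that[of "n2 j0" 2]) auto
next
  case True
  define c where "c = \<bar>deriv n1 j0\<bar> / 2"
  have c: "c > 0" using dz by (simp add: c_def)
  obtain d1 where d1: "d1 > 0" "\<And>y. \<bar>y - j0\<bar> < d1 \<Longrightarrow> \<bar>n1 y - n1 j0 - deriv n1 j0 * (y - j0)\<bar> \<le> c * \<bar>y - j0\<bar>"
    using DERIV_bounds[OF smooth_deriv(1)[OF n1] c] by metis
  obtain d2 where d2: "d2 > 0" "\<And>y. \<bar>y - j0\<bar> < d2 \<Longrightarrow> \<bar>n2 y - n2 j0 - deriv n2 j0 * (y - j0)\<bar> \<le> 1 * \<bar>y - j0\<bar>"
    using DERIV_bounds[OF smooth_deriv(1)[OF n2] zero_less_one] by metis
  \<comment> \<open>Near \<open>j0\<close>, \<open>|n1 j|\<close> is at least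
    \<open>c * |j - j0|\<close>, half of what its linear part gives, while \<open>|n2 j|\<close> is
    at most \<open>|deriv n2 j0| + 1\<close> times \<open>|j - j0|\<close>. The ratio of the two
    slopes bounds \<open>n2\<close> by \<open>n1\<close>.\<close>
  define K where "K = (\<bar>deriv n2 j0\<bar> + 1) / c"
  have K: "K > 0" using c by (simp add: K_def add_nonneg_pos)
  have n2_le: "\<bar>n2 j\<bar> \<le> K * \<bar>n1 j\<bar>" if "\<bar>j - j0\<bar> < min d1 d2" for j
  proof -
    have "\<bar>deriv n1 j0 * (j - j0)\<bar> \<le> \<bar>n1 j\<bar> + c * \<bar>j - j0\<bar>"
      using d1(2)[of j] that z by auto
    then have 1: "c * \<bar>j - j0\<bar> \<le> \<bar>n1 j\<bar>"
      by (simp add: abs_mult c_def)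
    have "\<bar>n2 j\<bar> \<le> (\<bar>deriv n2 j0\<bar> + 1) * \<bar>j - j0\<bar>"
      using d2(2)[of j] that True abs_mult[of "deriv n2 j0" "j - j0"] by (simp add: distrib_right)
    also have "\<dots> = K * (c * \<bar>j - j0\<bar>)"
      using c by (simp add: K_def)
    also have "\<dots> \<le> K * \<bar>n1 j\<bar>"
      using 1 K by (intro mult_left_mono) auto
    finally show ?thesis .
  qed
  have "\<exists>r>0. \<forall>j q. \<bar>j - j0\<bar> < r \<longrightarrow> \<bar>q\<bar> < r \<longrightarrow>
       \<bar>n2 j * q\<^sup>2 + b * q ^ 4 - b * q ^ 4\<bar> \<le> \<eta> * (\<bar>n1 j\<bar> + q ^ 4) \<and>
       \<bar>3 * n2 j * q\<^sup>2 + 5 * b * q ^ 4 - (real 4 + 1) * b * q ^ 4\<bar> \<le> \<eta> * (\<bar>n1 j\<bar> + q ^ 4)"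
    if \<eta>: "\<eta> > 0" for \<eta>
  proof -
    define r where "r = min (min d1 d2) (min 1 (\<eta> / (3 * K)))"
    have r: "r > 0" "r \<le> min d1 d2" "r \<le> 1" "3 * K * r \<le> \<eta>"
    proof -
      show "r > 0" using d1 d2 \<eta> K by (simp add: r_def)
      show "r \<le> min d1 d2" "r \<le> 1" unfolding r_def by linarith+
      have "r \<le> \<eta> / (3 * K)" by (simp add: r_def)
      then show "3 * K * r \<le> \<eta>" using K by (simp add: field_simps)
    qed
    show ?thesis
    proof (intro exI[of _ r] conjI allI impI r)
      fix j q assume jq: "\<bar>j - j0\<bar> < r" "\<bar>q\<bar> < r"
      have "\<bar>q\<bar> * \<bar>q\<bar> \<le> r * 1"
        using jq r by (intro mult_mono) auto
      then have "q\<^sup>2 \<le> r" by (simp add: power2_eq_square)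
      then have "3 * \<bar>n2 j\<bar> * q\<^sup>2 \<le> 3 * (K * \<bar>n1 j\<bar>) * r"
        using n2_le[of j] jq r K by (intro mult_mono) auto
      also have "\<dots> = (3 * K * r) * \<bar>n1 j\<bar>" by simp
      also have "\<dots> \<le> \<eta> * \<bar>n1 j\<bar>"
        using r by (intro mult_right_mono) auto
      also have "\<dots> \<le> \<eta> * (\<bar>n1 j\<bar> + q ^ 4)"
        using \<eta> by simp
      finally have *: "3 * \<bar>n2 j * q\<^sup>2\<bar> \<le> \<eta> * (\<bar>n1 j\<bar> + q ^ 4)"
        by (simp add: abs_mult)
      then show "\<bar>n2 j * q\<^sup>2 + b * q ^ 4 - b * q ^ 4\<bar> \<le> \<eta> * (\<bar>n1 j\<bar> + q ^ 4)"
        by simp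
      show "\<bar>3 * n2 j * q\<^sup>2 + 5 * b * q ^ 4 - (real 4 + 1) * b * q ^ 4\<bar> \<le> \<eta> * (\<bar>n1 j\<bar> + q ^ 4)"
        using * by (simp add: abs_mult)
    qed
  qed
  with True b show thesis
    by (intro that[of b 4]) auto
qed

text \<open>On the curve where the derivative in \<open>p\<close> vanishes, \<open>|a| * |p|\<close>
  is at most \<open>C * (|q| + |p|) ^ 6\<close>, which forces \<open>|p| \<le> |q|\<close>. All
  remainders thereby become powers of \<open>|q|\<close> alone, of higher order than the leading
  term.\<close>

lemma near_critical:
  assumes m: "m = 2 \<or> m = (4::nat)" and \<eta>: "\<eta> > 0"
    and lead: "\<And>\<eta>. \<eta> > 0 \<Longrightarrow> \<exists>r>0. \<forall>j q. \<bar>j - j0\<bar> < r \<longrightarrow> \<bar>q\<bar> < r \<longrightarrow>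
       \<bar>n2 j * q\<^sup>2 + b * q ^ 4 - \<kappa> * q ^ m\<bar> \<le> \<eta> * (\<bar>n1 j\<bar> + q ^ m) \<and>
       \<bar>3 * n2 j * q\<^sup>2 + 5 * b * q ^ 4 - (real m + 1) * \<kappa> * q ^ m\<bar> \<le> \<eta> * (\<bar>n1 j\<bar> + q ^ m)"
  obtains r where "r > 0"
    "\<And>j q p. \<bar>j - j0\<bar> < r \<Longrightarrow> \<bar>q\<bar> + \<bar>p\<bar> < r \<Longrightarrow> dp (g j) q p = 0 \<Longrightarrow>
       q ^ m \<le> 1 \<and> (q = 0 \<longrightarrow> p = 0) \<and>
       \<bar>dq (g j) q p - q * (n1 j + \<kappa> * q ^ m)\<bar> \<le> \<bar>q\<bar> * (\<eta> * (\<bar>n1 j\<bar> + q ^ m)) \<and>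
       \<bar>dq (dq (g j)) q p - (n1 j + (real m + 1) * \<kappa> * q ^ m)\<bar> \<le> \<eta> * (\<bar>n1 j\<bar> + q ^ m) \<and>
       \<bar>dq (dp (g j)) q p\<bar> \<le> \<eta> * q ^ m \<and> \<bar>dp (dp (g j)) q p - a\<bar> \<le> \<eta>"
proof -
  obtain C where C: "C > 0" and est:
    "\<And>j q p. \<bar>j - j0\<bar> \<le> \<rho> / 2 \<Longrightarrow> \<bar>q\<bar> + \<bar>p\<bar> \<le> 1 \<Longrightarrow>
      \<bar>dq (g j) q p - q * (n1 j + n2 j * q\<^sup>2 + b * q ^ 4)\<bar> \<le> C * (\<bar>q\<bar> + \<bar>p\<bar>) ^ 6 \<and>
      \<bar>dp (g j) q p - a * p\<bar> \<le> C * (\<bar>q\<bar> + \<bar>p\<bar>) ^ 6 \<and>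
      \<bar>dq (dq (g j)) q p - (n1 j + 3 * n2 j * q\<^sup>2 + 5 * b * q ^ 4)\<bar> \<le> C * (\<bar>q\<bar> + \<bar>p\<bar>) ^ 5 \<and>
      \<bar>dq (dp (g j)) q p\<bar> \<le> C * (\<bar>q\<bar> + \<bar>p\<bar>) ^ 5 \<and>
      \<bar>dp (dp (g j)) q p - a\<bar> \<le> C * (\<bar>q\<bar> + \<bar>p\<bar>) ^ 5"
    by (rule estimates) blast
  obtain r1 where r1: "r1 > 0" "\<And>j q. \<bar>j - j0\<bar> < r1 \<Longrightarrow> \<bar>q\<bar> < r1 \<Longrightarrow>
       \<bar>n2 j * q\<^sup>2 + b * q ^ 4 - \<kappa> * q ^ m\<bar> \<le> \<eta> / 2 * (\<bar>n1 j\<bar> + q ^ m) \<and>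
       \<bar>3 * n2 j * q\<^sup>2 + 5 * b * q ^ 4 - (real m + 1) * \<kappa> * q ^ m\<bar> \<le> \<eta> / 2 * (\<bar>n1 j\<bar> + q ^ m)"
    using lead[OF half_gt_zero[OF \<eta>]] by blast
  \<comment> \<open>The bound by \<open>|a| / (2 * C)\<close> yields \<open>|p| \<le> |q|\<close>.
    The one by \<open>\<eta> / (128 * C)\<close> absorbs the factor \<open>64 = 2 ^ 6\<close> from
    \<open>|q| + |p| \<le> 2 * |q|\<close> and leaves half of \<open>\<eta>\<close> for the Taylor
    remainder; the other half is spent on \<open>lead\<close>.\<close>
  define r where "r = min (min (\<rho> / 2) r1) (min 1 (min (\<bar>a\<bar> / (2 * C)) (\<eta> / (128 * C))))"
  have r: "r > 0" "r \<le> \<rho> / 2" "r \<le> r1" "r \<le> 1" "r \<le> \<bar>a\<bar> / (2 * C)" "r \<le> \<eta> / (128 * C)"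
    using \<rho> r1 C a \<eta> by (simp_all add: r_def)
  have r': "C * r \<le> \<bar>a\<bar> / 2" "64 * C * r \<le> \<eta> / 2"
    using r(5,6) C by (simp_all add: field_simps)
  show thesis
  proof (rule that[OF r(1)])
    fix j q p assume j: "\<bar>j - j0\<bar> < r" and N: "\<bar>q\<bar> + \<bar>p\<bar> < r" and crit: "dp (g j) q p = 0"
    let ?N = "\<bar>q\<bar> + \<bar>p\<bar>"
    have j2: "\<bar>j - j0\<bar> \<le> \<rho> / 2" and N1: "?N \<le> 1" using j N r by auto
    have "?N ^ 6 \<le> ?N ^ 2"
      using N1 by (intro power_decreasing) auto
    also have "\<dots> \<le> r * ?N"
      using N by (simp add: power2_eq_square mult_right_mono)
    finally have "C * ?N ^ 6 \<le> C * r * ?N"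
      using C by (simp add: mult.assoc)
    also have "\<dots> \<le> \<bar>a\<bar> / 2 * ?N"
      using r' by (intro mult_right_mono) auto
    finally have "\<bar>a\<bar> * \<bar>p\<bar> \<le> \<bar>a\<bar> * (?N / 2)"
      using est[OF j2 N1] crit by (simp add: abs_mult)
    then have "\<bar>p\<bar> \<le> ?N / 2" using a by simp
    then have pq: "\<bar>p\<bar> \<le> \<bar>q\<bar>" by (simp add: field_simps)
    then have N2: "?N \<le> 2 * \<bar>q\<bar>" by simp
    have q1: "\<bar>q\<bar> \<le> 1" "\<bar>q\<bar> < r" using N N1 by auto
    have qm: "q ^ 4 \<le> q ^ m" "q ^ m \<le> 1" "0 \<le> q ^ m"
    proof -
      have ev: "q ^ m = \<bar>q\<bar> ^ m" using m by (auto simp: power_even_abs)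
      show "0 \<le> q ^ m" "q ^ m \<le> 1" unfolding ev using q1 by (auto intro: power_le_one)
      have "\<bar>q\<bar> ^ 4 \<le> \<bar>q\<bar> ^ m" using q1 m by (intro power_decreasing) auto
      then show "q ^ 4 \<le> q ^ m" unfolding ev by (simp add: power_even_abs)
    qed
    have q4: "\<bar>q\<bar> ^ 4 = q ^ 4" by (simp add: power_even_abs)
    have q5: "\<bar>q\<bar> ^ 5 = \<bar>q\<bar> * q ^ 4" using power_Suc[of "\<bar>q\<bar>" 4] q4 by simp
    have q6: "\<bar>q\<bar> ^ 6 = \<bar>q\<bar> * (\<bar>q\<bar> * q ^ 4)" using power_Suc[of "\<bar>q\<bar>" 5] q5 by simp
    have five: "C * ?N ^ 5 \<le> \<eta> / 2 * q ^ m"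
    proof -
      have "C * ?N ^ 5 \<le> C * (2 * \<bar>q\<bar>) ^ 5"
        using N2 C by (intro mult_left_mono power_mono) auto
      also have "\<dots> = 32 * C * \<bar>q\<bar> * q ^ 4"
        unfolding power_mult_distrib q5 by simp
      also have "\<dots> \<le> \<eta> / 2 * q ^ m"
      proof (rule mult_mono)
        have "32 * C * \<bar>q\<bar> \<le> 64 * C * r"
          using q1 C by (intro mult_mono) auto
        then show "32 * C * \<bar>q\<bar> \<le> \<eta> / 2" using r' by linarith
      qed (use qm \<eta> in auto)
      finally show ?thesis .
    qed
    have six: "C * ?N ^ 6 \<le> \<bar>q\<bar> * (\<eta> / 2 * q ^ m)"
    proof -
      have "C * ?N ^ 6 \<le> C * (2 * \<bar>q\<bar>) ^ 6"
        using N2 C by (intro mult_left_mono power_mono) auto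
      also have "\<dots> = \<bar>q\<bar> * (64 * C * \<bar>q\<bar> * q ^ 4)"
        unfolding power_mult_distrib q6 by simp
      also have "\<dots> \<le> \<bar>q\<bar> * (\<eta> / 2 * q ^ m)"
      proof (intro mult_left_mono mult_mono)
        have "64 * C * \<bar>q\<bar> \<le> 64 * C * r"
          using q1 C by (intro mult_mono) auto
        then show "64 * C * \<bar>q\<bar> \<le> \<eta> / 2" using r' by linarith
      qed (use qm \<eta> in auto)
      finally show ?thesis .
    qed
    have le_q: "\<eta> / 2 * q ^ m \<le> \<eta> * q ^ m" "\<eta> * q ^ m \<le> \<eta>"
      using qm \<eta> by (auto simp: mult_left_le)
    note L = r1(2)[of j q]
    have L1: "\<bar>n2 j * q\<^sup>2 + b * q ^ 4 - \<kappa> * q ^ m\<bar> \<le> \<eta> / 2 * (\<bar>n1 j\<bar> + q ^ m)"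
      and L2: "\<bar>3 * n2 j * q\<^sup>2 + 5 * b * q ^ 4 - (real m + 1) * \<kappa> * q ^ m\<bar> \<le> \<eta> / 2 * (\<bar>n1 j\<bar> + q ^ m)"
      using L j q1 r by auto
    have half: "\<eta> / 2 * q ^ m + \<eta> / 2 * (\<bar>n1 j\<bar> + q ^ m) \<le> \<eta> * (\<bar>n1 j\<bar> + q ^ m)"
      using \<eta> by (simp add: field_simps)
    have "\<bar>dq (g j) q p - q * (n1 j + \<kappa> * q ^ m)\<bar> \<le> \<bar>q\<bar> * (\<eta> * (\<bar>n1 j\<bar> + q ^ m))"
    proof -
      have "dq (g j) q p - q * (n1 j + \<kappa> * q ^ m) = (dq (g j) q p - q * (n1 j + n2 j * q\<^sup>2 + b * q ^ 4))
          + q * (n2 j * q\<^sup>2 + b * q ^ 4 - \<kappa> * q ^ m)"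
        by (simp add: algebra_simps)
      also have "\<bar>\<dots>\<bar> \<le> C * ?N ^ 6 + \<bar>q\<bar> * \<bar>n2 j * q\<^sup>2 + b * q ^ 4 - \<kappa> * q ^ m\<bar>"
        using est[OF j2 N1]
        by (intro order_trans[OF abs_triangle_ineq] add_mono) (simp_all add: abs_mult)
      also have "\<dots> \<le> \<bar>q\<bar> * (\<eta> / 2 * q ^ m) + \<bar>q\<bar> * (\<eta> / 2 * (\<bar>n1 j\<bar> + q ^ m))"
        using six L1 by (intro add_mono mult_left_mono) auto
      also have "\<dots> = \<bar>q\<bar> * (\<eta> / 2 * q ^ m + \<eta> / 2 * (\<bar>n1 j\<bar> + q ^ m))"
        by (simp add: distrib_left)
      also have "\<dots> \<le> \<bar>q\<bar> * (\<eta> * (\<bar>n1 j\<bar> + q ^ m))"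
        using half by (intro mult_left_mono) auto
      finally show ?thesis .
    qed
    moreover have "\<bar>dq (dq (g j)) q p - (n1 j + (real m + 1) * \<kappa> * q ^ m)\<bar> \<le> \<eta> * (\<bar>n1 j\<bar> + q ^ m)"
    proof -
      have "dq (dq (g j)) q p - (n1 j + (real m + 1) * \<kappa> * q ^ m) =
          (dq (dq (g j)) q p - (n1 j + 3 * n2 j * q\<^sup>2 + 5 * b * q ^ 4))
          + (3 * n2 j * q\<^sup>2 + 5 * b * q ^ 4 - (real m + 1) * \<kappa> * q ^ m)"
        by simp
      also have "\<bar>\<dots>\<bar> \<le> C * ?N ^ 5 + \<eta> / 2 * (\<bar>n1 j\<bar> + q ^ m)"
        using est[OF j2 N1] L2 by (intro order_trans[OF abs_triangle_ineq] add_mono) simp_all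
      also have "\<dots> \<le> \<eta> * (\<bar>n1 j\<bar> + q ^ m)"
        using five half by (rule order_trans[OF add_right_mono])
      finally show ?thesis .
    qed
    moreover have "\<bar>dq (dp (g j)) q p\<bar> \<le> \<eta> * q ^ m" "\<bar>dp (dp (g j)) q p - a\<bar> \<le> \<eta>"
      using est[OF j2 N1] five le_q by (meson order_trans)+
    ultimately show "q ^ m \<le> 1 \<and> (q = 0 \<longrightarrow> p = 0) \<and>
       \<bar>dq (g j) q p - q * (n1 j + \<kappa> * q ^ m)\<bar> \<le> \<bar>q\<bar> * (\<eta> * (\<bar>n1 j\<bar> + q ^ m)) \<and>
       \<bar>dq (dq (g j)) q p - (n1 j + (real m + 1) * \<kappa> * q ^ m)\<bar> \<le> \<eta> * (\<bar>n1 j\<bar> + q ^ m) \<and>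
       \<bar>dq (dp (g j)) q p\<bar> \<le> \<eta> * q ^ m \<and> \<bar>dp (dp (g j)) q p - a\<bar> \<le> \<eta>"
      using qm pq by auto
  qed
qed

end

text \<open>If \<open>A\<close> outweighs both the second term and the error, it dictates the sign
  of \<open>X\<close>. This is needed in three regimes: where the power of \<open>q\<close>
  dominates, where \<open>n1\<close> dominates, and for \<open>n1\<close> itself next to a simple
  zero.\<close>

lemma dominant_term_sign:
  fixes q A B E X :: real
  assumes "q > 0" "\<bar>X - q * (A + B)\<bar> \<le> q * E" "\<bar>B\<bar> + E < \<bar>A\<bar>"
  shows "A * X > 0"
proof -
  have "\<bar>X - q * A\<bar> < q * \<bar>A\<bar>"
  proof -
    have "\<bar>X - q * A\<bar> \<le> \<bar>X - q * (A + B)\<bar> + q * \<bar>B\<bar>"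
      using abs_triangle_ineq[of "X - q * (A + B)" "q * B"] assms(1) by (simp add: abs_mult algebra_simps)
    also have "\<dots> \<le> q * (\<bar>B\<bar> + E)"
      using assms(2) by (simp add: algebra_simps)
    also have "\<dots> < q * \<bar>A\<bar>"
      using assms by (intro mult_strict_left_mono)
    finally show ?thesis .
  qed
  note * = this
  show ?thesis
  proof (cases "A > 0")
    case True
    then have "q * A > 0" using assms(1) by simp
    moreover have "\<bar>X - q * A\<bar> < q * A" using * True by simp
    ultimately have "X > 0" by linarith
    with True show ?thesis by simp
  next
    case False
    with * have "A < 0" by (cases "A = 0") auto
    then have "q * A < 0" using assms(1) by (simp add: mult_pos_neg)
    moreover have "\<bar>X - q * A\<bar> < - (q * A)" using * \<open>A < 0\<close> by simp
    ultimately have "X < 0" by linarith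
    with \<open>A < 0\<close> show ?thesis by (rule mult_neg_neg)
  qed
qed

section \<open>Critical points branching off at a simple zero\<close>

context normal_form_family
begin

text \<open>With \<open>p\<close> eliminated, one equation \<open>h x = 0\<close> in one variable
  remains. When \<open>\<kappa>\<close> and \<open>n1 j\<close> have opposite signs,
  \<open>h\<close> changes sign between a tiny positive point and a fixed one; positivity of the
  tiny point excludes the trivial solution.\<close>

lemma critical_exists:
  assumes z: "n1 j0 = 0" and \<kappa>: "\<kappa> \<noteq> 0" and m: "m > 0" and r: "r > 0"
    and \<eta>: "\<eta> > 0" "\<eta> \<le> 1 / 4" "\<eta> \<le> \<bar>\<kappa>\<bar> / 4"
    and r0: "r0 > 0"
    and near: "\<And>j q p. \<bar>j - j0\<bar> < r0 \<Longrightarrow> \<bar>q\<bar> + \<bar>p\<bar> < r0 \<Longrightarrow> dp (g j) q p = 0 \<Longrightarrow>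
       \<bar>dq (g j) q p - q * (n1 j + \<kappa> * q ^ m)\<bar> \<le> \<bar>q\<bar> * (\<eta> * (\<bar>n1 j\<bar> + q ^ m))"
  obtains \<delta> where "\<delta> > 0"
    "\<And>j. \<bar>j - j0\<bar> < \<delta> \<Longrightarrow> \<kappa> * n1 j < 0 \<Longrightarrow> \<exists>q p. q \<noteq> 0 \<and> \<bar>q\<bar> + \<bar>p\<bar> < r \<and> singular_point (g j) q p"
proof -
  have j0: "\<bar>j0 - j0\<bar> \<le> \<rho> / 2" using \<rho> by simp
  have dA: "dq (\<lambda>q p. q) 0 0 = 1" "dp (\<lambda>q p. q) 0 0 = 0"
    by (auto intro!: dq_eqI dp_eqI derivative_eq_intros)
  \<comment> \<open>Taking \<open>q\<close> itself as first component forces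
    \<open>P j x y = x\<close>, so that \<open>Q j x 0\<close> solves
    \<open>dp (g j) x p = 0\<close> for \<open>p\<close>.\<close>
  obtain d P Q where d: "d > 0"
    "\<And>j x y. \<bar>j - j0\<bar> < d \<Longrightarrow> \<bar>x\<bar> < d \<Longrightarrow> \<bar>y\<bar> < d \<Longrightarrow>
       \<bar>P j x y\<bar> + \<bar>Q j x y\<bar> < min r r0 \<and> P j x y = x \<and> dp (g j) (P j x y) (Q j x y) = y"
    "\<And>j. \<bar>j - j0\<bar> < d \<Longrightarrow> continuous_on {x. \<bar>x\<bar> < d} (\<lambda>x. Q j x 0)"
  proof (rule local_inverse_family[where A = "\<lambda>j q p. q" and B = "\<lambda>j. dp (g j)" and ?j0.0 = j0 and r = "min r r0"])
    show "smooth_family (\<lambda>j q p. q)" "smooth_family (\<lambda>j. dp (g j))"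
      by (rule smooth_family_vars smooth_family_dp g_smooth)+
    show "dp (g j0) 0 0 = 0" by (rule at_origin[OF j0])
    show "dq (\<lambda>q p. q) 0 0 * dp (dp (g j0)) 0 0 - dp (\<lambda>q p. q) 0 0 * dq (dp (g j0)) 0 0 \<noteq> 0"
      by (simp add: dA at_origin[OF j0] a)
    show "min r r0 > 0" using r r0 by simp
  qed (rule refl, rule that)
  have Q: "\<bar>x\<bar> + \<bar>Q j x 0\<bar> < r" "\<bar>x\<bar> + \<bar>Q j x 0\<bar> < r0" "dp (g j) x (Q j x 0) = 0"
    if "\<bar>j - j0\<bar> < d" "\<bar>x\<bar> < d" for j x
    using d(2)[OF that, of 0] d(1) by auto
  \<comment> \<open>\<open>e\<close> is independent of \<open>j\<close>: for \<open>j\<close> close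
    to \<open>j0\<close> the term \<open>n1 j\<close> is small against
    \<open>\<kappa> * e ^ m\<close>, and \<open>h e\<close> has the sign of
    \<open>\<kappa>\<close>.\<close>
  define e where "e = min (d / 2) (1 / 2)"
  have e: "e > 0" "e < d" "e \<le> 1" using d(1) by (auto simp: e_def)
  define M where "M = e ^ m"
  have M: "M > 0" using e by (simp add: M_def)
  obtain \<delta>1 where \<delta>1: "\<delta>1 > 0" "\<And>y. \<bar>y - j0\<bar> < \<delta>1 \<Longrightarrow> \<bar>n1 y - n1 j0\<bar> < \<bar>\<kappa>\<bar> * M / 4"
    using isCont_real_near[OF smooth_isCont[OF n1], of "\<bar>\<kappa>\<bar> * M / 4" j0] \<kappa> M by auto
  show thesis
  proof
    show "min \<delta>1 (min d r0) > 0" using \<delta>1 d r0 by simp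
    fix j assume j: "\<bar>j - j0\<bar> < min \<delta>1 (min d r0)" and sgn: "\<kappa> * n1 j < 0"
    have jd: "\<bar>j - j0\<bar> < d" "\<bar>j - j0\<bar> < r0" using j by auto
    have n1b: "\<bar>n1 j\<bar> < \<bar>\<kappa>\<bar> * M / 4" using \<delta>1(2)[of j] j z by simp
    have n1_pos: "\<bar>n1 j\<bar> > 0" using sgn by auto
    define h where "h x = dq (g j) x (Q j x 0)" for x
    have h: "\<bar>h x - x * (n1 j + \<kappa> * x ^ m)\<bar> \<le> \<bar>x\<bar> * (\<eta> * (\<bar>n1 j\<bar> + x ^ m))" if "\<bar>x\<bar> < d" for x
      unfolding h_def using near[OF jd(2) Q(2,3)[OF jd(1) that]] .
    have "(\<kappa> * M) * h e > 0"
    proof (rule dominant_term_sign[OF e(1)])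
      show "\<bar>h e - e * (\<kappa> * M + n1 j)\<bar> \<le> e * (\<eta> * (\<bar>n1 j\<bar> + M))"
        using h[of e] e by (simp add: M_def add.commute)
      have "\<eta> * \<bar>n1 j\<bar> \<le> \<bar>n1 j\<bar> / 4" "\<eta> * M \<le> \<bar>\<kappa>\<bar> / 4 * M"
        using mult_right_mono[OF \<eta>(2), of "\<bar>n1 j\<bar>"] mult_right_mono[OF \<eta>(3), of M] M by auto
      moreover have "\<bar>\<kappa> * M\<bar> = \<bar>\<kappa>\<bar> * M" "\<bar>\<kappa>\<bar> * M > 0" using M \<kappa> by (auto simp: abs_mult)
      ultimately show "\<bar>n1 j\<bar> + \<eta> * (\<bar>n1 j\<bar> + M) < \<bar>\<kappa> * M\<bar>"
        using n1b by (simp add: distrib_left)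
    qed
    then have he: "\<kappa> * h e > 0"
      using M by (simp add: zero_less_mult_iff mult_less_0_iff)
    \<comment> \<open>\<open>x1\<close> depends on \<open>j\<close> and is so small that
      \<open>n1 j\<close> dominates; as \<open>x1 \<le> 1\<close>, it is enough to bound
      \<open>x1\<close> instead of \<open>x1 ^ m\<close>. So \<open>h x1\<close> has the sign of
      \<open>n1 j\<close>, opposite to that of \<open>\<kappa>\<close>.\<close>
    define x1 where "x1 = min e (\<bar>n1 j\<bar> / (4 * (\<bar>\<kappa>\<bar> + 1)))"
    have x1: "x1 > 0" "x1 \<le> e" using e n1_pos by (auto simp: x1_def)
    have x1m: "x1 ^ m \<le> \<bar>n1 j\<bar> / (4 * (\<bar>\<kappa>\<bar> + 1))"
    proof -
      have "x1 ^ m \<le> x1 ^ 1" using x1 e m by (intro power_decreasing) auto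
      then show ?thesis by (simp add: x1_def)
    qed
    have "n1 j * h x1 > 0"
    proof (rule dominant_term_sign[OF x1(1)])
      show "\<bar>h x1 - x1 * (n1 j + \<kappa> * x1 ^ m)\<bar> \<le> x1 * (\<eta> * (\<bar>n1 j\<bar> + x1 ^ m))"
        using h[of x1] e x1 by simp
      have le: "4 * (\<bar>\<kappa>\<bar> * x1 ^ m) + 4 * x1 ^ m \<le> \<bar>n1 j\<bar>"
        using x1m by (simp add: field_simps)
      have "x1 ^ m > 0" using x1 by simp
      then have "\<eta> * (\<bar>n1 j\<bar> + x1 ^ m) \<le> 1 / 4 * (\<bar>n1 j\<bar> + x1 ^ m)"
        using \<eta>(2) \<open>x1 ^ m > 0\<close> by (intro mult_right_mono) auto
      moreover have "\<bar>\<kappa> * x1 ^ m\<bar> = \<bar>\<kappa>\<bar> * x1 ^ m" using x1 by (simp add: abs_mult)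
      moreover have "t + y < u" if "y \<le> 1 / 4 * (u + w)" "4 * t + 4 * w \<le> u" "0 < w" "0 < u" for t y u w :: real
        using that by (simp add: field_simps)
      ultimately show "\<bar>\<kappa> * x1 ^ m\<bar> + \<eta> * (\<bar>n1 j\<bar> + x1 ^ m) < \<bar>n1 j\<bar>"
        using le n1_pos \<open>x1 ^ m > 0\<close> by metis
    qed
    then have hx: "\<kappa> * h x1 < 0"
      using sgn by (auto simp: zero_less_mult_iff mult_less_0_iff)
    have sub: "{x1..e} \<subseteq> {x. \<bar>x\<bar> < d}" using x1 e by auto
    have "continuous_on {x1..e} (\<lambda>x. (\<lambda>(j, q, p). dq (g j) q p) (j, x, Q j x 0))"
      using continuous_on_subset[OF d(3)[OF jd(1)] sub]
      by (intro continuous_on_compose2[OF smooth_family_continuous[OF smooth_family_dq[OF g_smooth], of UNIV]]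
          continuous_intros) auto
    then have "continuous_on {x1..e} (\<lambda>x. \<kappa> * h x)"
      unfolding h_def by (intro continuous_intros) auto
    then obtain x where x: "x1 \<le> x" "x \<le> e" "\<kappa> * h x = 0"
      using IVT'[of "\<lambda>x. \<kappa> * h x" x1 0 e] hx he x1 by auto
    then have "singular_point (g j) x (Q j x 0)" "\<bar>x\<bar> + \<bar>Q j x 0\<bar> < r"
      using Q[OF jd(1), of x] \<kappa> e x1 by (auto simp: singular_point_def h_def)
    then show "\<exists>q p. q \<noteq> 0 \<and> \<bar>q\<bar> + \<bar>p\<bar> < r \<and> singular_point (g j) q p"
      using x x1 by (intro exI[of _ x] exI[of _ "Q j x 0"]) auto
  qed
qed

lemma critical_trivial:
  assumes "\<kappa> * n1 j > 0" "m = 2 \<or> m = (4::nat)" "\<eta> < 1" "\<eta> < \<bar>\<kappa>\<bar>"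
    and "\<bar>0 - q * (n1 j + \<kappa> * q ^ m)\<bar> \<le> \<bar>q\<bar> * (\<eta> * (\<bar>n1 j\<bar> + q ^ m))"
  shows "q = 0"
proof (rule ccontr)
  assume "q \<noteq> 0"
  have ev: "even m" using assms(2) by auto
  have Q: "q ^ m > 0" using \<open>q \<noteq> 0\<close> ev by (simp add: zero_less_power_eq)
  have "\<bar>q\<bar> * \<bar>n1 j + \<kappa> * q ^ m\<bar> \<le> \<bar>q\<bar> * (\<eta> * (\<bar>n1 j\<bar> + q ^ m))"
    using assms(5) by (simp add: abs_mult)
  then have "\<bar>n1 j + \<kappa> * q ^ m\<bar> \<le> \<eta> * \<bar>n1 j\<bar> + \<eta> * q ^ m"
    unfolding distrib_left[of \<eta>, symmetric] using \<open>q \<noteq> 0\<close> by simp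
  moreover have "\<bar>n1 j + \<kappa> * q ^ m\<bar> = \<bar>n1 j\<bar> + \<bar>\<kappa>\<bar> * q ^ m"
  proof (cases "\<kappa> > 0")
    case True
    then have "n1 j > 0" "\<kappa> * q ^ m > 0" using assms(1) Q by (auto simp: zero_less_mult_iff)
    with True show ?thesis by simp
  next
    case False
    then have "n1 j < 0" "\<kappa> < 0" "\<kappa> * q ^ m < 0"
      using assms(1) Q by (auto simp: zero_less_mult_iff mult_less_0_iff)
    then show ?thesis by simp
  qed
  moreover have "\<eta> * \<bar>n1 j\<bar> < 1 * \<bar>n1 j\<bar>" using assms(1,3) by (intro mult_strict_right_mono) auto
  moreover have "\<eta> * q ^ m < \<bar>\<kappa>\<bar> * q ^ m" using assms(4) Q by (intro mult_strict_right_mono) auto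
  ultimately show False by linarith
qed

text \<open>Off the origin a critical point has \<open>n1 j\<close> close to
  \<open>- \<kappa> * q ^ m\<close>, so the second derivative in \<open>q\<close> is close to
  \<open>m * \<kappa> * q ^ m\<close> and the Hessian determinant to
  \<open>m * \<kappa> * a * q ^ m\<close>, the mixed derivative being negligible.\<close>

lemma critical_type:
  assumes "q \<noteq> 0" "m = 2 \<or> m = (4::nat)" "\<kappa> \<noteq> 0"
    and \<eta>: "0 < \<eta>" "\<eta> \<le> 1 / 4" "\<eta> * (4 * \<bar>\<kappa>\<bar> + 4) \<le> \<bar>\<kappa>\<bar>" "\<eta> \<le> \<bar>a\<bar> / 2" "\<eta> < \<bar>\<kappa> * a\<bar> / 2"
    and "q ^ m \<le> 1"
    and crit: "\<bar>0 - q * (n1 j + \<kappa> * q ^ m)\<bar> \<le> \<bar>q\<bar> * (\<eta> * (\<bar>n1 j\<bar> + q ^ m))"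
    and qq: "\<bar>dq (dq (g j)) q p - (n1 j + (real m + 1) * \<kappa> * q ^ m)\<bar> \<le> \<eta> * (\<bar>n1 j\<bar> + q ^ m)"
    and qp: "\<bar>dq (dp (g j)) q p\<bar> \<le> \<eta> * q ^ m" and pp: "\<bar>dp (dp (g j)) q p - a\<bar> \<le> \<eta>"
  shows "\<kappa> * a * hess_det (g j) q p > 0"
proof -
  define Q where "Q = q ^ m"
  define X Y Z where "X = dq (dq (g j)) q p" and "Y = dq (dp (g j)) q p" and "Z = dp (dp (g j)) q p"
  have ev: "even m" using assms(2) by auto
  have Q: "Q > 0" "Q \<le> 1"
    using \<open>q \<noteq> 0\<close> ev assms(9) by (simp_all add: Q_def zero_less_power_eq)
  have "\<bar>q\<bar> * \<bar>n1 j + \<kappa> * Q\<bar> \<le> \<bar>q\<bar> * (\<eta> * (\<bar>n1 j\<bar> + Q))"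
    using crit by (simp add: abs_mult Q_def)
  then have 1: "\<bar>n1 j + \<kappa> * Q\<bar> \<le> \<eta> * \<bar>n1 j\<bar> + \<eta> * Q"
    unfolding distrib_left[of \<eta>, symmetric] using \<open>q \<noteq> 0\<close> by simp
  have k: "\<bar>\<kappa> * Q\<bar> = \<bar>\<kappa>\<bar> * Q" using Q by (simp add: abs_mult)
  have "\<eta> * \<bar>n1 j\<bar> \<le> 1 / 4 * \<bar>n1 j\<bar>" "\<eta> * Q \<le> 1 / 4 * Q"
    using \<eta>(2) Q by (intro mult_right_mono; simp)+
  then have n1_le: "\<bar>n1 j\<bar> \<le> 2 * \<bar>\<kappa>\<bar> * Q + Q"
    using 1 k by linarith
  \<comment> \<open>The error occurs twice, in the critical point equation and in the second
    derivative. Together they cost at most one of the \<open>m \<ge> 2\<close> multiples of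
    \<open>|\<kappa>| * Q\<close>, so at least one is left.\<close>
  have "2 * (\<eta> * \<bar>n1 j\<bar> + \<eta> * Q) \<le> 2 * (\<eta> * (2 * \<bar>\<kappa>\<bar> * Q + Q) + \<eta> * Q)"
    using n1_le \<eta>(1) by simp
  also have "\<dots> = \<eta> * (4 * \<bar>\<kappa>\<bar> + 4) * Q" by (simp add: algebra_simps)
  also have "\<dots> \<le> \<bar>\<kappa>\<bar> * Q" using \<eta>(3) Q by (intro mult_right_mono) auto
  finally have err: "2 * (\<eta> * \<bar>n1 j\<bar> + \<eta> * Q) \<le> \<bar>\<kappa>\<bar> * Q" .
  have "X - real m * \<kappa> * Q = (X - (n1 j + (real m + 1) * \<kappa> * Q)) + (n1 j + \<kappa> * Q)"
    by (simp add: algebra_simps)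
  then have X: "\<bar>X - real m * \<kappa> * Q\<bar> \<le> \<bar>\<kappa>\<bar> * Q"
    using qq 1 err unfolding X_def[symmetric] Q_def[symmetric] distrib_left by linarith
  have kX: "\<kappa> * X \<ge> \<kappa>\<^sup>2 * Q"
  proof -
    have "\<kappa> * X = real m * \<kappa>\<^sup>2 * Q + \<kappa> * (X - real m * \<kappa> * Q)"
      by (simp add: algebra_simps power2_eq_square)
    moreover have "\<bar>\<kappa> * (X - real m * \<kappa> * Q)\<bar> \<le> \<bar>\<kappa>\<bar> * (\<bar>\<kappa>\<bar> * Q)"
      unfolding abs_mult using X by (intro mult_left_mono) auto
    moreover have "\<bar>\<kappa>\<bar> * (\<bar>\<kappa>\<bar> * Q) = \<kappa>\<^sup>2 * Q" by (simp add: power2_eq_square flip: mult.assoc abs_mult)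
    moreover have "real m * \<kappa>\<^sup>2 * Q \<ge> 2 * \<kappa>\<^sup>2 * Q"
      using assms(2) Q by auto
    ultimately show ?thesis by linarith
  qed
  have aZ: "a * Z \<ge> a\<^sup>2 / 2"
  proof -
    have "a * Z = a\<^sup>2 + a * (Z - a)" by (simp add: algebra_simps power2_eq_square)
    moreover have "\<bar>a * (Z - a)\<bar> \<le> \<bar>a\<bar> * (\<bar>a\<bar> / 2)"
      unfolding abs_mult using pp \<eta>(4) by (intro mult_left_mono) (auto simp: Z_def)
    moreover have "\<bar>a\<bar> * (\<bar>a\<bar> / 2) = a\<^sup>2 / 2" by (simp add: power2_eq_square)
    ultimately show ?thesis by linarith
  qed
  have "(\<kappa> * X) * (a * Z) \<ge> (\<kappa>\<^sup>2 * Q) * (a\<^sup>2 / 2)"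
  proof (rule mult_mono[OF kX aZ])
    have "0 \<le> \<kappa>\<^sup>2 * Q" using Q by simp
    with kX show "0 \<le> \<kappa> * X" by linarith
  qed simp
  moreover have "\<kappa> * a * Y\<^sup>2 < (\<kappa>\<^sup>2 * Q) * (a\<^sup>2 / 2)"
  proof -
    have ka: "\<bar>\<kappa> * a\<bar> > 0" using assms(3) a by simp
    have "Y\<^sup>2 = \<bar>Y\<bar> * \<bar>Y\<bar>" by (simp add: power2_eq_square)
    also have "\<dots> \<le> (\<eta> * Q) * (\<eta> * Q)"
      using qp \<eta>(1) Q by (intro mult_mono) (auto simp: Y_def Q_def)
    also have "\<dots> \<le> \<eta> * Q"
    proof -
      have "\<eta> * Q \<le> 1 * 1" using \<eta> Q by (intro mult_mono) auto
      then show ?thesis using \<eta> Q by (simp add: mult_left_le)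
    qed
    also have "\<dots> < \<bar>\<kappa> * a\<bar> / 2 * Q" using \<eta>(5) Q by (intro mult_strict_right_mono) auto
    finally have "\<bar>\<kappa> * a\<bar> * Y\<^sup>2 < \<bar>\<kappa> * a\<bar> * (\<bar>\<kappa> * a\<bar> / 2 * Q)"
      using ka by (intro mult_strict_left_mono)
    also have "\<dots> = (\<kappa>\<^sup>2 * Q) * (a\<^sup>2 / 2)"
      by (simp add: abs_mult power2_eq_square mult_ac)
    finally show ?thesis
      using mult_right_mono[OF abs_ge_self[of "\<kappa> * a"], of "Y\<^sup>2"] by simp
  qed
  ultimately have "(\<kappa> * X) * (a * Z) - \<kappa> * a * Y\<^sup>2 > 0" by linarith
  then show ?thesis
    unfolding hess_det_def X_def Y_def Z_def by (simp add: algebra_simps)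
qed

text \<open>Both kinds of flip are the same picture: on the side where
  \<open>\<kappa> * n1 j > 0\<close> the origin is locally the only critical point, on the other
  side a pair of signs opens up a branch. The sign of \<open>a * \<kappa>\<close> only decides which
  side is stable and whether the new points are centres or saddles.\<close>

theorem flip_at_simple_zero:
  assumes z: "n1 j0 = 0" and dz: "deriv n1 j0 \<noteq> 0"
  obtains \<kappa> where "\<kappa> \<noteq> 0" "n2 j0 \<noteq> 0 \<Longrightarrow> \<kappa> = n2 j0"
    "a * \<kappa> > 0 \<Longrightarrow> ham_flip F j0" "a * \<kappa> < 0 \<Longrightarrow> dual_ham_flip F j0"
proof -
  obtain \<kappa> m where \<kappa>: "\<kappa> \<noteq> 0" and m: "m = 2 \<or> m = (4::nat)" and \<kappa>_n2: "n2 j0 \<noteq> 0 \<Longrightarrow> \<kappa> = n2 j0"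
    and lead: "\<And>\<eta>. \<eta> > 0 \<Longrightarrow> \<exists>r>0. \<forall>j q. \<bar>j - j0\<bar> < r \<longrightarrow> \<bar>q\<bar> < r \<longrightarrow>
       \<bar>n2 j * q\<^sup>2 + b * q ^ 4 - \<kappa> * q ^ m\<bar> \<le> \<eta> * (\<bar>n1 j\<bar> + q ^ m) \<and>
       \<bar>3 * n2 j * q\<^sup>2 + 5 * b * q ^ 4 - (real m + 1) * \<kappa> * q ^ m\<bar> \<le> \<eta> * (\<bar>n1 j\<bar> + q ^ m)"
    by (rule leading_term[OF z dz]) blast
  \<comment> \<open>Collects the smallness conditions of \<open>critical_exists\<close>,
    \<open>critical_trivial\<close> and \<open>critical_type\<close>; the quarter in the last term
    makes the required bound by a half strict.\<close>
  define \<eta> where "\<eta> = min (min (1 / 4) (\<bar>\<kappa>\<bar> / (4 * \<bar>\<kappa>\<bar> + 4))) (min (\<bar>a\<bar> / 2) (\<bar>\<kappa> * a\<bar> / 4))"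
  have ka: "\<bar>\<kappa> * a\<bar> > 0" "\<bar>a\<bar> > 0" "\<bar>\<kappa>\<bar> > 0" using \<kappa> a by simp_all
  have \<eta>: "0 < \<eta>" "\<eta> \<le> 1 / 4" "\<eta> * (4 * \<bar>\<kappa>\<bar> + 4) \<le> \<bar>\<kappa>\<bar>" "\<eta> \<le> \<bar>a\<bar> / 2" "\<eta> < \<bar>\<kappa> * a\<bar> / 2"
  proof -
    show "0 < \<eta>" unfolding \<eta>_def using ka by simp
    show "\<eta> \<le> 1 / 4" "\<eta> \<le> \<bar>a\<bar> / 2" unfolding \<eta>_def by (simp_all only: min.coboundedI1 min.coboundedI2 order_refl)
    have "\<eta> \<le> \<bar>\<kappa> * a\<bar> / 4" unfolding \<eta>_def by (simp only: min.coboundedI1 min.coboundedI2 order_refl)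
    then show "\<eta> < \<bar>\<kappa> * a\<bar> / 2" using ka by linarith
    have "\<eta> \<le> \<bar>\<kappa>\<bar> / (4 * \<bar>\<kappa>\<bar> + 4)" unfolding \<eta>_def by (simp only: min.coboundedI1 min.coboundedI2 order_refl)
    moreover have "4 * \<bar>\<kappa>\<bar> + 4 > 0" using ka by linarith
    ultimately show "\<eta> * (4 * \<bar>\<kappa>\<bar> + 4) \<le> \<bar>\<kappa>\<bar>" by (simp only: pos_le_divide_eq)
  qed
  have \<eta>4: "\<eta> \<le> \<bar>\<kappa>\<bar> / 4"
  proof -
    have "\<eta> * \<bar>\<kappa>\<bar> \<ge> 0" using \<eta> by simp
    then show ?thesis using \<eta>(3) unfolding distrib_left by linarith
  qed
  obtain r0 where r0: "r0 > 0" and near: "\<And>j q p. \<bar>j - j0\<bar> < r0 \<Longrightarrow> \<bar>q\<bar> + \<bar>p\<bar> < r0 \<Longrightarrow> dp (g j) q p = 0 \<Longrightarrow>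
       q ^ m \<le> 1 \<and> (q = 0 \<longrightarrow> p = 0) \<and>
       \<bar>dq (g j) q p - q * (n1 j + \<kappa> * q ^ m)\<bar> \<le> \<bar>q\<bar> * (\<eta> * (\<bar>n1 j\<bar> + q ^ m)) \<and>
       \<bar>dq (dq (g j)) q p - (n1 j + (real m + 1) * \<kappa> * q ^ m)\<bar> \<le> \<eta> * (\<bar>n1 j\<bar> + q ^ m) \<and>
       \<bar>dq (dp (g j)) q p\<bar> \<le> \<eta> * q ^ m \<and> \<bar>dp (dp (g j)) q p - a\<bar> \<le> \<eta>"
    by (rule near_critical[OF m \<eta>(1) lead]) blast+
  \<comment> \<open>The Jacobian is assumed non-zero at the origin only; its continuity extends this
    to nearby points, where critical points of \<open>F j\<close> and of \<open>g j\<close> then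
    correspond.\<close>
  define J where "J j q p = dq (U j) q p * dp (V j) q p - dp (U j) q p * dq (V j) q p" for j q p
  have Jsm: "smooth_family J"
    unfolding J_def by (intro smooth_family_arith smooth_family_dq smooth_family_dp U V)
  have j0\<rho>: "\<bar>j0 - j0\<bar> < \<rho>" using \<rho> by simp
  have "open {x. (\<lambda>(j, q, p). J j q p) x \<noteq> 0}"
    by (intro open_Collect_neq smooth_family_continuous[OF Jsm] continuous_intros)
  moreover have "(j0, 0, 0) \<in> {x. (\<lambda>(j, q, p). J j q p) x \<noteq> 0}"
    using jac[OF j0\<rho>] by (simp add: J_def)
  ultimately obtain r1 where r1: "r1 > 0"
    "\<And>j q p. \<bar>j - j0\<bar> < r1 \<Longrightarrow> \<bar>q\<bar> < r1 \<Longrightarrow> \<bar>p\<bar> < r1 \<Longrightarrow> (j, q, p) \<in> {x. (\<lambda>(j, q, p). J j q p) x \<noteq> 0}"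
    by (rule open_contains_box) blast
  then have J: "J j q p \<noteq> 0" if "\<bar>j - j0\<bar> < r1" "\<bar>q\<bar> + \<bar>p\<bar> < r1" for j q p
    using r1(2)[of j q p] that by auto
  define r2 where "r2 = min r0 r1"
  have r2: "r2 > 0" "r2 \<le> r0" "r2 \<le> r1" using r0 r1(1) by (auto simp: r2_def)
  \<comment> \<open>A full neighbourhood of the origin in the original coordinates is covered by
    points with \<open>|q| + |p| < r2\<close>, so no critical point of \<open>F j\<close> near the
    origin escapes the estimates.\<close>
  obtain d P Q where d: "d > 0"
    "\<And>j x y. \<bar>j - j0\<bar> < d \<Longrightarrow> \<bar>x\<bar> < d \<Longrightarrow> \<bar>y\<bar> < d \<Longrightarrow>
       \<bar>P j x y\<bar> + \<bar>Q j x y\<bar> < r2 \<and> U j (P j x y) (Q j x y) = x \<and> V j (P j x y) (Q j x y) = y"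
    "\<And>j q p q' p'. \<bar>j - j0\<bar> < d \<Longrightarrow> \<bar>q\<bar> < d \<Longrightarrow> \<bar>p\<bar> < d \<Longrightarrow> \<bar>q'\<bar> < d \<Longrightarrow> \<bar>p'\<bar> < d \<Longrightarrow>
       U j q p = U j q' p' \<Longrightarrow> V j q p = V j q' p' \<Longrightarrow> (q, p) = (q', p')"
    by (rule local_inverse_family[OF U V origin[OF j0\<rho>] jac[OF j0\<rho>] r2(1)]) blast
  define c where "c = deriv n1 j0"
  have c: "\<bar>c\<bar> / 2 > 0" using dz by (simp add: c_def)
  obtain d1 where d1: "d1 > 0" "\<And>y. \<bar>y - j0\<bar> < d1 \<Longrightarrow> \<bar>n1 y - n1 j0 - c * (y - j0)\<bar> \<le> \<bar>c\<bar> / 2 * \<bar>y - j0\<bar>"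
    using DERIV_bounds[OF smooth_deriv(1)[OF n1] c, of j0] unfolding c_def by metis
  have n1_sign: "c * (j - j0) * n1 j > 0" if "\<bar>j - j0\<bar> < d1" "j \<noteq> j0" for j
  proof (rule dominant_term_sign[of 1 _ _ 0 "\<bar>c\<bar> / 2 * \<bar>j - j0\<bar>"])
    show "\<bar>n1 j - 1 * (c * (j - j0) + 0)\<bar> \<le> 1 * (\<bar>c\<bar> / 2 * \<bar>j - j0\<bar>)"
      using d1(2)[OF that(1)] z by simp
    show "\<bar>0::real\<bar> + \<bar>c\<bar> / 2 * \<bar>j - j0\<bar> < \<bar>c * (j - j0)\<bar>"
      using c that(2) by (simp add: abs_mult)
  qed simp
  \<comment> \<open>As \<open>n1 j\<close> has the sign of \<open>c * (j - j0)\<close>, this choice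
    makes \<open>\<kappa> * n1 j\<close> negative exactly for
    \<open>\<sigma> * (j - j0) > 0\<close>, which \<open>flip_shape\<close> takes as the side of the
    new critical points.\<close>
  define \<sigma> :: real where "\<sigma> = (if c * \<kappa> > 0 then -1 else 1)"
  have \<sigma>: "\<sigma> \<in> {-1, 1}" "\<sigma> * (c * \<kappa>) < 0"
  proof -
    have "c * \<kappa> \<noteq> 0" using c \<kappa> by simp
    then show "\<sigma> \<in> {-1, 1}" "\<sigma> * (c * \<kappa>) < 0"
      unfolding \<sigma>_def by (simp_all only: split: if_split) (simp_all add: order_less_le)
  qed
  have \<sigma>1: "\<bar>\<sigma>\<bar> = 1" using \<sigma>(1) by auto
  have side: "\<sigma> * (j - j0) * (\<kappa> * n1 j) < 0" if "\<bar>j - j0\<bar> < d1" "j \<noteq> j0" for j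
  proof -
    have "(\<sigma> * (c * \<kappa>)) * (c * (j - j0) * n1 j) < 0"
      using \<sigma>(2) n1_sign[OF that] by (rule mult_neg_pos)
    then have "(\<sigma> * (j - j0) * (\<kappa> * n1 j)) * (c * c) < 0"
      by (simp add: mult_ac)
    moreover have "c * c > 0" using c by (auto simp: zero_less_mult_iff)
    ultimately show ?thesis by (simp add: mult_less_0_iff)
  qed
  define \<epsilon> where "\<epsilon> = min (min d1 (\<rho> / 2)) (min d r2)"
  have \<epsilon>: "\<epsilon> > 0" "\<epsilon> \<le> d1" "\<epsilon> \<le> \<rho> / 2" "\<epsilon> \<le> d" "\<epsilon> \<le> r2"
    using d1(1) \<rho> d(1) r2(1) by (simp_all add: \<epsilon>_def)
  have abs_side: "\<bar>j - j0\<bar> < e" if "0 < s" "s < e" "s = \<sigma> * (j - j0) \<or> s = \<sigma> * (j0 - j)" for s e j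
  proof -
    have "\<bar>s\<bar> = \<bar>j - j0\<bar>" using that(3) \<sigma>1 by (auto simp: abs_mult)
    then show ?thesis using that by simp
  qed
  have before: "\<kappa> * n1 j > 0" "\<bar>j - j0\<bar> < \<epsilon>" if "0 < \<sigma> * (j0 - j)" "\<sigma> * (j0 - j) < \<epsilon>" for j
  proof -
    show *: "\<bar>j - j0\<bar> < \<epsilon>" using abs_side[OF that] by blast
    have "\<sigma> * (j - j0) < 0" using that(1) by (simp add: right_diff_distrib)
    moreover from this have "\<sigma> * (j - j0) * (\<kappa> * n1 j) < 0"
      using * \<epsilon> by (intro side) auto
    ultimately show "\<kappa> * n1 j > 0"
      using mult_less_0_iff[of "\<sigma> * (j - j0)" "\<kappa> * n1 j"] by linarith
  qed
  have after: "\<kappa> * n1 j < 0" "\<bar>j - j0\<bar> < \<delta>" if "0 < \<sigma> * (j - j0)" "\<sigma> * (j - j0) < \<delta>" "\<delta> \<le> \<epsilon>" for j \<delta>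
  proof -
    show *: "\<bar>j - j0\<bar> < \<delta>" using abs_side[OF that(1,2)] by blast
    have "\<sigma> * (j - j0) * (\<kappa> * n1 j) < 0"
      using * \<epsilon> that by (intro side) auto
    with that(1) show "\<kappa> * n1 j < 0"
      using mult_less_0_iff[of "\<sigma> * (j - j0)" "\<kappa> * n1 j"] by linarith
  qed
  have only_origin: "(x, y) = (0, 0)"
    if "\<bar>j - j0\<bar> < \<epsilon>" "\<kappa> * n1 j > 0" "singular_point (F j) x y" "norm (x, y) < d" for j x y
  proof -
    have xy: "\<bar>x\<bar> < d" "\<bar>y\<bar> < d"
      using that(4) norm_fst_le[of x y] norm_snd_le[of y x] by auto
    define q p where "q = P j x y" and "p = Q j x y"
    have qp: "\<bar>q\<bar> + \<bar>p\<bar> < r2" "U j q p = x" "V j q p = y"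
      using d(2)[of j x y] that(1) \<epsilon> xy by (auto simp: q_def p_def)
    have "J j q p \<noteq> 0" using J[of j q p] that(1) \<epsilon> qp(1) r2 by auto
    then have sing: "singular_point (g j) q p"
      using singular_point_compose_iff[OF F U V, of j q p] that(3) qp(2,3) by (simp add: J_def g_eq)
    then have dd: "dq (g j) q p = 0" "dp (g j) q p = 0" by (auto simp: singular_point_def)
    have nc: "q = 0 \<longrightarrow> p = 0" "\<bar>0 - q * (n1 j + \<kappa> * q ^ m)\<bar> \<le> \<bar>q\<bar> * (\<eta> * (\<bar>n1 j\<bar> + q ^ m))"
      using near[OF _ _ dd(2)] that(1) \<epsilon> qp(1) r2 unfolding dd(1) by auto
    have "q = 0"
    proof (rule critical_trivial[OF that(2) m _ _ nc(2)])
      show "\<eta> < 1" using \<eta> by simp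
      show "\<eta> < \<bar>\<kappa>\<bar>" using \<eta>4 ka by linarith
    qed
    with nc(1) qp origin[of j] that(1) \<epsilon> \<rho> show ?thesis by auto
  qed
  have produced: "\<exists>\<delta>>0. \<forall>j. 0 < \<sigma> * (j - j0) \<and> \<sigma> * (j - j0) < \<delta> \<longrightarrow>
      (\<exists>x y. (x, y) \<noteq> (0, 0) \<and> norm (x, y) < r \<and> singular_point (F j) x y \<and> \<kappa> * a * hess_det (F j) x y > 0)"
    if r: "r > 0" for r
  proof -
    have "open {x. \<bar>(\<lambda>(j, q, p). U j q p) x\<bar> + \<bar>(\<lambda>(j, q, p). V j q p) x\<bar> < r}"
      by (intro open_Collect_less continuous_intros smooth_family_continuous U V)
    moreover have "(j0, 0, 0) \<in> {x. \<bar>(\<lambda>(j, q, p). U j q p) x\<bar> + \<bar>(\<lambda>(j, q, p). V j q p) x\<bar> < r}"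
      using origin[OF j0\<rho>] r by simp
    ultimately obtain r3 where r3: "r3 > 0"
      "\<And>j q p. \<bar>j - j0\<bar> < r3 \<Longrightarrow> \<bar>q\<bar> < r3 \<Longrightarrow> \<bar>p\<bar> < r3 \<Longrightarrow>
        (j, q, p) \<in> {x. \<bar>(\<lambda>(j, q, p). U j q p) x\<bar> + \<bar>(\<lambda>(j, q, p). V j q p) x\<bar> < r}"
      by (rule open_contains_box) blast
    define r4 where "r4 = min r3 (min d r2)"
    have r4: "r4 > 0" "r4 \<le> r3" "r4 \<le> d" "r4 \<le> r2" using r3(1) d(1) r2(1) by (simp_all add: r4_def)
    have m0: "m > 0" using m by auto
    obtain \<delta> where \<delta>: "\<delta> > 0" "\<And>j. \<bar>j - j0\<bar> < \<delta> \<Longrightarrow> \<kappa> * n1 j < 0 \<Longrightarrow>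
        \<exists>q p. q \<noteq> 0 \<and> \<bar>q\<bar> + \<bar>p\<bar> < r4 \<and> singular_point (g j) q p"
    proof (rule critical_exists[OF z \<kappa> m0 r4(1) \<eta>(1,2) \<eta>4 r0])
      show "\<bar>dq (g j) q p - q * (n1 j + \<kappa> * q ^ m)\<bar> \<le> \<bar>q\<bar> * (\<eta> * (\<bar>n1 j\<bar> + q ^ m))"
        if "\<bar>j - j0\<bar> < r0" "\<bar>q\<bar> + \<bar>p\<bar> < r0" "dp (g j) q p = 0" for j q p
        using near[OF that] by blast
    qed blast
    define \<delta>' where "\<delta>' = min (min \<delta> \<epsilon>) r4"
    have \<delta>': "\<delta>' > 0" "\<delta>' \<le> \<delta>" "\<delta>' \<le> \<epsilon>" "\<delta>' \<le> r4" using \<delta>(1) \<epsilon>(1) r4(1) by (simp_all add: \<delta>'_def)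
    have "\<exists>x y. (x, y) \<noteq> (0, 0) \<and> norm (x, y) < r \<and> singular_point (F j) x y \<and> \<kappa> * a * hess_det (F j) x y > 0"
      if "0 < \<sigma> * (j - j0)" "\<sigma> * (j - j0) < \<delta>'" for j
    proof -
      have j: "\<kappa> * n1 j < 0" "\<bar>j - j0\<bar> < \<delta>'" using after[OF that \<delta>'(3)] by auto
      obtain q p where q: "q \<noteq> 0" "\<bar>q\<bar> + \<bar>p\<bar> < r4" "singular_point (g j) q p"
        using \<delta>(2)[OF _ j(1)] j(2) \<delta>'(2) by auto
      have Jn: "J j q p \<noteq> 0" using J[of j q p] j \<delta>' r4 r2 q by auto
      then have sing: "singular_point (F j) (U j q p) (V j q p)"
        using singular_point_compose_iff[OF F U V, of j q p] q(3) by (simp add: J_def g_eq)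
      have dd: "dq (g j) q p = 0" "dp (g j) q p = 0" using q(3) by (auto simp: singular_point_def)
      have bnd: "\<bar>j - j0\<bar> < r0" "\<bar>q\<bar> + \<bar>p\<bar> < r0" using j \<delta>' r4 r2 q by auto
      note nc = near[OF bnd dd(2), unfolded dd(1)]
      have "\<kappa> * a * hess_det (g j) q p > 0"
        by (rule critical_type[OF q(1) m \<kappa> \<eta>]) (use nc in auto)
      moreover have "hess_det (g j) q p = hess_det (F j) (U j q p) (V j q p) * (J j q p)\<^sup>2"
        using hess_det_compose[OF F U V sing] by (simp add: g_eq J_def)
      ultimately have "(\<kappa> * a * hess_det (F j) (U j q p) (V j q p)) * (J j q p)\<^sup>2 > 0"
        by (simp add: mult_ac)
      then have "\<kappa> * a * hess_det (F j) (U j q p) (V j q p) > 0"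
        using Jn by (simp add: zero_less_mult_iff)
      moreover have "(U j q p, V j q p) \<noteq> (0, 0)"
      proof
        assume "(U j q p, V j q p) = (0, 0)"
        moreover have "U j 0 0 = 0" "V j 0 0 = 0" using origin[of j] j \<delta>' \<epsilon> \<rho> by auto
        ultimately have "(q, p) = (0, 0)"
          using d(1) j \<delta>' r4 q by (intro d(3)[of j]) auto
        with q(1) show False by simp
      qed
      moreover have "norm (U j q p, V j q p) < r"
      proof -
        have "\<bar>U j q p\<bar> + \<bar>V j q p\<bar> < r" using r3(2)[of j q p] j \<delta>' r4 q by auto
        then show ?thesis using norm_Pair_le[of "U j q p" "V j q p"] by simp
      qed
      ultimately show ?thesis using sing by blast
    qed
    with \<delta>'(1) show ?thesis by blast
  qed
  \<comment> \<open>Kept generic in \<open>B\<close> and \<open>T\<close>: the sides are told apart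
    by the sign of \<open>\<kappa> * n1 j\<close>, stability by that of \<open>a * n1 j\<close>, and
    the sign of \<open>a * \<kappa>\<close> translates one into the other.\<close>
  have shape: "flip_shape F j0 B T"
    if B: "\<And>j. \<bar>j - j0\<bar> < \<epsilon> \<Longrightarrow> \<kappa> * n1 j > 0 \<Longrightarrow> B (F j)"
      "\<And>j. \<bar>j - j0\<bar> < \<epsilon> \<Longrightarrow> \<kappa> * n1 j < 0 \<Longrightarrow> \<not> B (F j)"
      and T: "\<And>j x y. singular_point (F j) x y \<Longrightarrow> \<kappa> * a * hess_det (F j) x y > 0 \<Longrightarrow> T (F j) x y" for B T
    unfolding flip_shape_def
  proof (rule bexI[OF _ \<sigma>(1)], rule exI[of _ \<epsilon>], intro conjI)
    show "\<epsilon> > 0" by (fact \<epsilon>(1))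
    show "\<forall>j. 0 < \<sigma> * (j0 - j) \<and> \<sigma> * (j0 - j) < \<epsilon> \<longrightarrow> B (F j)"
      using before B(1) by blast
    show "\<forall>j. 0 < \<sigma> * (j - j0) \<and> \<sigma> * (j - j0) < \<epsilon> \<longrightarrow> \<not> B (F j)"
      using after[OF _ _ order_refl] B(2) by blast
    show "\<forall>r>0. \<exists>\<delta>>0. \<forall>j. 0 < \<sigma> * (j - j0) \<and> \<sigma> * (j - j0) < \<delta> \<longrightarrow>
         (\<exists>q p. (q, p) \<noteq> (0, 0) \<and> norm (q, p) < r \<and> T (F j) q p)"
    proof (intro allI impI)
      fix r :: real assume "r > 0"
      from produced[OF this] obtain \<delta> where "\<delta> > 0" and
        \<delta>: "\<And>j. 0 < \<sigma> * (j - j0) \<Longrightarrow> \<sigma> * (j - j0) < \<delta> \<Longrightarrow> \<exists>x y. (x, y) \<noteq> (0, 0) \<and> norm (x, y) < r \<and>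
          singular_point (F j) x y \<and> \<kappa> * a * hess_det (F j) x y > 0"
        by blast
      have "\<exists>q p. (q, p) \<noteq> (0, 0) \<and> norm (q, p) < r \<and> T (F j) q p"
        if "0 < \<sigma> * (j - j0) \<and> \<sigma> * (j - j0) < \<delta>" for j
      proof -
        obtain x y where "(x, y) \<noteq> (0, 0)" "norm (x, y) < r" "singular_point (F j) x y"
          "\<kappa> * a * hess_det (F j) x y > 0"
          using \<delta> \<open>0 < \<sigma> * (j - j0) \<and> \<sigma> * (j - j0) < \<delta>\<close> by blast
        with T show ?thesis by blast
      qed
      with \<open>\<delta> > 0\<close> show "\<exists>\<delta>>0. \<forall>j. 0 < \<sigma> * (j - j0) \<and> \<sigma> * (j - j0) < \<delta> \<longrightarrow>
          (\<exists>q p. (q, p) \<noteq> (0, 0) \<and> norm (q, p) < r \<and> T (F j) q p)"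
        by blast
    qed
    show "\<exists>r>0. \<forall>j. 0 < \<sigma> * (j0 - j) \<and> \<sigma> * (j0 - j) < \<epsilon> \<longrightarrow>
         (\<forall>q p. singular_point (F j) q p \<and> norm (q, p) < r \<longrightarrow> (q, p) = (0, 0))"
    proof (intro exI[of _ d] conjI allI impI d(1))
      fix j q p
      assume "0 < \<sigma> * (j0 - j) \<and> \<sigma> * (j0 - j) < \<epsilon>" "singular_point (F j) q p \<and> norm (q, p) < d"
      then show "(q, p) = (0, 0)"
        using only_origin[of j q p] before[of j] by simp
    qed
  qed
  have stab: "a * n1 j > 0 \<Longrightarrow> stable_origin (F j)" "a * n1 j < 0 \<Longrightarrow> \<not> stable_origin (F j)"
    if "\<bar>j - j0\<bar> < \<epsilon>" for j
    using stability[of j] that \<epsilon> by auto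
  show thesis
  proof (rule that[OF \<kappa> \<kappa>_n2])
    assume ak: "a * \<kappa> > 0"
    have sg: "a * n > 0 \<longleftrightarrow> \<kappa> * n > 0" "a * n < 0 \<longleftrightarrow> \<kappa> * n < 0" for n
      using ak by (auto simp: zero_less_mult_iff mult_less_0_iff)
    show "ham_flip F j0"
      unfolding ham_flip_def
    proof (rule shape)
      show "is_centre (F j) x y" if "singular_point (F j) x y" "\<kappa> * a * hess_det (F j) x y > 0" for j x y
      proof (rule is_centreI[OF F that(1)])
        have "\<kappa> * a > 0" using ak by (simp add: mult.commute)
        then show "hess_det (F j) x y > 0"
          using that(2) zero_less_mult_iff[of "\<kappa> * a" "hess_det (F j) x y"] by linarith
      qed
    qed (use stab sg in blast)+
  next
    assume ak: "a * \<kappa> < 0"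
    have sg: "a * n > 0 \<longleftrightarrow> \<kappa> * n < 0" "a * n < 0 \<longleftrightarrow> \<kappa> * n > 0" for n
      using ak by (auto simp: zero_less_mult_iff mult_less_0_iff)
    show "dual_ham_flip F j0"
      unfolding dual_ham_flip_def
    proof (rule shape)
      show "is_saddle (F j) x y" if "singular_point (F j) x y" "\<kappa> * a * hess_det (F j) x y > 0" for j x y
      proof (rule is_saddleI[OF F that(1)])
        have "\<kappa> * a < 0" using ak by (simp add: mult.commute)
        then show "hess_det (F j) x y < 0"
          using that(2) zero_less_mult_iff[of "\<kappa> * a" "hess_det (F j) x y"] by linarith
      qed
    qed (use stab sg in blast)+
  qed
qed

end

section \<open>Zeros near a fold\<close>

text \<open>The secant from \<open>0\<close> to a point with \<open>k \<ge> 0\<close> rises away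
  from \<open>0\<close>, and monotonicity of \<open>k'\<close> passes the sign of its slope on to
  that point. So every zero is simple, and beyond it \<open>k\<close> stays positive, which leaves
  one zero on each side. The last clause traps the zeros in smaller intervals and is there for their
  limits.\<close>

lemma convex_zeros:
  fixes k k' k'' :: "real \<Rightarrow> real"
  assumes k: "\<And>x. \<bar>x\<bar> < r \<Longrightarrow> (k has_real_derivative k' x) (at x)"
    and k': "\<And>x. \<bar>x\<bar> < r \<Longrightarrow> (k' has_real_derivative k'' x) (at x)"
    and k'': "\<And>x. \<bar>x\<bar> < r \<Longrightarrow> k'' x > 0"
    and \<epsilon>: "0 < \<epsilon>" "\<epsilon> < r" and k0: "k 0 < 0" and ends: "k (- \<epsilon>) > 0" "k \<epsilon> > 0"
  obtains x y where "x \<noteq> y" "{j. \<bar>j\<bar> < \<epsilon> \<and> k j = 0} = {x, y}" "k' x \<noteq> 0" "k' y \<noteq> 0"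
    "\<And>\<eta>. 0 < \<eta> \<Longrightarrow> \<eta> \<le> \<epsilon> \<Longrightarrow> k (- \<eta>) > 0 \<Longrightarrow> k \<eta> > 0 \<Longrightarrow> \<bar>x\<bar> < \<eta> \<and> \<bar>y\<bar> < \<eta>"
proof -
  have mono: "k' u < k' v" if "u < v" "- r < u" "v < r" for u v
    using that by (intro DERIV_pos_imp_increasing[of u v k']) (auto intro!: exI k' k'')
  have cont: "continuous_on {u..v} k" if "- r < u" "v < r" for u v
    using that by (intro DERIV_continuous_on[of _ _ k'] has_field_derivative_at_within[OF k]) auto
  have right: "k' y > 0" if y: "0 < y" "y < r" "k y \<ge> 0" for y
  proof -
    obtain z where z: "0 < z" "z < y" "k y - k 0 = (y - 0) * k' z"
      using MVT2[of 0 y k k'] y k by auto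
    then have "y * k' z > 0" using y k0 by simp
    then have "k' z > 0" using y by (simp add: zero_less_mult_iff)
    with mono[of z y] z y show ?thesis by simp
  qed
  have left: "k' x < 0" if x: "- r < x" "x < 0" "k x \<ge> 0" for x
  proof -
    obtain z where z: "x < z" "z < 0" "k 0 - k x = (0 - x) * k' z"
      using MVT2[of x 0 k k'] x k by auto
    then have "(- x) * k' z < 0" using x k0 by simp
    then have "k' z < 0" using x mult_less_0_iff[of "- x" "k' z"] by linarith
    with mono[of x z] z x show ?thesis by simp
  qed
  have right_unique: "k v > 0" if "0 < u" "u < v" "v < r" "k u = 0" for u v
  proof -
    have "k u < k v"
    proof (rule DERIV_pos_imp_increasing[OF that(2)])
      fix w assume w: "u \<le> w" "w \<le> v"
      have "k' u > 0" using right[of u] that by auto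
      then have "k' w > 0" using mono[of u w] w that by (cases "u = w") auto
      then show "\<exists>y. (k has_real_derivative y) (at w) \<and> 0 < y" using k[of w] w that by auto
    qed
    then show ?thesis using that by simp
  qed
  have left_unique: "k v > 0" if "- r < v" "v < u" "u < 0" "k u = 0" for u v
  proof -
    have "k u < k v"
    proof (rule DERIV_neg_imp_decreasing[OF that(2)])
      fix w assume w: "v \<le> w" "w \<le> u"
      have "k' u < 0" using left[of u] that by auto
      then have "k' w < 0" using mono[of w u] w that by (cases "u = w") auto
      then show "\<exists>y. (k has_real_derivative y) (at w) \<and> y < 0" using k[of w] w that by auto
    qed
    then show ?thesis using that by simp
  qed
  have ex_right: "\<exists>y. 0 < y \<and> y < \<eta> \<and> k y = 0" if h: "0 < \<eta>" "\<eta> \<le> \<epsilon>" "k \<eta> > 0" for \<eta>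
  proof -
    obtain y where "0 \<le> y" "y \<le> \<eta>" "k y = 0"
      using IVT'[of k 0 0 \<eta>] cont[of 0 \<eta>] h k0 \<epsilon> by auto
    moreover have "y \<noteq> 0" "y \<noteq> \<eta>" using calculation k0 h by auto
    ultimately show ?thesis by (intro exI[of _ y]) simp
  qed
  have ex_left: "\<exists>x. - \<eta> < x \<and> x < 0 \<and> k x = 0" if h: "0 < \<eta>" "\<eta> \<le> \<epsilon>" "k (- \<eta>) > 0" for \<eta>
  proof -
    obtain x where "- \<eta> \<le> x" "x \<le> 0" "k x = 0"
      using IVT2'[of k 0 0 "- \<eta>"] cont[of "- \<eta>" 0] h k0 \<epsilon> by auto
    moreover have "x \<noteq> 0" "x \<noteq> - \<eta>" using calculation k0 h by auto
    ultimately show ?thesis by (intro exI[of _ x]) simp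
  qed
  obtain x where x: "- \<epsilon> < x" "x < 0" "k x = 0" using ex_left[of \<epsilon>] \<epsilon> ends by auto
  obtain y where y: "0 < y" "y < \<epsilon>" "k y = 0" using ex_right[of \<epsilon>] \<epsilon> ends by auto
  have x_only: "u = x" if "- \<epsilon> < u" "u < 0" "k u = 0" for u
    using left_unique[of u x] left_unique[of x u] that x \<epsilon> by (cases u x rule: linorder_cases) auto
  have y_only: "u = y" if "0 < u" "u < \<epsilon>" "k u = 0" for u
    using right_unique[of u y] right_unique[of y u] that y \<epsilon> by (cases u y rule: linorder_cases) auto
  show thesis
  proof (rule that[of x y])
    show "x \<noteq> y" using x y by simp
    show "{j. \<bar>j\<bar> < \<epsilon> \<and> k j = 0} = {x, y}"
    proof (intro equalityI subsetI)
      fix u assume "u \<in> {j. \<bar>j\<bar> < \<epsilon> \<and> k j = 0}"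
      then have u: "- \<epsilon> < u" "u < \<epsilon>" "k u = 0" by auto
      then have "u \<noteq> 0" using k0 by auto
      then show "u \<in> {x, y}" using x_only[of u] y_only[of u] u by (cases "u < 0") auto
    next
      fix u assume "u \<in> {x, y}"
      then show "u \<in> {j. \<bar>j\<bar> < \<epsilon> \<and> k j = 0}" using x y by auto
    qed
    show "k' x \<noteq> 0" "k' y \<noteq> 0" using left[of x] right[of y] x y \<epsilon> by auto
    fix \<eta> assume \<eta>: "0 < \<eta>" "\<eta> \<le> \<epsilon>" "k (- \<eta>) > 0" "k \<eta> > 0"
    obtain u v where "- \<eta> < u" "u < 0" "k u = 0" "0 < v" "v < \<eta>" "k v = 0"
      using ex_left[of \<eta>] ex_right[of \<eta>] \<eta> by blast
    with x_only[of u] y_only[of v] \<eta> show "\<bar>x\<bar> < \<eta> \<and> \<bar>y\<bar> < \<eta>" by auto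
  qed
qed

text \<open>After normalising signs, \<open>N\<close> is strictly convex in \<open>j\<close> with
  minimum 0 at the origin for \<open>t = 0\<close>, and strictly monotone in \<open>t\<close>.
  Raising the graph removes the zero, lowering it splits the zero in two.\<close>

lemma fold_zeros:
  fixes N :: "real \<Rightarrow> real \<Rightarrow> real"
  assumes N: "smooth (\<lambda>(j, t). N j t)" and N0: "N 0 0 = 0" and Nj: "deriv (\<lambda>j. N j 0) 0 = 0"
    and Njj: "deriv (deriv (\<lambda>j. N j 0)) 0 \<noteq> 0" and Nt: "deriv (\<lambda>t. N 0 t) 0 \<noteq> 0" and \<rho>: "\<rho> > 0"
  obtains \<sigma> \<epsilon> \<delta> :: real and jm jp where "\<sigma> \<in> {-1, 1}" "0 < \<epsilon>" "\<epsilon> \<le> \<rho>" "0 < \<delta>" "\<delta> \<le> \<rho>"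
    "\<And>j t. 0 < \<sigma> * t \<Longrightarrow> \<sigma> * t < \<delta> \<Longrightarrow> \<bar>j\<bar> < \<epsilon> \<Longrightarrow> N j t \<noteq> 0"
    "\<And>j. \<bar>j\<bar> < \<epsilon> \<Longrightarrow> N j 0 = 0 \<Longrightarrow> j = 0"
    "\<And>t. 0 < - \<sigma> * t \<Longrightarrow> - \<sigma> * t < \<delta> \<Longrightarrow> jm t \<noteq> jp t \<and> {j. \<bar>j\<bar> < \<epsilon> \<and> N j t = 0} = {jm t, jp t} \<and>
       deriv (\<lambda>j. N j t) (jm t) \<noteq> 0 \<and> deriv (\<lambda>j. N j t) (jp t) \<noteq> 0"
    "(jm \<longlongrightarrow> 0) (at 0 within {t. 0 < - \<sigma> * t})" "(jp \<longlongrightarrow> 0) (at 0 within {t. 0 < - \<sigma> * t})"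
proof -
  \<comment> \<open>The plane is now that of \<open>(j, t)\<close>: \<open>dq\<close> is the
    derivative in \<open>j\<close>, \<open>dp\<close> the one in \<open>t\<close>, and the family
    parameter is a dummy.\<close>
  define G where "G = (\<lambda>_::real. N)"
  have G: "smooth_family G"
    unfolding G_def smooth_family_def
    using smooth_compose2[OF N smooth_proj(2,3)] by (simp add: case_prod_unfold)
  have Nq: "dq N j t = deriv (\<lambda>j. N j t) j" and Np: "dp N j t = deriv (\<lambda>t. N j t) t" for j t
    by (simp_all add: dq_def dp_def)
  have dN: "((\<lambda>j. N j t) has_real_derivative dq N j t) (at j)" "((\<lambda>t. N j t) has_real_derivative dp N j t) (at t)" for j t
    using smooth_family_DERIV[OF G, of 0] by (simp_all add: G_def)
  have ddN: "((\<lambda>j. dq N j t) has_real_derivative dq (dq N) j t) (at j)" for j t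
    using smooth_family_DERIV(1)[OF smooth_family_dq[OF G], of 0] by (simp add: G_def)
  define c e where "c = dq (dq N) 0 0" and "e = dp N 0 0"
  have c: "c \<noteq> 0" using Njj unfolding c_def dq_def by simp
  have e: "e \<noteq> 0" using Nt unfolding e_def dp_def by simp
  note cont = smooth_family_continuous[of _ UNIV]
  have "open {x. 0 < c * (\<lambda>(j, q, p). dq (dq (G j)) q p) x}" "open {x. 0 < e * (\<lambda>(j, q, p). dp (G j) q p) x}"
    by (intro open_Collect_less continuous_intros cont smooth_family_dq smooth_family_dp G)+
  then have "open ({x. 0 < c * (\<lambda>(j, q, p). dq (dq (G j)) q p) x} \<inter> {x. 0 < e * (\<lambda>(j, q, p). dp (G j) q p) x})"
    by (rule open_Int)
  moreover have "(0, 0, 0) \<in> {x. 0 < c * (\<lambda>(j, q, p). dq (dq (G j)) q p) x} \<inter> {x. 0 < e * (\<lambda>(j, q, p). dp (G j) q p) x}"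
    using c e by (simp add: G_def c_def[symmetric] e_def[symmetric] zero_less_mult_iff, linarith)
  ultimately obtain r where r: "r > 0" "\<And>j q p. \<bar>j - 0\<bar> < r \<Longrightarrow> \<bar>q\<bar> < r \<Longrightarrow> \<bar>p\<bar> < r \<Longrightarrow>
      (j, q, p) \<in> {x. 0 < c * (\<lambda>(j, q, p). dq (dq (G j)) q p) x} \<inter> {x. 0 < e * (\<lambda>(j, q, p). dp (G j) q p) x}"
    by (rule open_contains_box) blast
  have cjj: "c * dq (dq N) j t > 0" and et: "e * dp N j t > 0" if "\<bar>j\<bar> < r" "\<bar>t\<bar> < r" for j t
    using r(2)[of 0 j t] that r(1) by (auto simp: G_def)
  \<comment> \<open>Multiplying by the second derivative \<open>c\<close> at the origin makes
    \<open>k t\<close> convex near it whatever the sign of \<open>c\<close>.\<close>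
  define k where "k t j = c * N j t" for t j
  have dk: "(k t has_real_derivative c * dq N j t) (at j)" for t j
    unfolding k_def by (rule DERIV_cmult[OF dN(1)])
  have ddk: "((\<lambda>j. c * dq N j t) has_real_derivative c * dq (dq N) j t) (at j)" for t j
    by (rule DERIV_cmult[OF ddN])
  have zero_iff: "N j t = 0 \<longleftrightarrow> k t j = 0" for j t using c by (simp add: k_def)
  have mono: "c * dq N u 0 < c * dq N v 0" if "u < v" "- r < u" "v < r" for u v
    using that r(1) by (intro DERIV_pos_imp_increasing[of u v "\<lambda>j. c * dq N j 0"]) (auto intro!: exI ddk cjj)
  have dq00: "dq N 0 0 = 0" using Nj by (simp add: Nq)
  have k00: "k 0 0 = 0" by (simp add: k_def N0)
  have k0_pos: "k 0 j > 0" if h: "\<bar>j\<bar> < r" "j \<noteq> 0" for j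
  proof (cases "j > 0")
    case True
    obtain z where "0 < z" "z < j" "k 0 j - k 0 0 = (j - 0) * (c * dq N z 0)"
      using MVT2[of 0 j "k 0" "\<lambda>j. c * dq N j 0"] True dk by auto
    moreover from this have "c * dq N z 0 > 0" using mono[of 0 z] h dq00 r(1) by auto
    then have "(j - 0) * (c * dq N z 0) > 0" using True mult_pos_pos[of j "c * dq N z 0"] by simp
    ultimately show ?thesis using k00 by linarith
  next
    case False
    then obtain z where "j < z" "z < 0" "k 0 0 - k 0 j = (0 - j) * (c * dq N z 0)"
      using MVT2[of j 0 "k 0" "\<lambda>j. c * dq N j 0"] h dk by auto
    moreover from this have "c * dq N z 0 < 0" using mono[of z 0] h dq00 r(1) by auto
    then have "(0 - j) * (c * dq N z 0) < 0" using False h mult_pos_neg[of "0 - j" "c * dq N z 0"] by linarith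
    ultimately show ?thesis using k00 by linarith
  qed
  \<comment> \<open>The derivative of \<open>k\<close> in \<open>t\<close> has the sign of
    \<open>c * e\<close>, so \<open>k\<close> increases with \<open>\<sigma> * t\<close>.\<close>
  define \<sigma> :: real where "\<sigma> = (if c * e > 0 then 1 else - 1)"
  have \<sigma>: "\<sigma> \<in> {-1, 1}" by (simp add: \<sigma>_def)
  have \<sigma>ce: "\<sigma> * (c * e) > 0"
  proof -
    have "c * e \<noteq> 0" using c e by simp
    then show ?thesis unfolding \<sigma>_def by (simp only: split: if_split) (simp add: order_less_le)
  qed
  have \<sigma>abs: "\<bar>\<sigma> * t\<bar> = \<bar>t\<bar>" for t using \<sigma> by auto
  have shift: "0 < (\<sigma> * t) * (k t j - k 0 j)" if h: "\<bar>j\<bar> < r" "\<bar>t\<bar> < r" "t \<noteq> 0" for j t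
  proof -
    have "\<exists>s. \<bar>s\<bar> < r \<and> N j t - N j 0 = t * dp N j s"
    proof (cases "t > 0")
      case True
      then obtain z where "0 < z" "z < t" "N j t - N j 0 = (t - 0) * dp N j z"
        using MVT2[of 0 t "\<lambda>t. N j t" "\<lambda>t. dp N j t"] dN by auto
      then show ?thesis using h by (intro exI[of _ z]) auto
    next
      case False
      then obtain z where "t < z" "z < 0" "N j 0 - N j t = (0 - t) * dp N j z"
        using MVT2[of t 0 "\<lambda>t. N j t" "\<lambda>t. dp N j t"] dN h by auto
      then show ?thesis using h by (intro exI[of _ z]) (auto simp: algebra_simps)
    qed
    then obtain s where s: "\<bar>s\<bar> < r" "N j t - N j 0 = t * dp N j s" by blast
    have "t * t > 0" "e * e > 0" using h e by (auto simp: zero_less_mult_iff)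
    \<comment> \<open>The squares of \<open>t\<close> and \<open>e\<close> are supplied so that
      known positive factors regroup into the wanted product times \<open>e * e\<close>.\<close>
    then have "(\<sigma> * (c * e)) * (e * dp N j s) * (t * t) > 0"
      by (intro mult_pos_pos[OF mult_pos_pos[OF \<sigma>ce et[OF h(1) s(1)]]])
    also have "(\<sigma> * (c * e)) * (e * dp N j s) * (t * t) = ((\<sigma> * t) * (c * (t * dp N j s))) * (e * e)"
      by (simp add: mult_ac)
    finally have "(\<sigma> * t) * (c * (t * dp N j s)) > 0"
      using \<open>e * e > 0\<close> by (rule zero_less_mult_pos2)
    then show ?thesis
      by (simp add: k_def s(2)[symmetric] right_diff_distrib)
  qed
  \<comment> \<open>Positivity of \<open>k 0\<close> at \<open>\<eta>\<close> and
    \<open>- \<eta>\<close> persists for small \<open>t\<close>. It is used at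
    \<open>\<epsilon>\<close> to obtain the zeros, and at arbitrarily small \<open>\<eta>\<close> to
    make them converge.\<close>
  have ends: "\<exists>d>0. \<forall>t. \<bar>t\<bar> < d \<longrightarrow> k t \<eta> > 0 \<and> k t (- \<eta>) > 0" if e: "0 < \<eta>" "\<eta> < r" for \<eta>
  proof -
    have "\<exists>d>0. \<forall>t. \<bar>t\<bar> < d \<longrightarrow> k t j > 0" if h: "\<bar>j\<bar> < r" "j \<noteq> 0" for j
    proof -
      have "isCont (\<lambda>t. k t j) 0"
        unfolding k_def using DERIV_isCont[OF DERIV_cmult[OF dN(2)]] .
      then obtain d where "d > 0" "\<And>t. \<bar>t - 0\<bar> < d \<Longrightarrow> \<bar>k t j - k 0 j\<bar> < k 0 j"
        using isCont_real_near[of 0 "\<lambda>t. k t j" "k 0 j"] k0_pos[OF h] by blast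
      then show ?thesis by (intro exI[of _ d]) fastforce
    qed
    from this[of \<eta>] this[of "- \<eta>"] e obtain d1 d2 where "d1 > 0" "d2 > 0"
      "\<And>t. \<bar>t\<bar> < d1 \<Longrightarrow> k t \<eta> > 0" "\<And>t. \<bar>t\<bar> < d2 \<Longrightarrow> k t (- \<eta>) > 0" by auto
    then show ?thesis by (intro exI[of _ "min d1 d2"]) auto
  qed
  define \<epsilon> where "\<epsilon> = min (r / 2) \<rho>"
  have \<epsilon>: "0 < \<epsilon>" "\<epsilon> < r" "\<epsilon> \<le> \<rho>" using r(1) \<rho> by (auto simp: \<epsilon>_def)
  obtain d0 where d0: "d0 > 0" "\<And>t. \<bar>t\<bar> < d0 \<Longrightarrow> k t \<epsilon> > 0 \<and> k t (- \<epsilon>) > 0"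
    using ends[OF \<epsilon>(1,2)] by blast
  define \<delta> where "\<delta> = min (min r \<rho>) d0"
  have \<delta>: "0 < \<delta>" "\<delta> \<le> r" "\<delta> \<le> \<rho>" "\<delta> \<le> d0" using r(1) \<rho> d0(1) by (auto simp: \<delta>_def)
  \<comment> \<open>The clause on \<open>\<eta>\<close> is recorded together with the zeros before
    they are chosen, since it is what later forces them to tend to \<open>0\<close>.\<close>
  define Z where "Z t x y \<longleftrightarrow> x \<noteq> y \<and> {j. \<bar>j\<bar> < \<epsilon> \<and> N j t = 0} = {x, y} \<and> dq N x t \<noteq> 0 \<and> dq N y t \<noteq> 0 \<and>
      (\<forall>\<eta>. 0 < \<eta> \<and> \<eta> \<le> \<epsilon> \<and> k t (- \<eta>) > 0 \<and> k t \<eta> > 0 \<longrightarrow> \<bar>x\<bar> < \<eta> \<and> \<bar>y\<bar> < \<eta>)" for t x y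
  have ex: "\<exists>x y. Z t x y"
    if t: "0 < - \<sigma> * t" "- \<sigma> * t < \<delta>" for t
  proof -
    have "\<bar>t\<bar> < \<delta>" using \<sigma>abs[of t] t by linarith
    have "t \<noteq> 0" using t by auto
    have "(\<sigma> * t) * (k t 0 - k 0 0) > 0"
      using shift[of 0 t] \<open>\<bar>t\<bar> < \<delta>\<close> \<open>t \<noteq> 0\<close> \<delta> r(1) by auto
    then have k0: "k t 0 < 0"
      using t N0 zero_less_mult_iff[of "\<sigma> * t" "k t 0 - k 0 0"] by (simp add: k_def)
    have tr: "\<bar>t\<bar> < r" "\<bar>t\<bar> < d0" using \<open>\<bar>t\<bar> < \<delta>\<close> \<delta> by auto
    show ?thesis
    proof (rule convex_zeros[of r "k t" "\<lambda>j. c * dq N j t" "\<lambda>j. c * dq (dq N) j t" \<epsilon>])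
      fix x y
      assume "x \<noteq> y" "{j. \<bar>j\<bar> < \<epsilon> \<and> k t j = 0} = {x, y}" "c * dq N x t \<noteq> 0" "c * dq N y t \<noteq> 0"
        "\<And>\<eta>. 0 < \<eta> \<Longrightarrow> \<eta> \<le> \<epsilon> \<Longrightarrow> k t (- \<eta>) > 0 \<Longrightarrow> k t \<eta> > 0 \<Longrightarrow> \<bar>x\<bar> < \<eta> \<and> \<bar>y\<bar> < \<eta>"
      then show ?thesis
        by (intro exI[of _ x] exI[of _ y]) (auto simp: zero_iff Z_def)
    qed (use dk ddk cjj tr \<epsilon> k0 d0(2)[OF tr(2)] in auto)
  qed
  have "\<forall>t. \<exists>z. 0 < - \<sigma> * t \<longrightarrow> - \<sigma> * t < \<delta> \<longrightarrow> Z t (fst z) (snd z)"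
  proof
    fix t show "\<exists>z. 0 < - \<sigma> * t \<longrightarrow> - \<sigma> * t < \<delta> \<longrightarrow> Z t (fst z) (snd z)"
    proof (cases "0 < - \<sigma> * t \<and> - \<sigma> * t < \<delta>")
      case True
      then obtain x y where "Z t x y" using ex by blast
      then show ?thesis by (intro exI[of _ "(x, y)"]) simp
    qed blast
  qed
  from choice[OF this] obtain z where z: "\<And>t. 0 < - \<sigma> * t \<Longrightarrow> - \<sigma> * t < \<delta> \<Longrightarrow> Z t (fst (z t)) (snd (z t))"
    by blast
  define jm jp where "jm t = fst (z t)" and "jp t = snd (z t)" for t
  have j: "jm t \<noteq> jp t \<and>
      {j. \<bar>j\<bar> < \<epsilon> \<and> N j t = 0} = {jm t, jp t} \<and> dq N (jm t) t \<noteq> 0 \<and> dq N (jp t) t \<noteq> 0 \<and>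
      (\<forall>\<eta>. 0 < \<eta> \<and> \<eta> \<le> \<epsilon> \<and> k t (- \<eta>) > 0 \<and> k t \<eta> > 0 \<longrightarrow> \<bar>jm t\<bar> < \<eta> \<and> \<bar>jp t\<bar> < \<eta>)"
    if "0 < - \<sigma> * t" "- \<sigma> * t < \<delta>" for t
    using z[OF that] unfolding Z_def jm_def jp_def .
  have small: "\<exists>d>0. \<forall>t. 0 < - \<sigma> * t \<and> \<bar>t\<bar> < d \<longrightarrow> \<bar>jm t\<bar> < \<eta> \<and> \<bar>jp t\<bar> < \<eta>" if "\<eta> > 0" for \<eta>
  proof -
    define \<eta>' where "\<eta>' = min \<eta> \<epsilon>"
    have \<eta>': "0 < \<eta>'" "\<eta>' \<le> \<epsilon>" "\<eta>' \<le> \<eta>" using that \<epsilon> by (auto simp: \<eta>'_def)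
    obtain d where d: "d > 0" "\<And>t. \<bar>t\<bar> < d \<Longrightarrow> k t \<eta>' > 0 \<and> k t (- \<eta>') > 0"
      using ends[of \<eta>'] \<eta>' \<epsilon> by auto
    have "\<bar>jm t\<bar> < \<eta> \<and> \<bar>jp t\<bar> < \<eta>" if t: "0 < - \<sigma> * t" "\<bar>t\<bar> < min d \<delta>" for t
    proof -
      have "- \<sigma> * t < \<delta>" using \<sigma>abs[of t] t by simp
      with j[OF t(1)] d(2)[of t] t \<eta>' have "\<bar>jm t\<bar> < \<eta>' \<and> \<bar>jp t\<bar> < \<eta>'" by auto
      then show ?thesis using \<eta>' by auto
    qed
    moreover have "min d \<delta> > 0" using d(1) \<delta>(1) by simp
    ultimately show ?thesis by blast
  qed
  have lim: "(h \<longlongrightarrow> 0) (at 0 within {t. 0 < - \<sigma> * t})"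
    if "\<And>\<eta>. \<eta> > 0 \<Longrightarrow> \<exists>d>0. \<forall>t. 0 < - \<sigma> * t \<and> \<bar>t\<bar> < d \<longrightarrow> \<bar>h t\<bar> < \<eta>" for h :: "real \<Rightarrow> real"
  proof (rule tendstoI)
    fix \<eta> :: real assume "\<eta> > 0"
    from that[OF this] show "\<forall>\<^sub>F t in at 0 within {t. 0 < - \<sigma> * t}. dist (h t) 0 < \<eta>"
      unfolding eventually_at by (auto simp: dist_real_def)
  qed
  show thesis
  proof (rule that[OF \<sigma> \<epsilon>(1,3) \<delta>(1,3)])
    show "N j t \<noteq> 0" if "0 < \<sigma> * t" "\<sigma> * t < \<delta>" "\<bar>j\<bar> < \<epsilon>" for j t
    proof -
      have "\<bar>t\<bar> < \<delta>" using \<sigma>abs[of t] that by linarith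
      moreover have "t \<noteq> 0" using that by auto
      ultimately have "(\<sigma> * t) * (k t j - k 0 j) > 0" using shift[of j t] that \<delta> \<epsilon> by auto
      then have "k t j > k 0 j" using that(1) zero_less_mult_iff[of "\<sigma> * t" "k t j - k 0 j"] by auto
      moreover have "k 0 j \<ge> 0" using k0_pos[of j] that \<epsilon> N0 by (cases "j = 0") (auto simp: k_def)
      ultimately show ?thesis by (simp add: zero_iff)
    qed
    show "j = 0" if "\<bar>j\<bar> < \<epsilon>" "N j 0 = 0" for j
      using k0_pos[of j] that \<epsilon> by (auto simp: zero_iff)
    show "jm t \<noteq> jp t \<and> {j. \<bar>j\<bar> < \<epsilon> \<and> N j t = 0} = {jm t, jp t} \<and>
       deriv (\<lambda>j. N j t) (jm t) \<noteq> 0 \<and> deriv (\<lambda>j. N j t) (jp t) \<noteq> 0"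
      if "0 < - \<sigma> * t" "- \<sigma> * t < \<delta>" for t
      using j[OF that] by (simp add: Nq)
    show "(jm \<longlongrightarrow> 0) (at 0 within {t. 0 < - \<sigma> * t})" "(jp \<longlongrightarrow> 0) (at 0 within {t. 0 < - \<sigma> * t})"
      by (rule lim, use small in blast)+
  qed
qed

section \<open>Flips along the fold: the double flip bifurcation\<close>

theorem theorem3p6:
  fixes a b :: real
    and \<nu>1 \<nu>2 :: "real \<Rightarrow> real \<Rightarrow> real"
    and f :: "real \<Rightarrow> real \<Rightarrow> real \<Rightarrow> real \<Rightarrow> real"
    and \<phi> :: "real \<Rightarrow> real \<Rightarrow> real \<Rightarrow> real \<Rightarrow> real \<times> real"
  assumes a: "a \<noteq> 0" and b: "b \<noteq> 0"
    and nu_smooth: "smooth (\<lambda>(j, t). \<nu>1 j t)" "smooth (\<lambda>(j, t). \<nu>2 j t)"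
    and nu_zero: "\<nu>1 0 0 = 0" "\<nu>2 0 0 = 0"
    and nu1_j: "deriv (\<lambda>j. \<nu>1 j 0) 0 = 0"
    and nu1_jj: "deriv (deriv (\<lambda>j. \<nu>1 j 0)) 0 \<noteq> 0"
    and nu1_t: "deriv (\<lambda>t. \<nu>1 0 t) 0 \<noteq> 0"
    and f_smooth: "smooth (\<lambda>((j, t), (q, p)). f j t q p)"
    and f_sym: "\<And>j t q p. f j t (- q) (- p) = f j t q p"
    and phi_smooth: "smooth (\<lambda>((j, t), (q, p)). fst (\<phi> j t q p))"
                    "smooth (\<lambda>((j, t), (q, p)). snd (\<phi> j t q p))"
    and coord_change: "\<exists>\<rho>>0. \<forall>j t. \<bar>j\<bar> < \<rho> \<and> \<bar>t\<bar> < \<rho> \<longrightarrow>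
         \<phi> j t 0 0 = (0, 0) \<and>
         dq (\<lambda>q p. fst (\<phi> j t q p)) 0 0 * dp (\<lambda>q p. snd (\<phi> j t q p)) 0 0
           - dp (\<lambda>q p. fst (\<phi> j t q p)) 0 0 * dq (\<lambda>q p. snd (\<phi> j t q p)) 0 0 \<noteq> 0 \<and>
         same_jet_at0 6 (\<lambda>q p. f j t (fst (\<phi> j t q p)) (snd (\<phi> j t q p)))
                        (Hnf a b \<nu>1 \<nu>2 j t)"
  shows "double_flip f \<and>
    (\<exists>\<delta>>0. \<exists>\<epsilon>>0. \<forall>\<tau> j0. \<bar>\<tau>\<bar> < \<delta> \<and> \<bar>j0\<bar> < \<epsilon> \<and> \<nu>1 j0 \<tau> = 0 \<and> \<nu>2 j0 \<tau> \<noteq> 0 \<longrightarrow>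
        (a * \<nu>2 j0 \<tau> < 0 \<longrightarrow> dual_ham_flip (\<lambda>j. f j \<tau>) j0) \<and>
        (a * \<nu>2 j0 \<tau> > 0 \<longrightarrow> ham_flip (\<lambda>j. f j \<tau>) j0))"
proof -
  obtain \<rho> where \<rho>: "\<rho> > 0" and cc: "\<And>j t. \<bar>j\<bar> < \<rho> \<Longrightarrow> \<bar>t\<bar> < \<rho> \<Longrightarrow>
         \<phi> j t 0 0 = (0, 0) \<and>
         dq (\<lambda>q p. fst (\<phi> j t q p)) 0 0 * dp (\<lambda>q p. snd (\<phi> j t q p)) 0 0
           - dp (\<lambda>q p. fst (\<phi> j t q p)) 0 0 * dq (\<lambda>q p. snd (\<phi> j t q p)) 0 0 \<noteq> 0 \<and>
         same_jet_at0 6 (\<lambda>q p. f j t (fst (\<phi> j t q p)) (snd (\<phi> j t q p)))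
                        (Hnf a b \<nu>1 \<nu>2 j t)"
    using coord_change by blast
  have slice: "smooth_family (\<lambda>j q p. H j t q p)" if "smooth (\<lambda>((j, t), (q, p)). H j t q p)"
    for H :: "real \<Rightarrow> real \<Rightarrow> real \<Rightarrow> real \<Rightarrow> real" and t
    using smooth_compose4[OF that smooth_proj(1) smooth_const smooth_proj(2,3), of t]
    by (simp add: smooth_family_def case_prod_unfold)
  have slice2: "smooth (\<lambda>j. H j t)" if "smooth (\<lambda>(j, t). H j t)"
    for H :: "real \<Rightarrow> real \<Rightarrow> real" and t
    using smooth_compose2[OF that smooth_bounded_linear[OF bounded_linear_ident] smooth_const, of t] by simp
  \<comment> \<open>Recentring at \<open>j\<close> leaves the width \<open>\<rho> - |j|\<close>. The
    coordinate change is read as a map from the normal form coordinates to the original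
    ones.\<close>
  have nf: "normal_form_family a b (\<lambda>j. \<nu>1 j t) (\<lambda>j. \<nu>2 j t) (\<lambda>j. f j t)
      (\<lambda>j q p. fst (\<phi> j t q p)) (\<lambda>j q p. snd (\<phi> j t q p)) j (\<rho> - \<bar>j\<bar>)"
    if "\<bar>j\<bar> < \<rho>" "\<bar>t\<bar> < \<rho>" for j t
  proof
    have near: "\<bar>i\<bar> < \<rho>" if "\<bar>i - j\<bar> < \<rho> - \<bar>j\<bar>" for i using that by linarith
    show "smooth_family (\<lambda>j. f j t)" "smooth_family (\<lambda>j q p. fst (\<phi> j t q p))"
      "smooth_family (\<lambda>j q p. snd (\<phi> j t q p))"
      using slice[OF f_smooth] slice[OF phi_smooth(1)] slice[OF phi_smooth(2)] .
    show "fst (\<phi> i t 0 0) = 0" "snd (\<phi> i t 0 0) = 0"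
      "dq (\<lambda>q p. fst (\<phi> i t q p)) 0 0 * dp (\<lambda>q p. snd (\<phi> i t q p)) 0 0 -
        dp (\<lambda>q p. fst (\<phi> i t q p)) 0 0 * dq (\<lambda>q p. snd (\<phi> i t q p)) 0 0 \<noteq> 0"
      "same_jet_at0 6 (\<lambda>q p. f i t (fst (\<phi> i t q p)) (snd (\<phi> i t q p)))
        (\<lambda>q p. a / 2 * p ^ 2 + b / 6 * q ^ 6 + \<nu>1 i t / 2 * q ^ 2 + \<nu>2 i t / 4 * q ^ 4)"
      if "\<bar>i - j\<bar> < \<rho> - \<bar>j\<bar>" for i
      using cc[OF near[OF that] \<open>\<bar>t\<bar> < \<rho>\<close>] by (simp_all add: Hnf_def[abs_def])
  qed (use a b that slice2[OF nu_smooth(1)] slice2[OF nu_smooth(2)] in auto)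
  obtain \<sigma> \<epsilon> \<delta> :: real and jm jp where \<sigma>: "\<sigma> \<in> {-1, 1}" and \<epsilon>: "0 < \<epsilon>" "\<epsilon> \<le> \<rho>" and \<delta>: "0 < \<delta>" "\<delta> \<le> \<rho>"
    and no_zero: "\<And>j t. 0 < \<sigma> * t \<Longrightarrow> \<sigma> * t < \<delta> \<Longrightarrow> \<bar>j\<bar> < \<epsilon> \<Longrightarrow> \<nu>1 j t \<noteq> 0"
    and zero0: "\<And>j. \<bar>j\<bar> < \<epsilon> \<Longrightarrow> \<nu>1 j 0 = 0 \<Longrightarrow> j = 0"
    and zeros: "\<And>t. 0 < - \<sigma> * t \<Longrightarrow> - \<sigma> * t < \<delta> \<Longrightarrow>
       jm t \<noteq> jp t \<and> {j. \<bar>j\<bar> < \<epsilon> \<and> \<nu>1 j t = 0} = {jm t, jp t} \<and>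
       deriv (\<lambda>j. \<nu>1 j t) (jm t) \<noteq> 0 \<and> deriv (\<lambda>j. \<nu>1 j t) (jp t) \<noteq> 0"
    and lim: "(jm \<longlongrightarrow> 0) (at 0 within {t. 0 < - \<sigma> * t})" "(jp \<longlongrightarrow> 0) (at 0 within {t. 0 < - \<sigma> * t})"
    by (rule fold_zeros[OF nu_smooth(1) nu_zero(1) nu1_j nu1_jj nu1_t \<rho>]) blast
  have \<sigma>abs: "\<bar>\<sigma> * t\<bar> = \<bar>t\<bar>" for t using \<sigma> by auto
  have no_flip: "\<not> ham_flip (\<lambda>j. f j t) j \<and> \<not> dual_ham_flip (\<lambda>j. f j t) j"
    if "\<bar>j\<bar> < \<epsilon>" "\<bar>t\<bar> < \<delta>" "\<nu>1 j t \<noteq> 0" for j t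
    using normal_form_family.no_flip[OF nf[of j t]] that \<epsilon> \<delta> by auto
  have simple_zero: "deriv (\<lambda>j. \<nu>1 j t) j \<noteq> 0" if "\<bar>j\<bar> < \<epsilon>" "0 < - \<sigma> * t" "- \<sigma> * t < \<delta>" "\<nu>1 j t = 0" for j t
  proof -
    have "j \<in> {jm t, jp t}" using zeros[OF that(2,3)] that(1,4) by blast
    then show ?thesis using zeros[OF that(2,3)] by auto
  qed
  have flip: "\<exists>\<kappa>. \<kappa> \<noteq> 0 \<and> (\<nu>2 j t \<noteq> 0 \<longrightarrow> \<kappa> = \<nu>2 j t) \<and>
      (a * \<kappa> > 0 \<longrightarrow> ham_flip (\<lambda>j. f j t) j) \<and> (a * \<kappa> < 0 \<longrightarrow> dual_ham_flip (\<lambda>j. f j t) j)"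
    if "\<bar>j\<bar> < \<epsilon>" "0 < - \<sigma> * t" "- \<sigma> * t < \<delta>" "\<nu>1 j t = 0" for j t
  proof -
    have "\<bar>t\<bar> < \<delta>" using \<sigma>abs[of t] that(2,3) by simp
    then have "\<bar>j\<bar> < \<rho>" "\<bar>t\<bar> < \<rho>" using that(1) \<epsilon> \<delta> by auto
    from normal_form_family.flip_at_simple_zero[OF nf[OF this] that(4) simple_zero[OF that]]
    show ?thesis by metis
  qed
  have "double_flip f"
    unfolding double_flip_def
  proof (rule bexI[OF _ \<sigma>], rule exI[of _ \<epsilon>], rule conjI[OF \<epsilon>(1)], rule exI[of _ \<delta>], intro conjI)
    show "0 < \<delta>" by fact
    show "\<forall>t. 0 < \<sigma> * t \<and> \<sigma> * t < \<delta> \<longrightarrow>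
        \<not> (\<exists>j. \<bar>j\<bar> < \<epsilon> \<and> (ham_flip (\<lambda>j. f j t) j \<or> dual_ham_flip (\<lambda>j. f j t) j))"
    proof (intro allI impI)
      fix t assume t: "0 < \<sigma> * t \<and> \<sigma> * t < \<delta>"
      then have "\<bar>t\<bar> < \<delta>" using \<sigma>abs[of t] by simp
      then show "\<not> (\<exists>j. \<bar>j\<bar> < \<epsilon> \<and> (ham_flip (\<lambda>j. f j t) j \<or> dual_ham_flip (\<lambda>j. f j t) j))"
        using no_flip no_zero t by blast
    qed
    \<comment> \<open>Off the zeros of \<open>\<nu>1\<close> there is no flip. Each zero is a flip
      of one kind or the other because \<open>a * \<kappa>\<close> is non-zero, even if
      \<open>\<nu>2\<close> vanishes there.\<close>
    have "{j. \<bar>j\<bar> < \<epsilon> \<and> (ham_flip (\<lambda>j. f j t) j \<or> dual_ham_flip (\<lambda>j. f j t) j)} = {j. \<bar>j\<bar> < \<epsilon> \<and> \<nu>1 j t = 0}"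
      if t: "0 < - \<sigma> * t" "- \<sigma> * t < \<delta>" for t
    proof -
      have "\<bar>t\<bar> < \<delta>" using \<sigma>abs[of t] t by simp
      have "ham_flip (\<lambda>j. f j t) j \<or> dual_ham_flip (\<lambda>j. f j t) j \<longleftrightarrow> \<nu>1 j t = 0" if "\<bar>j\<bar> < \<epsilon>" for j
      proof
        show "\<nu>1 j t = 0" if "ham_flip (\<lambda>j. f j t) j \<or> dual_ham_flip (\<lambda>j. f j t) j"
          using that no_flip[OF \<open>\<bar>j\<bar> < \<epsilon>\<close> \<open>\<bar>t\<bar> < \<delta>\<close>] by blast
        show "ham_flip (\<lambda>j. f j t) j \<or> dual_ham_flip (\<lambda>j. f j t) j" if z: "\<nu>1 j t = 0"
        proof -
          obtain \<kappa> where "\<kappa> \<noteq> 0" "a * \<kappa> > 0 \<longrightarrow> ham_flip (\<lambda>j. f j t) j" "a * \<kappa> < 0 \<longrightarrow> dual_ham_flip (\<lambda>j. f j t) j"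
            using flip[OF \<open>\<bar>j\<bar> < \<epsilon>\<close> t z] by blast
          moreover have "a * \<kappa> \<noteq> 0" using a \<open>\<kappa> \<noteq> 0\<close> by simp
          ultimately show ?thesis by (meson linorder_neqE)
        qed
      qed
      then show ?thesis by blast
    qed
    then show "\<exists>jm jp. (\<forall>t. 0 < - \<sigma> * t \<and> - \<sigma> * t < \<delta> \<longrightarrow> jm t \<noteq> jp t \<and>
           {j. \<bar>j\<bar> < \<epsilon> \<and> (ham_flip (\<lambda>j. f j t) j \<or> dual_ham_flip (\<lambda>j. f j t) j)} = {jm t, jp t}) \<and>
        (jm \<longlongrightarrow> 0) (at 0 within {t. 0 < - \<sigma> * t}) \<and> (jp \<longlongrightarrow> 0) (at 0 within {t. 0 < - \<sigma> * t})"
      using zeros lim by (intro exI[of _ jm] exI[of _ jp]) simp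
  qed
  moreover have "(a * \<nu>2 j0 \<tau> < 0 \<longrightarrow> dual_ham_flip (\<lambda>j. f j \<tau>) j0) \<and>
        (a * \<nu>2 j0 \<tau> > 0 \<longrightarrow> ham_flip (\<lambda>j. f j \<tau>) j0)"
    if h: "\<bar>\<tau>\<bar> < \<delta> \<and> \<bar>j0\<bar> < \<epsilon> \<and> \<nu>1 j0 \<tau> = 0 \<and> \<nu>2 j0 \<tau> \<noteq> 0" for \<tau> j0
  proof -
    \<comment> \<open>For \<open>t = 0\<close> the only nearby zero of \<open>\<nu>1\<close> is the
      degenerate one at \<open>j = 0\<close>, which \<open>\<nu>2 j0 \<tau> \<noteq> 0\<close> rules
      out. The existence of a zero then places \<open>\<tau>\<close> on the side with two simple
      zeros.\<close>
    have "\<tau> \<noteq> 0" using h zero0[of j0] nu_zero(2) by auto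
    have "\<not> 0 < \<sigma> * \<tau>" using no_zero[of \<tau> j0] h \<sigma>abs[of \<tau>] by auto
    then have "0 < - \<sigma> * \<tau>" "- \<sigma> * \<tau> < \<delta>"
      using \<open>\<tau> \<noteq> 0\<close> \<sigma> h by auto
    then show ?thesis using flip[of j0 \<tau>] h by blast
  qed
  ultimately show ?thesis
    using \<epsilon>(1) \<delta>(1) by blast
qed

end
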